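(* Let $\{(x^k,y^k,z^k)\}_{k\ge0}$ be generated by SiPBA with $$\alpha_k=\alpha_0(k+1)^{-s},\quad \beta_k=\beta_0(k+1)^{-3t},\quad \sigma_k=\sigma_0(k+1)^{-t},\quad \delta_k=\delta_0(k+1)^{-t},\quad \rho_k=\rho_0(k+1)^{t},$$ where $\alpha_0,\beta_0,\sigma_0,\delta_0,\rho_0>0$ and $s,t>0$. Suppose that $\phi$ is bounded below on $X$, that $s>7t$ and $s+2t<1$, and that $\beta_0/\sigma_0$ is sufficiently small (below a positive threshold depending on the problem data and the other parameter constants). Then there exists a subsequence $\{k_j\}$ such that $$\mathcal G_{k_j}(x^{k_j})\to0,\qquad (y^{k_j},z^{k_j})-\bigl(y_{k_j}^*(x^{k_j}),z_{k_j}^*(x^{k_j})\bigr)\to0.$$ Let $(\bar x,\bar y)$ be any accumulation pair of $\{(x^{k_j},y_{k_j}^*(x^{k_j}))\}$. Suppose, in addition, that $X=\{x\in\mathbb R^n:G(x)\le0\}$ and $Y=\{y\in\mathbb R^m:g(y)\le0\}$, where $G:\mathbb R^n\to\mathbb R^q$ is continuously differentiable with convex components and $g:\mathbb R^m\to\mathbb R^p$ is twice continuously differentiable with convex components. Assume further that $\mathcal S$ is inner semicontinuous at $\bar x$; that $f$ is twice continuously differentiable in a neighborhood of $(\bar x,\bar y)$; that upper-level MFCQ holds at $\bar x$; and that lower-level LICQ and the uniform parametric error bound hold at $(\bar x,\bar y)$. Then, along the corresponding (further) subsequence, $$x^{k_j}\to\bar x,\qquad (y^{k_j},z^{k_j})\to(\bar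 y,\bar y),\qquad \bar y\in\mathcal S_p(\bar x),$$ and $\bar x$ is a C-stationary point of the pessimistic bilevel problem $\min_{x\in X}\max_{y\in\mathcal S(x)}F(x,y)$.
   Context: $X\subseteq\mathbb R^n$ and $Y\subseteq\mathbb R^m$ are nonempty, closed and convex, and $F,f:\mathbb R^n\times\mathbb R^m\to\mathbb R$. For $x\in X$ let $\mathcal S(x):=\arg\min_{y\in Y}f(x,y)$. $N_C$ is the normal cone of convex analysis and $\operatorname{Proj}_C$ the Euclidean projection. Standing assumptions. (A1) $F$ is continuously differentiable and $\nabla F$ is Lipschitz continuous on $X\times Y$. For every $x\in X$, $F(x,\cdot)$ is concave on $Y$ and $-F(x,\cdot)$ is coercive on $Y$, i.e. $\lim_{\|y\|\to\infty,\,y\in Y}F(x,y)=-\infty$. (A2) $f$ is continuously differentiable and $\nabla f$ is Lipschitz continuous on $X\times Y$. For every $x\in X$, $f(x,\cdot)$ is convex on $Y$ and $\mathcal S(x)\neq\emptyset$. For every bounded set $D_x\subseteq X$ there is a bounded set $D_y\subseteq Y$ with $\mathcal S(x)\cap D_y\neq\emptyset$ for every $x\in D_x$. (A4) $X$ is compact. $\phi(x):=\max_{y\in\mathcal S(x)}F(x,y)$ and $\mathcal S_p(x):=\arg\max_{y\in\mathcal S(x)}F(x,y)$ for $x\in X$. $\mathcal S$ is inner semicontinuous at $\bar x\in X$ if for every $\bar y\in\mathcal S(\bar x)$ and every $\{x_k\}\subset X$ with $x_k\to\bar x$ there are $y_k\in\mathcal S(x_k)$ with $y_k\to\bar y$.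 Smooth approximation. For positive parameters $\rho_k,\sigma_k,\delta_k$, $$\psi_k(x,y,z):=F(x,y)-\rho_k\bigl(f(x,y)-f(x,z)\bigr)+\tfrac{\sigma_k}{2}\|z\|^2-\sigma_k\langle y,z\rangle-\tfrac{\delta_k}{2}\|y\|^2,\quad \phi_k(x):=\min_{z\in Y}\max_{y\in Y}\psi_k(x,y,z).$$ For each $x\in X$ this minimax problem has a unique saddle point $(y_k^*(x),z_k^*(x))\in Y\times Y$, and $\phi_k$ is differentiable with $\nabla\phi_k(x)=\nabla_x\psi_k(x,y_k^*(x),z_k^*(x))$. SiPBA. From $(x^0,y^0,z^0)\in X\times Y\times Y$, for $k=0,1,2,\dots$ set $y^{k+1}=\operatorname{Proj}_Y(y^k+\beta_kd_y^k)$, $z^{k+1}=\operatorname{Proj}_Y(z^k-\beta_kd_z^k)$, $x^{k+1}=\operatorname{Proj}_X(x^k-\alpha_kd_x^k)$, where $d_y^k=\nabla_yF(x^k,y^k)-\rho_k\nabla_yf(x^k,y^k)-\sigma_kz^k-\delta_ky^k$, $d_z^k=\rho_k\nabla_yf(x^k,z^k)+\sigma_k(z^k-y^k)$, and $d_x^k=\nabla_xF(x^k,y^{k+1})-\rho_k\bigl(\nabla_xf(x^k,y^{k+1})-\nabla_xf(x^k,z^{k+1})\bigr)$. Projected-gradient mapping: $\mathcal G_k(x):=\frac1{\alpha_k}\bigl(x-\operatorname{Proj}_X(x-\alpha_k\nabla\phi_k(x))\bigr)$. Multipliers and qualifications (with $X=\{G\le0\}$, $Y=\{g\le0\}$). For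 vector-valued maps $\nabla$ denotes the Jacobian; for scalar functions the gradient column vector. $\mathcal L(x,y,\mu):=\nabla_yf(x,y)+\nabla g(y)^\top\mu\in\mathbb R^m$, with Jacobians $\nabla_x\mathcal L\in\mathbb R^{m\times n}$, $\nabla_y\mathcal L\in\mathbb R^{m\times m}$. $\Lambda(x,y):=\{\mu\in\mathbb R^p:\mathcal L(x,y,\mu)=0,\ \mu\ge0,\ g(y)\le0,\ \mu^\top g(y)=0\}$. - Upper-level MFCQ at $\bar x$: $\pi\ge0$, $\pi^\top G(\bar x)=0$, $\nabla G(\bar x)^\top\pi=0$ imply $\pi=0$. - Lower-level LICQ at $(\bar x,y)$, $y\in\mathcal S(\bar x)$: the vectors $\{\nabla g_i(y):g_i(y)=0\}$ are linearly independent. - Uniform parametric error bound at $(\bar x,\bar y)$, $\bar y\in\mathcal S(\bar x)$: there are neighborhoods $U$ of $\bar x$, $V$ of $\bar y$ and $\kappa>0$ with $\operatorname{dist}(y,\mathcal S(x))\le\kappa\operatorname{dist}(0,\nabla_yf(x,y)+N_Y(y))$ for all $x\in X\cap U$, $y\in Y\cap V$. C-stationarity. A feasible $\bar x$ is C-stationary if there exist $\bar y\in\mathcal S_p(\bar x)$, $\bar\mu\in\Lambda(\bar x,\bar y)$, $\pi\in\mathbb R^q$, $\omega\in\mathbb R^p$, $\gamma\in\mathbb R^m$ such that $$\nabla_xF(\bar x,\bar y)+\nabla_x\mathcal L(\bar x,\bar y,\bar\mu)^\top\gamma+\nabla G(\bar x)^\top\pi=0,\qquad \nabla_yF(\bar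 x,\bar y)+\nabla_y\mathcal L(\bar x,\bar y,\bar\mu)^\top\gamma+\nabla g(\bar y)^\top\omega=0,$$ $\pi\ge0$, $\pi^\top G(\bar x)=0$, $\omega_i=0$ for $i\in\mathcal I_1$, $\nabla g_i(\bar y)^\top\gamma=0$ for $i\in\mathcal I_3$, and $\omega_i\nabla g_i(\bar y)^\top\gamma\ge0$ for $i\in\mathcal I_2$, where $\mathcal I_1=\{i:\bar\mu_i=0,g_i(\bar y)<0\}$, $\mathcal I_2=\{i:\bar\mu_i=0,g_i(\bar y)=0\}$, $\mathcal I_3=\{i:\bar\mu_i>0,g_i(\bar y)=0\}$. *)

theory Defs
  imports "HOL-Analysis.Analysis"
begin

section \<open>Smoothness\<close>

text \<open>
  The gradient vector with respect to a filter, in the style of \<^const>\<open>frechet_derivative\<close>. For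
  the filter \<open>at x\<close> it is the vector \<open>D\<close> of \<open>GDERIV f x :> D\<close>.
\<close>
definition gradient :: "('a::real_inner \<Rightarrow> real) \<Rightarrow> 'a filter \<Rightarrow> 'a" where
  "gradient f net = (SOME v. (f has_derivative (\<lambda>h. inner h v)) net)"

text \<open>The following two notions are meant for open \<open>S\<close>.\<close>
definition C1_on :: "('a::real_normed_vector \<Rightarrow> 'b::real_normed_vector) \<Rightarrow> 'a set \<Rightarrow> bool" where
  "C1_on f S \<longleftrightarrow>
     (\<exists>f' :: 'a \<Rightarrow> 'a \<Rightarrow>\<^sub>L 'b.
        (\<forall>x\<in>S. (f has_derivative blinfun_apply (f' x)) (at x)) \<and> continuous_on S f')"

definition C2_on :: "('a::real_normed_vector \<Rightarrow> 'b::real_normed_vector) \<Rightarrow> 'a set \<Rightarrow> bool" where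
  "C2_on f S \<longleftrightarrow>
     (\<exists>f' :: 'a \<Rightarrow> 'a \<Rightarrow>\<^sub>L 'b.
        (\<forall>x\<in>S. (f has_derivative blinfun_apply (f' x)) (at x)) \<and> C1_on f' S)"

abbreviation grad_x :: "('a::real_inner \<times> 'b \<Rightarrow> real) \<Rightarrow> 'a \<Rightarrow> 'b \<Rightarrow> 'a" where
  "grad_x F x y \<equiv> gradient (\<lambda>x'. F (x', y)) (at x)"

abbreviation grad_y :: "('a \<times> 'b::real_inner \<Rightarrow> real) \<Rightarrow> 'a \<Rightarrow> 'b \<Rightarrow> 'b" where
  "grad_y F x y \<equiv> gradient (\<lambda>y'. F (x, y')) (at y)"


section \<open>The pessimistic bilevel problem\<close>

definition lower_sol :: "'b set \<Rightarrow> ('a \<times> 'b \<Rightarrow> real) \<Rightarrow> 'a \<Rightarrow> 'b set" where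
  "lower_sol Y f x = {y. is_arg_min (\<lambda>y. f (x, y)) (\<lambda>y. y \<in> Y) y}"

definition pess_sol :: "'b set \<Rightarrow> ('a \<times> 'b \<Rightarrow> real) \<Rightarrow> ('a \<times> 'b \<Rightarrow> real) \<Rightarrow> 'a \<Rightarrow> 'b set" where
  "pess_sol Y F f x = {y. is_arg_max (\<lambda>y. F (x, y)) (\<lambda>y. y \<in> lower_sol Y f x) y}"

definition pess_value :: "'b set \<Rightarrow> ('a \<times> 'b \<Rightarrow> real) \<Rightarrow> ('a \<times> 'b \<Rightarrow> real) \<Rightarrow> 'a \<Rightarrow> real" where
  "pess_value Y F f x = (SUP y\<in>lower_sol Y f x. F (x, y))"

definition inner_semicontinuous_at ::
    "'a::topological_space set \<Rightarrow> ('a \<Rightarrow> 'b::topological_space set) \<Rightarrow> 'a \<Rightarrow> bool" where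
  "inner_semicontinuous_at X S xb \<longleftrightarrow>
     (\<forall>yb\<in>S xb. \<forall>u. (\<forall>k. u k \<in> X) \<and> u \<longlonglongrightarrow> xb \<longrightarrow>
        (\<exists>v. (\<forall>k. v k \<in> S (u k)) \<and> v \<longlonglongrightarrow> yb))"


section \<open>The smooth approximation\<close>

definition psi ::
    "('a \<times> 'b::real_inner \<Rightarrow> real) \<Rightarrow> ('a \<times> 'b \<Rightarrow> real) \<Rightarrow>
     real \<Rightarrow> real \<Rightarrow> real \<Rightarrow> 'a \<Rightarrow> 'b \<Rightarrow> 'b \<Rightarrow> real" where
  "psi F f \<rho> \<sigma> \<delta> x y z =
     F (x, y) - \<rho> * (f (x, y) - f (x, z))
       + \<sigma> / 2 * (norm z)\<^sup>2 - \<sigma> * inner y z - \<delta> / 2 * (norm y)\<^sup>2"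

definition phi_approx ::
    "'b set \<Rightarrow> ('a \<times> 'b::real_inner \<Rightarrow> real) \<Rightarrow> ('a \<times> 'b \<Rightarrow> real) \<Rightarrow>
     real \<Rightarrow> real \<Rightarrow> real \<Rightarrow> 'a \<Rightarrow> real" where
  "phi_approx Y F f \<rho> \<sigma> \<delta> x = (INF z\<in>Y. SUP y\<in>Y. psi F f \<rho> \<sigma> \<delta> x y z)"

text \<open>The maximisation is over the first argument \<open>y\<close>, the minimisation over the second.\<close>
definition is_saddle_point :: "'b set \<Rightarrow> ('b \<Rightarrow> 'b \<Rightarrow> real) \<Rightarrow> 'b \<times> 'b \<Rightarrow> bool" where
  "is_saddle_point Y h p \<longleftrightarrow>
     fst p \<in> Y \<and> snd p \<in> Y \<and>
     (\<forall>y\<in>Y. h y (snd p) \<le> h (fst p) (snd p)) \<and>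
     (\<forall>z\<in>Y. h (fst p) (snd p) \<le> h (fst p) z)"

definition saddle_point ::
    "'b set \<Rightarrow> ('a \<times> 'b::real_inner \<Rightarrow> real) \<Rightarrow> ('a \<times> 'b \<Rightarrow> real) \<Rightarrow>
     real \<Rightarrow> real \<Rightarrow> real \<Rightarrow> 'a \<Rightarrow> 'b \<times> 'b" where
  "saddle_point Y F f \<rho> \<sigma> \<delta> x = (THE p. is_saddle_point Y (psi F f \<rho> \<sigma> \<delta> x) p)"

text \<open>
  The approximate value function is only under control on \<open>X\<close>, so its gradient is taken within \<open>X\<close>.
  If \<open>X\<close> has empty interior, this gradient is determined only up to a vector orthogonal to the
  affine hull of \<open>X\<close>; adding such a vector does not change the projection onto \<open>X\<close> below.
\<close>
definition proj_grad_map ::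
    "'a set \<Rightarrow> 'b set \<Rightarrow> ('a::euclidean_space \<times> 'b::euclidean_space \<Rightarrow> real) \<Rightarrow>
     ('a \<times> 'b \<Rightarrow> real) \<Rightarrow> real \<Rightarrow> real \<Rightarrow> real \<Rightarrow> real \<Rightarrow> 'a \<Rightarrow> 'a" where
  "proj_grad_map X Y F f \<alpha> \<rho> \<sigma> \<delta> x =
     (1 / \<alpha>) *\<^sub>R
       (x - closest_point X (x - \<alpha> *\<^sub>R gradient (phi_approx Y F f \<rho> \<sigma> \<delta>) (at x within X)))"


section \<open>The algorithm\<close>

definition SiPBA ::
    "'a set \<Rightarrow> 'b set \<Rightarrow> ('a::euclidean_space \<times> 'b::euclidean_space \<Rightarrow> real) \<Rightarrow>
     ('a \<times> 'b \<Rightarrow> real) \<Rightarrow>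
     (nat \<Rightarrow> real) \<Rightarrow> (nat \<Rightarrow> real) \<Rightarrow> (nat \<Rightarrow> real) \<Rightarrow> (nat \<Rightarrow> real) \<Rightarrow> (nat \<Rightarrow> real) \<Rightarrow>
     (nat \<Rightarrow> 'a) \<Rightarrow> (nat \<Rightarrow> 'b) \<Rightarrow> (nat \<Rightarrow> 'b) \<Rightarrow> bool" where
  "SiPBA X Y F f \<alpha> \<beta> \<rho> \<sigma> \<delta> x y z \<longleftrightarrow>
     x 0 \<in> X \<and> y 0 \<in> Y \<and> z 0 \<in> Y \<and>
     (\<forall>k.
        let dy = grad_y F (x k) (y k) - \<rho> k *\<^sub>R grad_y f (x k) (y k)
                   - \<sigma> k *\<^sub>R z k - \<delta> k *\<^sub>R y k;
            dz = \<rho> k *\<^sub>R grad_y f (x k) (z k) + \<sigma> k *\<^sub>R (z k - y k);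
            dx = grad_x F (x k) (y (Suc k))
                   - \<rho> k *\<^sub>R (grad_x f (x k) (y (Suc k)) - grad_x f (x k) (z (Suc k)))
        in y (Suc k) = closest_point Y (y k + \<beta> k *\<^sub>R dy) \<and>
           z (Suc k) = closest_point Y (z k - \<beta> k *\<^sub>R dz) \<and>
           x (Suc k) = closest_point X (x k - \<alpha> k *\<^sub>R dx))"

definition stationary_subseq ::
    "'a set \<Rightarrow> 'b set \<Rightarrow> ('a::euclidean_space \<times> 'b::euclidean_space \<Rightarrow> real) \<Rightarrow>
     ('a \<times> 'b \<Rightarrow> real) \<Rightarrow>
     (nat \<Rightarrow> real) \<Rightarrow> (nat \<Rightarrow> real) \<Rightarrow> (nat \<Rightarrow> real) \<Rightarrow> (nat \<Rightarrow> real) \<Rightarrow>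
     (nat \<Rightarrow> 'a) \<Rightarrow> (nat \<Rightarrow> 'b) \<Rightarrow> (nat \<Rightarrow> 'b) \<Rightarrow> (nat \<Rightarrow> nat) \<Rightarrow> bool" where
  "stationary_subseq X Y F f \<alpha> \<rho> \<sigma> \<delta> x y z r \<longleftrightarrow>
     strict_mono r \<and>
     (\<lambda>j. proj_grad_map X Y F f (\<alpha> (r j)) (\<rho> (r j)) (\<sigma> (r j)) (\<delta> (r j)) (x (r j))) \<longlonglongrightarrow> 0 \<and>
     (\<lambda>j. (y (r j), z (r j)) - saddle_point Y F f (\<rho> (r j)) (\<sigma> (r j)) (\<delta> (r j)) (x (r j)))
       \<longlonglongrightarrow> 0"


section \<open>Constraint qualifications and C-stationarity\<close>

definition normal_cone :: "'a::real_inner set \<Rightarrow> 'a \<Rightarrow> 'a set" where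
  "normal_cone C y = (if y \<in> C then {v. \<forall>c\<in>C. inner v (c - y) \<le> 0} else {})"

definition upper_MFCQ :: "(real^'n \<Rightarrow> real^'q) \<Rightarrow> real^'n \<Rightarrow> bool" where
  "upper_MFCQ G xb \<longleftrightarrow>
     (\<forall>\<pi>. (\<forall>i. 0 \<le> \<pi> $ i) \<and> inner \<pi> (G xb) = 0 \<and> transpose (jacobian G (at xb)) *v \<pi> = 0
        \<longrightarrow> \<pi> = 0)"

text \<open>
  Linear independence is that of a family: \<^const>\<open>independent\<close> alone would not see two active
  constraints with the same gradient.
\<close>
definition lower_LICQ :: "(real^'m \<Rightarrow> real^'p) \<Rightarrow> real^'m \<Rightarrow> bool" where
  "lower_LICQ g y \<longleftrightarrow>
     (let A = {i. g y $ i = 0}; dg = (\<lambda>i. gradient (\<lambda>y'. g y' $ i) (at y))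
      in inj_on dg A \<and> independent (dg ` A))"

definition uniform_error_bound ::
    "'a::topological_space set \<Rightarrow> 'b::euclidean_space set \<Rightarrow> ('a \<times> 'b \<Rightarrow> real) \<Rightarrow>
     'a \<Rightarrow> 'b \<Rightarrow> bool" where
  "uniform_error_bound X Y f xb yb \<longleftrightarrow>
     (\<exists>U V \<kappa>. open U \<and> xb \<in> U \<and> open V \<and> yb \<in> V \<and> \<kappa> > 0 \<and>
        (\<forall>x\<in>X \<inter> U. \<forall>y\<in>Y \<inter> V.
           infdist y (lower_sol Y f x)
             \<le> \<kappa> * infdist 0 ((\<lambda>v. grad_y f x y + v) ` normal_cone Y y)))"

definition lower_lagr ::
    "((real^'n) \<times> (real^'m) \<Rightarrow> real) \<Rightarrow> (real^'m \<Rightarrow> real^'p) \<Rightarrow>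
     real^'n \<Rightarrow> real^'m \<Rightarrow> real^'p \<Rightarrow> real^'m" where
  "lower_lagr f g x y \<mu> = grad_y f x y + transpose (jacobian g (at y)) *v \<mu>"

definition multipliers ::
    "((real^'n) \<times> (real^'m) \<Rightarrow> real) \<Rightarrow> (real^'m \<Rightarrow> real^'p) \<Rightarrow>
     real^'n \<Rightarrow> real^'m \<Rightarrow> (real^'p) set" where
  "multipliers f g x y =
     {\<mu>. lower_lagr f g x y \<mu> = 0 \<and> (\<forall>i. 0 \<le> \<mu> $ i) \<and> (\<forall>i. g y $ i \<le> 0) \<and> inner \<mu> (g y) = 0}"

definition C_stationary ::
    "(real^'n) set \<Rightarrow> (real^'m) set \<Rightarrow>
     ((real^'n) \<times> (real^'m) \<Rightarrow> real) \<Rightarrow> ((real^'n) \<times> (real^'m) \<Rightarrow> real) \<Rightarrow>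
     (real^'n \<Rightarrow> real^'q) \<Rightarrow> (real^'m \<Rightarrow> real^'p) \<Rightarrow> real^'n \<Rightarrow> bool" where
  "C_stationary X Y F f G g xb \<longleftrightarrow>
     xb \<in> X \<and>
     (\<exists>yb\<in>pess_sol Y F f xb. \<exists>\<mu>\<in>multipliers f g xb yb. \<exists>\<pi> \<omega> \<gamma>.
        grad_x F xb yb
          + transpose (jacobian (\<lambda>x. lower_lagr f g x yb \<mu>) (at xb)) *v \<gamma>
          + transpose (jacobian G (at xb)) *v \<pi> = 0 \<and>
        grad_y F xb yb
          + transpose (jacobian (\<lambda>y. lower_lagr f g xb y \<mu>) (at yb)) *v \<gamma>
          + transpose (jacobian g (at yb)) *v \<omega> = 0 \<and>
        (\<forall>i. 0 \<le> \<pi> $ i) \<and> inner \<pi> (G xb) = 0 \<and>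
        (\<forall>i. \<mu> $ i = 0 \<and> g yb $ i < 0 \<longrightarrow> \<omega> $ i = 0) \<and>
        (\<forall>i. \<mu> $ i > 0 \<and> g yb $ i = 0 \<longrightarrow>
             inner (gradient (\<lambda>y. g y $ i) (at yb)) \<gamma> = 0) \<and>
        (\<forall>i. \<mu> $ i = 0 \<and> g yb $ i = 0 \<longrightarrow>
             \<omega> $ i * inner (gradient (\<lambda>y. g y $ i) (at yb)) \<gamma> \<ge> 0))"

end

theory Submission
  imports Defs
begin

text \<open>
  For fixed parameters the saddle point is the solution of a variational inequality with a
  strongly monotone Lipschitz operator on \<open>Y \<times> Y\<close>, and one step of the algorithm in \<open>(y, z)\<close> is one
  projected step for that operator. With \<open>e\<^sub>k\<close> the distance of \<open>(y\<^sup>k, z\<^sup>k)\<close> to the saddle point at \<open>x\<^sup>k\<close>,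
  the merit function \<open>\<phi>\<^sub>k(x\<^sup>k) + (k + 1) powr (- t) * e\<^sub>k\<^sup>2\<close> decreases up to summable errors, so the decrements
  are summable and are \<open>o(1 / k)\<close> along a subsequence.

  In the limit, inner semicontinuity brings \<open>z\<close> to the limit of \<open>y\<close>, because \<open>z\<close> is a proximal
  point of \<open>y\<close>. The error bound makes \<open>\<rho>\<^sub>k (z - y)\<close> bounded; its limit is the multiplier \<open>\<gamma>\<close> of C-stationarity. The
  multipliers of the constraints come from Fritz John conditions, which MFCQ and LICQ keep
  bounded. The sign condition on the biactive set is the monotonicity inequality
  \<open>(\<nu>\<^sub>i - \<mu>\<^sub>i) (g\<^sub>i(z) - g\<^sub>i(y)) \<ge> 0\<close> of complementary pairs.
\<close>

section \<open>Projections, gradients and convexity\<close>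

text \<open>The obstacle is that the conditioning degrades along the run: the Lipschitz constant of
  the operator grows like (k + 1)^t with \<rho>, while its monotonicity modulus decays like (k +
  1)^(-t) with \<sigma> and \<delta>. A projected step of length \<beta> contracts well if \<beta>
  times the squared Lipschitz constant is at most the modulus. This fixes the exponent -3t of
  \<beta> and the threshold for \<beta>0 / \<sigma>0, and it leaves a contraction factor of 1 -
  const (k + 1)^(-4t). That small gain has to beat the motion of the saddle point, whose Lipschitz
  constant in x is of order (k + 1)^(2t).

  The limit argument is carried out at the exact saddle points and not at the iterates. Their
  optimality conditions in y and z hold without error, hence survive multiplication by the unbounded
  \<rho>; only the condition in x has a residual, the projected-gradient mapping. The iterates enter
  again only through their vanishing distance to the saddle points.\<close>

lemma closest_point_eq_iff:
  fixes p :: "'a::euclidean_space"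
  assumes "convex C" "closed C" "p \<in> C"
  shows "closest_point C a = p \<longleftrightarrow> (\<forall>c\<in>C. inner (a - p) (c - p) \<le> 0)"
proof
  assume "closest_point C a = p"
  then show "\<forall>c\<in>C. inner (a - p) (c - p) \<le> 0"
    using closest_point_dot[OF assms(1,2)] by blast
next
  assume *: "\<forall>c\<in>C. inner (a - p) (c - p) \<le> 0"
  have "dist a p \<le> dist a c" if "c \<in> C" for c
  proof -
    have "(norm (a - c))\<^sup>2 = (norm (a - p))\<^sup>2 + (norm (c - p))\<^sup>2 - 2 * inner (a - p) (c - p)"
      by (simp add: power2_norm_eq_inner algebra_simps inner_commute)
    with * that have "(norm (a - p))\<^sup>2 \<le> (norm (a - c))\<^sup>2" by (smt (verit) zero_le_power2)
    then show ?thesis by (simp add: dist_norm)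
  qed
  then show "closest_point C a = p" using closest_point_unique[OF assms(1,2,3)] by metis
qed

lemma normal_cone_scale: "v \<in> normal_cone C p \<Longrightarrow> 0 \<le> c \<Longrightarrow> c *\<^sub>R v \<in> normal_cone C p"
  by (auto simp: normal_cone_def mult_nonneg_nonpos split: if_splits)

text \<open>Lets the simultaneous projections of \<open>y\<close> and \<open>z\<close> in the
  algorithm be read as one projection onto \<open>Y \<times> Y\<close>.\<close>

lemma closest_point_Times:
  fixes A :: "'a::euclidean_space set" and B :: "'b::euclidean_space set"
  assumes A: "convex A" "closed A" "A \<noteq> {}" and B: "convex B" "closed B" "B \<noteq> {}"
  shows "closest_point (A \<times> B) (a, b) = (closest_point A a, closest_point B b)"
proof -
  have "closest_point A a \<in> A" "closest_point B b \<in> B"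
    using A B by (auto intro: closest_point_in_set)
  then show ?thesis
    using A B closest_point_dot[OF A(1,2)] closest_point_dot[OF B(1,2)]
    by (subst closest_point_eq_iff)
       (auto simp: convex_Times closed_Times inner_prod_def intro!: add_nonpos_nonpos)
qed

section \<open>Gradients, partial gradients and first-order inequalities on convex sets\<close>

lemma linear_functional_eq_inner:
  fixes \<phi> :: "'a::euclidean_space \<Rightarrow> real"
  assumes "linear \<phi>"
  shows "\<phi> h = inner h (\<Sum>b\<in>Basis. \<phi> b *\<^sub>R b)"
proof -
  have "\<phi> h = \<phi> (\<Sum>b\<in>Basis. inner h b *\<^sub>R b)" by (simp add: euclidean_representation)
  also have "\<dots> = (\<Sum>b\<in>Basis. inner h b * \<phi> b)"
    by (simp add: linear_sum[OF assms] linear_cmul[OF assms])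
  finally show ?thesis by (simp add: inner_sum_right mult.commute)
qed

text \<open>\<open>gradient\<close> is a choice, so its defining property follows as soon as some
  vector represents the derivative. The filter is arbitrary: within a thin set the vector need not
  be unique.\<close>

lemma has_derivative_gradient:
  fixes f :: "'a::euclidean_space \<Rightarrow> real"
  assumes "(f has_derivative f') net"
  shows "(f has_derivative (\<lambda>h. inner h (gradient f net))) net"
proof -
  have "f' = (\<lambda>h. inner h (\<Sum>b\<in>Basis. f' b *\<^sub>R b))"
    using linear_functional_eq_inner[OF has_derivative_linear[OF assms]] by blast
  with assms have "\<exists>v. (f has_derivative (\<lambda>h. inner h v)) net" by metis
  then show ?thesis unfolding gradient_def by (rule someI_ex)
qed

lemma gradient_eqI:
  fixes f :: "'a::euclidean_space \<Rightarrow> real"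
  assumes "(f has_derivative (\<lambda>h. inner h v)) (at x)"
  shows "gradient f (at x) = v"
proof -
  have "(\<lambda>h. inner h (gradient f (at x))) = (\<lambda>h. inner h v)"
    using has_derivative_unique[OF has_derivative_gradient[OF assms] assms] .
  then show ?thesis by (metis inner_commute vector_eq_ldot)
qed

lemma inner_gradient:
  fixes f :: "'a::euclidean_space \<Rightarrow> real"
  assumes "(f has_derivative f') (at x)"
  shows "inner h (gradient f (at x)) = f' h"
  using has_derivative_unique[OF has_derivative_gradient[OF assms] assms] by meson

lemma partial_has_derivative:
  fixes f :: "'a::euclidean_space \<times> 'b::euclidean_space \<Rightarrow> real"
  assumes "(f has_derivative f') (at (x, y))"
  shows "((\<lambda>u. f (u, y)) has_derivative (\<lambda>h. f' (h, 0))) (at x)"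
    and "((\<lambda>v. f (x, v)) has_derivative (\<lambda>h. f' (0, h))) (at y)"
proof -
  have 1: "((\<lambda>u. (u, y)) has_derivative (\<lambda>h. (h, 0))) (at x)"
    and 2: "((\<lambda>v. (x, v)) has_derivative (\<lambda>h. (0, h))) (at y)"
    by (auto intro!: derivative_eq_intros)
  show "((\<lambda>u. f (u, y)) has_derivative (\<lambda>h. f' (h, 0))) (at x)"
    using has_derivative_compose[OF 1 assms] by simp
  show "((\<lambda>v. f (x, v)) has_derivative (\<lambda>h. f' (0, h))) (at y)"
    using has_derivative_compose[OF 2 assms] by simp
qed

lemma partial_gradients:
  fixes f :: "'a::euclidean_space \<times> 'b::euclidean_space \<Rightarrow> real"
  assumes "(f has_derivative f') (at (x, y))"
  shows "grad_x f x y = fst (gradient f (at (x, y)))"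
    and "grad_y f x y = snd (gradient f (at (x, y)))"
proof -
  have "(f has_derivative (\<lambda>h. inner h (gradient f (at (x, y))))) (at (x, y))"
    using has_derivative_gradient[OF assms] .
  note * = partial_has_derivative[OF this]
  show "grad_x f x y = fst (gradient f (at (x, y)))"
    using *(1) by (intro gradient_eqI) (simp add: inner_prod_def)
  show "grad_y f x y = snd (gradient f (at (x, y)))"
    using *(2) by (intro gradient_eqI) (simp add: inner_prod_def)
qed

text \<open>A derivative within a convex set is seen along segments that stay in the set, so it is
  reduced to a one-sided derivative of a real function on such a segment. The first-order
  inequalities that follow are passages to this limit.\<close>

lemma directional_quotient:
  fixes f :: "'a::real_normed_vector \<Rightarrow> real"
  assumes "(f has_derivative f') (at x within S)" "convex S" "x \<in> S" "y \<in> S"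
  shows "((\<lambda>t. (f (x + t *\<^sub>R (y - x)) - f x) / t) \<longlongrightarrow> f' (y - x)) (at_right 0)"
proof -
  have sub: "(\<lambda>t. x + t *\<^sub>R (y - x)) ` {0..1} \<subseteq> S"
  proof clarify
    fix t :: real assume "t \<in> {0..1}"
    moreover have "x + t *\<^sub>R (y - x) = (1 - t) *\<^sub>R x + t *\<^sub>R y" by (simp add: algebra_simps)
    ultimately show "x + t *\<^sub>R (y - x) \<in> S" using assms(2-4) by (simp add: convexD_alt)
  qed
  have "(f has_derivative f') (at (x + 0 *\<^sub>R (y - x)) within (\<lambda>t. x + t *\<^sub>R (y - x)) ` {0..1})"
    using has_derivative_subset[OF assms(1) sub] by simp
  moreover have "((\<lambda>t. x + t *\<^sub>R (y - x)) has_derivative (\<lambda>t. t *\<^sub>R (y - x))) (at 0 within {0..1})"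
    by (auto intro!: derivative_eq_intros)
  ultimately have "((\<lambda>t. f (x + t *\<^sub>R (y - x))) has_derivative (\<lambda>t. f' (t *\<^sub>R (y - x)))) (at 0 within {0..1})"
    using has_derivative_in_compose by blast
  moreover have "f' (t *\<^sub>R (y - x)) = f' (y - x) * t" for t
    using linear_cmul[OF has_derivative_linear[OF assms(1)]] by (simp add: mult.commute)
  ultimately have "((\<lambda>t. f (x + t *\<^sub>R (y - x))) has_field_derivative f' (y - x)) (at 0 within {0..1})"
    by (simp add: has_field_derivative_def)
  then show ?thesis
    by (simp add: has_field_derivative_iff at_within_Icc_at_right)
qed

lemma convex_on_gradient_le:
  fixes f :: "'a::real_normed_vector \<Rightarrow> real"
  assumes "convex_on S f" "(f has_derivative f') (at x within S)" "x \<in> S" "y \<in> S"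
  shows "f x + f' (y - x) \<le> f y"
proof -
  have "convex S" using assms(1) convex_on_imp_convex by blast
  from directional_quotient[OF assms(2) this assms(3,4)]
  have "f' (y - x) \<le> f y - f x"
  proof (rule tendsto_upperbound)
    have "(f (x + t *\<^sub>R (y - x)) - f x) / t \<le> f y - f x" if "0 < t" "t < 1" for t
    proof -
      have "x + t *\<^sub>R (y - x) = (1 - t) *\<^sub>R x + t *\<^sub>R y" by (simp add: algebra_simps)
      then have "f (x + t *\<^sub>R (y - x)) \<le> (1 - t) * f x + t * f y"
        using convex_onD[OF assms(1), of t x y] that assms(3,4) by simp
      then show ?thesis using that by (simp add: field_simps)
    qed
    then show "\<forall>\<^sub>F t in at_right 0. (f (x + t *\<^sub>R (y - x)) - f x) / t \<le> f y - f x"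
      by (auto simp: eventually_at_right_field intro!: exI[of _ 1])
  qed simp
  then show ?thesis by simp
qed

lemma concave_on_gradient_ge:
  fixes f :: "'a::real_normed_vector \<Rightarrow> real"
  assumes "concave_on S f" "(f has_derivative f') (at x within S)" "x \<in> S" "y \<in> S"
  shows "f y \<le> f x + f' (y - x)"
  using convex_on_gradient_le[of S "\<lambda>x. - f x" "\<lambda>h. - f' h" x y] assms
  by (auto simp: concave_on_def intro: derivative_intros)

lemma minimum_variational_inequality:
  fixes f :: "'a::real_normed_vector \<Rightarrow> real"
  assumes "(f has_derivative f') (at x within S)" "convex S" "x \<in> S" "y \<in> S"
    and min: "\<And>u. u \<in> S \<Longrightarrow> f x \<le> f u"
  shows "0 \<le> f' (y - x)"
  using directional_quotient[OF assms(1-4)]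
proof (rule tendsto_lowerbound)
  have "0 \<le> (f (x + t *\<^sub>R (y - x)) - f x) / t" if "0 < t" "t < 1" for t
  proof -
    have "x + t *\<^sub>R (y - x) = (1 - t) *\<^sub>R x + t *\<^sub>R y" by (simp add: algebra_simps)
    then have "x + t *\<^sub>R (y - x) \<in> S" using assms(2-4) that by (simp add: convexD_alt)
    then show ?thesis using min that by simp
  qed
  then show "\<forall>\<^sub>F t in at_right 0. 0 \<le> (f (x + t *\<^sub>R (y - x)) - f x) / t"
    by (auto simp: eventually_at_right_field intro!: exI[of _ 1])
qed simp

text \<open>The one-sided limit along a segment is unique even if \<open>S\<close> has empty
  interior. This makes \<open>proj_grad_map\<close> independent of the vector that
  \<open>gradient\<close> happens to choose.\<close>

lemma gradient_within_unique:
  fixes f :: "'a::real_inner \<Rightarrow> real"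
  assumes "(f has_derivative (\<lambda>h. inner h u)) (at x within S)"
    and "(f has_derivative (\<lambda>h. inner h v)) (at x within S)"
    and "convex S" "x \<in> S" "c \<in> S"
  shows "inner (c - x) u = inner (c - x) v"
  using directional_quotient[OF assms(1,3,4,5)] directional_quotient[OF assms(2,3,4,5)]
  by (rule tendsto_unique[rotated]) simp

text \<open>The variation of the gradient is bounded by its largest value on the segment instead of
  being integrated, hence the constant \<open>L\<close> and not \<open>L / 2\<close>.\<close>

lemma lipschitz_gradient_taylor:
  fixes f :: "'a::euclidean_space \<Rightarrow> real"
  assumes "convex S" "p \<in> S" "q \<in> S"
    and der: "\<And>u. u \<in> S \<Longrightarrow> (f has_derivative (\<lambda>h. inner h (D u))) (at u)"
    and lip: "L-lipschitz_on S D"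
  shows "\<bar>f q - f p - inner (q - p) (D p)\<bar> \<le> L * (norm (q - p))\<^sup>2"
proof -
  define I where "I = (\<lambda>t. p + t *\<^sub>R (q - p)) ` {0..1}"
  have IS: "I \<subseteq> S"
  proof (unfold I_def, clarify)
    fix t :: real assume "t \<in> {0..1}"
    moreover have "p + t *\<^sub>R (q - p) = (1 - t) *\<^sub>R p + t *\<^sub>R q" by (simp add: algebra_simps)
    ultimately show "p + t *\<^sub>R (q - p) \<in> S" using assms(1-3) by (simp add: convexD_alt)
  qed
  have L: "0 \<le> L" using lip lipschitz_on_nonneg by blast
  have "norm (f q - f p - (\<lambda>h. inner h (D p)) (q - p)) \<le> norm (q - p) * (L * norm (q - p))"
  proof (rule differentiable_bound_linearization[where S = I and f' = "\<lambda>u h. inner h (D u)" and ?x0.0 = p])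
    fix u assume u: "u \<in> I"
    then obtain t where t: "0 \<le> t" "t \<le> 1" "u = p + t *\<^sub>R (q - p)" by (auto simp: I_def)
    show "(f has_derivative (\<lambda>h. inner h (D u))) (at u within I)"
      using der[of u] u IS by (auto intro: has_derivative_at_withinI)
    have "norm (D u - D p) \<le> L * norm (u - p)"
      using lipschitz_onD[OF lip, of u p] u IS assms(2) by (auto simp: dist_norm)
    also have "\<dots> \<le> L * norm (q - p)" using t L by (simp add: mult_left_mono mult_left_le_one_le)
    finally have "norm (D u - D p) \<le> L * norm (q - p)" .
    moreover have "norm (((\<lambda>h. inner h (D u)) - (\<lambda>h. inner h (D p))) h) \<le> norm (D u - D p) * norm h" for h
      using Cauchy_Schwarz_ineq2[of h "D u - D p"] by (simp add: inner_diff_right mult.commute)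
    ultimately have "norm (((\<lambda>h. inner h (D u)) - (\<lambda>h. inner h (D p))) h) \<le> (L * norm (q - p)) * norm h" for h
      by (meson mult_right_mono norm_ge_zero order_trans)
    then show "onorm ((\<lambda>h. inner h (D u)) - (\<lambda>h. inner h (D p))) \<le> L * norm (q - p)"
      using L by (intro onorm_le)
  qed (auto simp: I_def intro: image_eqI[of _ _ 0])
  then show ?thesis by (simp add: power2_eq_square mult_ac)
qed

section \<open>Strongly monotone variational inequalities\<close>

lemma VI_iff_fixed_point:
  fixes w :: "'a::euclidean_space"
  assumes "convex C" "closed C" "w \<in> C" "0 < \<beta>"
  shows "(\<forall>c\<in>C. 0 \<le> inner (T w) (c - w)) \<longleftrightarrow> closest_point C (w - \<beta> *\<^sub>R T w) = w"
  using assms by (auto simp: closest_point_eq_iff zero_le_mult_iff)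

text \<open>The projection is nonexpansive, and the square of
  \<open>(v - w) - \<beta> *\<^sub>R (T v - T w)\<close> expands into the stated factor. The
  hypotheses concern a single pair of points, so that the same estimate serves the fixed-point
  theorem and one step of the algorithm compared with the saddle point.\<close>

lemma projected_step_contraction:
  fixes T :: "'a::euclidean_space \<Rightarrow> 'a"
  assumes C: "convex C" "closed C" and v: "v \<in> C" and w: "w \<in> C"
    and mono: "\<mu> * (norm (v - w))\<^sup>2 \<le> inner (T v - T w) (v - w)"
    and lip: "norm (T v - T w) \<le> L * norm (v - w)" and b: "0 \<le> \<beta>"
  shows "(norm (closest_point C (v - \<beta> *\<^sub>R T v) - closest_point C (w - \<beta> *\<^sub>R T w)))\<^sup>2
           \<le> (1 - 2 * \<beta> * \<mu> + \<beta>\<^sup>2 * L\<^sup>2) * (norm (v - w))\<^sup>2"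
proof -
  have "norm (closest_point C (v - \<beta> *\<^sub>R T v) - closest_point C (w - \<beta> *\<^sub>R T w))
      \<le> norm ((v - w) - \<beta> *\<^sub>R (T v - T w))"
    using closest_point_lipschitz[OF C, of "v - \<beta> *\<^sub>R T v" "w - \<beta> *\<^sub>R T w"] v
    by (auto simp: dist_norm algebra_simps)
  then have "(norm (closest_point C (v - \<beta> *\<^sub>R T v) - closest_point C (w - \<beta> *\<^sub>R T w)))\<^sup>2
      \<le> (norm ((v - w) - \<beta> *\<^sub>R (T v - T w)))\<^sup>2" by simp
  also have "\<dots> = (norm (v - w))\<^sup>2 - 2 * \<beta> * inner (T v - T w) (v - w) + \<beta>\<^sup>2 * (norm (T v - T w))\<^sup>2"
    unfolding power2_norm_eq_inner by (simp add: algebra_simps inner_commute power2_eq_square)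
  also have "\<dots> \<le> (norm (v - w))\<^sup>2 - 2 * \<beta> * (\<mu> * (norm (v - w))\<^sup>2) + \<beta>\<^sup>2 * (L * norm (v - w))\<^sup>2"
    using b mono lip by (intro add_mono diff_mono mult_left_mono power_mono) auto
  finally show ?thesis by (simp add: algebra_simps power_mult_distrib)
qed

lemma strongly_monotone_VI_exists:
  fixes T :: "'a::euclidean_space \<Rightarrow> 'a"
  assumes C: "convex C" "closed C" "C \<noteq> {}"
    and mono: "\<And>v w. v \<in> C \<Longrightarrow> w \<in> C \<Longrightarrow> \<mu> * (norm (v - w))\<^sup>2 \<le> inner (T v - T w) (v - w)"
    and lip: "\<And>v w. v \<in> C \<Longrightarrow> w \<in> C \<Longrightarrow> norm (T v - T w) \<le> L * norm (v - w)"
    and mu: "0 < \<mu>"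
  shows "\<exists>w\<in>C. \<forall>c\<in>C. 0 \<le> inner (T w) (c - w)"
proof -
  \<comment> \<open>A given Lipschitz constant may be smaller than \<open>\<mu>\<close> (for
    instance if \<open>C\<close> is a single point); enlarging it makes
    \<open>(\<mu> / M)\<^sup>2 \<le> 1\<close>, so that the root \<open>q\<close> below is
    real.\<close>
  define M where "M = max L \<mu>"
  have M: "0 < M" "\<mu> \<le> M" "L \<le> M" using mu by (auto simp: M_def)
  have lip': "norm (T v - T w) \<le> M * norm (v - w)" if "v \<in> C" "w \<in> C" for v w
    using lip[OF that] M(3) by (meson mult_right_mono norm_ge_zero order_trans)
  \<comment> \<open>The minimiser of
    \<open>1 - 2 * \<beta> * \<mu> + \<beta>\<^sup>2 * M\<^sup>2\<close>; the minimum is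
    \<open>q\<^sup>2\<close>.\<close>
  define \<beta> where "\<beta> = \<mu> / M\<^sup>2"
  define q where "q = sqrt (1 - (\<mu> / M)\<^sup>2)"
  have b: "0 < \<beta>" using mu M by (simp add: \<beta>_def)
  have r: "0 < \<mu> / M" "\<mu> / M \<le> 1" using M mu by auto
  then have r2: "(\<mu> / M)\<^sup>2 \<le> 1" "0 < (\<mu> / M)\<^sup>2" using mu M by (simp_all add: power_le_one del: power_divide)
  have eq: "1 - 2 * \<beta> * \<mu> + \<beta>\<^sup>2 * M\<^sup>2 = q\<^sup>2"
    using r2 M by (simp add: q_def \<beta>_def field_simps power2_eq_square)
  define P where "P v = closest_point C (v - \<beta> *\<^sub>R T v)" for v
  have contr: "dist (P v) (P w) \<le> q * dist v w" if "v \<in> C" "w \<in> C" for v w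
  proof -
    have "(norm (P v - P w))\<^sup>2 \<le> (q * norm (v - w))\<^sup>2"
      using projected_step_contraction[OF C(1,2) that mono[OF that] lip'[OF that], of \<beta>] b
      by (simp add: P_def eq power_mult_distrib)
    then show ?thesis using r2 by (simp add: dist_norm q_def power2_le_iff_abs_le)
  qed
  have "\<exists>!w\<in>C. P w = w"
  proof (rule Banach_fix)
    show "complete C" using C(2) by (simp add: complete_eq_closed)
    show "0 \<le> q" "q < 1" using r2 by (auto simp: q_def)
    show "P ` C \<subseteq> C" using closest_point_in_set[OF C(2,3)] by (auto simp: P_def)
    show "\<And>x y. x \<in> C \<Longrightarrow> y \<in> C \<Longrightarrow> dist (P x) (P y) \<le> q * dist x y" using contr by blast
  qed (use C in auto)
  then obtain w where "w \<in> C" "P w = w" by blast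
  then show ?thesis using VI_iff_fixed_point[OF C(1,2) _ b, of w T] by (auto simp: P_def)
qed

text \<open>Each inequality is tested with the solution of the other one. Monotonicity is asked of
  \<open>T\<close> alone, and the two operators are compared only at \<open>w\<close>. With equal
  operators this is uniqueness; with different ones it is sensitivity in x or in the
  parameters.\<close>

lemma VI_perturbation:
  fixes v w :: "'a::real_inner"
  assumes "\<And>c. c \<in> C \<Longrightarrow> 0 \<le> inner (T v) (c - v)" "\<And>c. c \<in> C \<Longrightarrow> 0 \<le> inner (U w) (c - w)"
    and "v \<in> C" "w \<in> C" and mono: "\<mu> * (norm (v - w))\<^sup>2 \<le> inner (T v - T w) (v - w)"
  shows "\<mu> * norm (v - w) \<le> norm (T w - U w)"
proof (cases "v = w")
  case False
  have "\<mu> * (norm (v - w))\<^sup>2 \<le> inner (U w - T w) (v - w)"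
    using mono assms(1)[of w] assms(2)[of v] assms(3,4) by (simp add: inner_diff_left inner_diff_right)
  also have "\<dots> \<le> norm (T w - U w) * norm (v - w)"
    by (metis Cauchy_Schwarz_ineq2 abs_le_D1 norm_minus_commute)
  finally show ?thesis using False by (simp add: power2_eq_square)
qed simp

lemma norm_parts_le:
  "norm (fst v - fst w) \<le> norm (v - w)" "norm (snd v - snd w) \<le> norm (v - w)"
  by (cases v, cases w, simp add: norm_fst_le norm_snd_le)+

lemma norm_Pair_le_add: "norm a \<le> A \<Longrightarrow> norm b \<le> B \<Longrightarrow> norm (a, b) \<le> A + B"
  using norm_Pair_le[of a b] by linarith

text \<open>\<open>bounded_selection\<close> is the bounded-set condition of (A2) for the whole of
  \<open>X\<close>, which is bounded because it is compact. One constant \<open>L\<close> serves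
  both gradients.\<close>

locale bilevel_data =
  fixes X :: "'a::euclidean_space set" and Y :: "'b::euclidean_space set"
    and F f :: "'a \<times> 'b \<Rightarrow> real" and L :: real
  assumes X: "X \<noteq> {}" "compact X" "convex X"
    and Y: "Y \<noteq> {}" "closed Y" "convex Y"
    and F_diff: "\<And>p. (F has_derivative (\<lambda>h. inner h (gradient F (at p)))) (at p)"
    and f_diff: "\<And>p. (f has_derivative (\<lambda>h. inner h (gradient f (at p)))) (at p)"
    and F_lip: "L-lipschitz_on (X \<times> Y) (\<lambda>p. gradient F (at p))"
    and f_lip: "L-lipschitz_on (X \<times> Y) (\<lambda>p. gradient f (at p))"
    and F_concave: "\<And>x. x \<in> X \<Longrightarrow> concave_on Y (\<lambda>y. F (x, y))"
    and f_convex: "\<And>x. x \<in> X \<Longrightarrow> convex_on Y (\<lambda>y. f (x, y))"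
    and F_coercive: "\<And>x. x \<in> X \<Longrightarrow>
          filterlim (\<lambda>y. F (x, y)) at_bot (inf at_infinity (principal Y))"
    and bounded_selection: "\<exists>R. \<forall>x\<in>X. \<exists>v\<in>lower_sol Y f x. norm v \<le> R"
begin

lemma closed_X: "closed X" using X(2) by (rule compact_imp_closed)

lemma L_nonneg: "0 \<le> L" using F_lip lipschitz_on_nonneg by blast

lemma continuous_F: "continuous_on S F" and continuous_f: "continuous_on S f"
  by (auto intro!: continuous_at_imp_continuous_on has_derivative_continuous[OF F_diff]
      has_derivative_continuous[OF f_diff] simp del: split_paired_All)

definition "Fx x y = fst (gradient F (at (x, y)))"
definition "Fy x y = snd (gradient F (at (x, y)))"
definition "fx x y = fst (gradient f (at (x, y)))"
definition "fy x y = snd (gradient f (at (x, y)))"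

lemma partials:
  "grad_x F x y = Fx x y" "grad_y F x y = Fy x y" "grad_x f x y = fx x y" "grad_y f x y = fy x y"
  unfolding Fx_def Fy_def fx_def fy_def
  by (rule partial_gradients[OF F_diff] partial_gradients[OF f_diff])+

lemma lipschitz_gradients:
  assumes "x \<in> X" "x' \<in> X" "y \<in> Y" "y' \<in> Y"
  shows "norm (Fx x y - Fx x' y') \<le> L * (norm (x - x') + norm (y - y'))"
    and "norm (Fy x y - Fy x' y') \<le> L * (norm (x - x') + norm (y - y'))"
    and "norm (fx x y - fx x' y') \<le> L * (norm (x - x') + norm (y - y'))"
    and "norm (fy x y - fy x' y') \<le> L * (norm (x - x') + norm (y - y'))"
proof -
  have le: "L * norm ((x, y) - (x', y')) \<le> L * (norm (x - x') + norm (y - y'))"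
    using L_nonneg norm_Pair_le[of "x - x'" "y - y'"] by (simp add: mult_left_mono)
  have 1: "norm (gradient F (at (x, y)) - gradient F (at (x', y'))) \<le> L * (norm (x - x') + norm (y - y'))"
    using lipschitz_onD[OF F_lip, of "(x, y)" "(x', y')"] assms le by (auto simp: dist_norm)
  have 2: "norm (gradient f (at (x, y)) - gradient f (at (x', y'))) \<le> L * (norm (x - x') + norm (y - y'))"
    using lipschitz_onD[OF f_lip, of "(x, y)" "(x', y')"] assms le by (auto simp: dist_norm)
  show "norm (Fx x y - Fx x' y') \<le> L * (norm (x - x') + norm (y - y'))"
    "norm (Fy x y - Fy x' y') \<le> L * (norm (x - x') + norm (y - y'))"
    "norm (fx x y - fx x' y') \<le> L * (norm (x - x') + norm (y - y'))"
    "norm (fy x y - fy x' y') \<le> L * (norm (x - x') + norm (y - y'))"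
    unfolding Fx_def Fy_def fx_def fy_def
    by (rule order_trans[OF norm_parts_le(1) 1] order_trans[OF norm_parts_le(2) 1]
        order_trans[OF norm_parts_le(1) 2] order_trans[OF norm_parts_le(2) 2])+
qed

lemma F_above_tangent:
  assumes "x \<in> X" "y \<in> Y" "y' \<in> Y"
  shows "F (x, y') \<le> F (x, y) + inner (y' - y) (Fy x y)"
proof -
  have "((\<lambda>v. F (x, v)) has_derivative (\<lambda>h. inner h (Fy x y))) (at y within Y)"
    using partial_has_derivative(2)[OF F_diff[of "(x, y)"]]
    by (simp add: Fy_def inner_prod_def has_derivative_at_withinI)
  from concave_on_gradient_ge[OF F_concave this] assms show ?thesis by blast
qed

lemma f_above_tangent:
  assumes "x \<in> X" "y \<in> Y" "y' \<in> Y"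
  shows "f (x, y) + inner (y' - y) (fy x y) \<le> f (x, y')"
proof -
  have "((\<lambda>v. f (x, v)) has_derivative (\<lambda>h. inner h (fy x y))) (at y within Y)"
    using partial_has_derivative(2)[OF f_diff[of "(x, y)"]]
    by (simp add: fy_def inner_prod_def has_derivative_at_withinI)
  from convex_on_gradient_le[OF f_convex this] assms show ?thesis by blast
qed

lemma fy_monotone:
  assumes "x \<in> X" "y \<in> Y" "y' \<in> Y"
  shows "0 \<le> inner (fy x y - fy x y') (y - y')"
  using f_above_tangent[of x y y'] f_above_tangent[of x y' y] assms
  by (simp add: inner_diff_left inner_diff_right inner_commute)

lemma Fy_monotone:
  assumes "x \<in> X" "y \<in> Y" "y' \<in> Y"
  shows "inner (Fy x y - Fy x y') (y - y') \<le> 0"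
  using F_above_tangent[of x y y'] F_above_tangent[of x y' y] assms
  by (simp add: inner_diff_left inner_diff_right inner_commute)

lemma F_taylor:
  assumes "x \<in> X" "x' \<in> X" "y \<in> Y"
  shows "\<bar>F (x', y) - F (x, y) - inner (x' - x) (Fx x y)\<bar> \<le> L * (norm (x' - x))\<^sup>2"
  using lipschitz_gradient_taylor[of "X \<times> Y" "(x, y)" "(x', y)" F, OF _ _ _ F_diff F_lip] assms X Y
  by (simp add: convex_Times inner_prod_def Fx_def norm_Pair)

lemma f_taylor:
  assumes "x \<in> X" "x' \<in> X" "y \<in> Y"
  shows "\<bar>f (x', y) - f (x, y) - inner (x' - x) (fx x y)\<bar> \<le> L * (norm (x' - x))\<^sup>2"
  using lipschitz_gradient_taylor[of "X \<times> Y" "(x, y)" "(x', y)" f, OF _ _ _ f_diff f_lip] assms X Y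
  by (simp add: convex_Times inner_prod_def fx_def norm_Pair)


section \<open>The saddle point as a strongly monotone variational inequality\<close>

text \<open>The operator \<open>(- grad\<^sub>y \<psi>, grad\<^sub>z \<psi>)\<close>.\<close>
definition vi_op :: "real \<Rightarrow> real \<Rightarrow> real \<Rightarrow> 'a \<Rightarrow> 'b \<times> 'b \<Rightarrow> 'b \<times> 'b" where
  "vi_op \<rho> \<sigma> \<delta> x w =
     (\<rho> *\<^sub>R fy x (fst w) - Fy x (fst w) + \<sigma> *\<^sub>R snd w + \<delta> *\<^sub>R fst w,
      \<rho> *\<^sub>R fy x (snd w) + \<sigma> *\<^sub>R (snd w - fst w))"

lemma norm_sq_expand:
  fixes u v :: "'c::real_inner"
  shows "(norm u)\<^sup>2 = (norm v)\<^sup>2 + 2 * inner v (u - v) + (norm (u - v))\<^sup>2"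
  by (simp add: power2_norm_eq_inner inner_diff_left inner_diff_right inner_commute)

text \<open>Strong concavity in y with modulus \<open>\<delta>\<close>: \<open>F\<close> and
  \<open>- \<rho> * f\<close> lie below their tangents, the coupling term is linear in y, and the
  quadratic term is expanded exactly. The next lemma is the counterpart in z, with modulus
  \<open>\<sigma>\<close>.\<close>

lemma psi_upper:
  assumes "x \<in> X" "y \<in> Y" "y' \<in> Y" "0 < \<rho>"
  shows "psi F f \<rho> \<sigma> \<delta> x y' z
      \<le> psi F f \<rho> \<sigma> \<delta> x y z - inner (fst (vi_op \<rho> \<sigma> \<delta> x (y, z))) (y' - y) - \<delta> / 2 * (norm (y' - y))\<^sup>2"
proof -
  have "\<rho> * (f (x, y) + inner (y' - y) (fy x y)) \<le> \<rho> * f (x, y')"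
    using f_above_tangent assms by (intro mult_left_mono) auto
  moreover have "\<delta> / 2 * (norm y')\<^sup>2
      = \<delta> / 2 * (norm y)\<^sup>2 + \<delta> * inner y (y' - y) + \<delta> / 2 * (norm (y' - y))\<^sup>2"
    by (subst norm_sq_expand[of y' y]) (simp add: algebra_simps)
  ultimately show ?thesis
    using F_above_tangent[OF assms(1-3)]
    by (simp add: psi_def vi_op_def algebra_simps inner_commute)
qed

lemma psi_lower:
  assumes "x \<in> X" "z \<in> Y" "z' \<in> Y" "0 < \<rho>"
  shows "psi F f \<rho> \<sigma> \<delta> x y z + inner (snd (vi_op \<rho> \<sigma> \<delta> x (y, z))) (z' - z) + \<sigma> / 2 * (norm (z' - z))\<^sup>2
      \<le> psi F f \<rho> \<sigma> \<delta> x y z'"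
proof -
  have "\<rho> * (f (x, z) + inner (z' - z) (fy x z)) \<le> \<rho> * f (x, z')"
    using f_above_tangent assms by (intro mult_left_mono) auto
  moreover have "\<sigma> / 2 * (norm z')\<^sup>2
      = \<sigma> / 2 * (norm z)\<^sup>2 + \<sigma> * inner z (z' - z) + \<sigma> / 2 * (norm (z' - z))\<^sup>2"
    by (subst norm_sq_expand[of z' z]) (simp add: algebra_simps)
  ultimately show ?thesis
    by (simp add: psi_def vi_op_def algebra_simps inner_commute)
qed

text \<open>The coupling \<open>- \<sigma> * inner y z\<close> enters the two components with
  opposite signs, so its contribution is skew and cancels. What remains is \<open>\<delta>\<close>
  in y, \<open>\<sigma>\<close> in z and monotone terms.\<close>

lemma vi_op_strongly_monotone:
  assumes "x \<in> X" "v \<in> Y \<times> Y" "w \<in> Y \<times> Y" "0 < \<rho>"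
  shows "min \<sigma> \<delta> * (norm (v - w))\<^sup>2 \<le> inner (vi_op \<rho> \<sigma> \<delta> x v - vi_op \<rho> \<sigma> \<delta> x w) (v - w)"
proof -
  obtain y z y' z' where vw: "v = (y, z)" "w = (y', z')" by (metis surj_pair)
  have Yw: "y \<in> Y" "z \<in> Y" "y' \<in> Y" "z' \<in> Y" using assms vw by auto
  have eq: "inner (vi_op \<rho> \<sigma> \<delta> x v - vi_op \<rho> \<sigma> \<delta> x w) (v - w)
      = \<rho> * inner (fy x y - fy x y') (y - y') - inner (Fy x y - Fy x y') (y - y')
        + \<delta> * (norm (y - y'))\<^sup>2 + \<rho> * inner (fy x z - fy x z') (z - z') + \<sigma> * (norm (z - z'))\<^sup>2"
    unfolding vw vi_op_def power2_norm_eq_inner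
    by (simp add: algebra_simps inner_commute)
  have "0 \<le> \<rho> * inner (fy x y - fy x y') (y - y')" "0 \<le> \<rho> * inner (fy x z - fy x z') (z - z')"
    using fy_monotone Yw assms(1,4) by simp_all
  moreover have "inner (Fy x y - Fy x y') (y - y') \<le> 0"
    using Fy_monotone Yw assms(1) by blast
  moreover have "min \<sigma> \<delta> * (norm (v - w))\<^sup>2 \<le> \<delta> * (norm (y - y'))\<^sup>2 + \<sigma> * (norm (z - z'))\<^sup>2"
    unfolding vw by (simp add: norm_Pair distrib_left add_mono mult_right_mono)
  ultimately show ?thesis unfolding eq by linarith
qed

text \<open>The norm of a pair is bounded by the sum of the norms of its components, which accounts
  for the factors 2 and 3. At \<open>k = 0\<close> this is the constant that appears in
  \<open>\<beta>0_small\<close>.\<close>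

lemma vi_op_lipschitz:
  assumes "x \<in> X" "v \<in> Y \<times> Y" "w \<in> Y \<times> Y" "0 < \<rho>" "0 < \<sigma>" "0 < \<delta>"
  shows "norm (vi_op \<rho> \<sigma> \<delta> x v - vi_op \<rho> \<sigma> \<delta> x w) \<le> (L + 2 * \<rho> * L + 3 * \<sigma> + \<delta>) * norm (v - w)"
proof -
  let ?N = "norm (v - w)"
  have Yw: "fst v \<in> Y" "snd v \<in> Y" "fst w \<in> Y" "snd w \<in> Y" using assms by auto
  note n = norm_parts_le[of v w]
  have 1: "norm (fy x (fst v) - fy x (fst w)) \<le> L * ?N" "norm (fy x (snd v) - fy x (snd w)) \<le> L * ?N"
    "norm (Fy x (fst v) - Fy x (fst w)) \<le> L * ?N"
    using lipschitz_gradients[OF assms(1) assms(1) Yw(1,3)] lipschitz_gradients[OF assms(1) assms(1) Yw(2,4)]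
      mult_left_mono[OF n(1) L_nonneg] mult_left_mono[OF n(2) L_nonneg]
    by simp_all
  have 2: "norm (\<rho> *\<^sub>R (fy x (fst v) - fy x (fst w))) \<le> \<rho> * (L * ?N)"
    "norm (\<rho> *\<^sub>R (fy x (snd v) - fy x (snd w))) \<le> \<rho> * (L * ?N)"
    "norm (\<sigma> *\<^sub>R (snd v - snd w)) \<le> \<sigma> * ?N" "norm (\<sigma> *\<^sub>R (fst v - fst w)) \<le> \<sigma> * ?N"
    "norm (\<delta> *\<^sub>R (fst v - fst w)) \<le> \<delta> * ?N"
    using 1 n assms(4-6) by (simp_all add: mult_left_mono)
  have "vi_op \<rho> \<sigma> \<delta> x v - vi_op \<rho> \<sigma> \<delta> x w =
     (\<rho> *\<^sub>R (fy x (fst v) - fy x (fst w)) - (Fy x (fst v) - Fy x (fst w)) + \<sigma> *\<^sub>R (snd v - snd w) + \<delta> *\<^sub>R (fst v - fst w),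
      \<rho> *\<^sub>R (fy x (snd v) - fy x (snd w)) + \<sigma> *\<^sub>R (snd v - snd w) - \<sigma> *\<^sub>R (fst v - fst w))" (is "_ = (?a, ?b)")
    by (simp add: vi_op_def algebra_simps)
  moreover have "norm ?a \<le> \<rho> * (L * ?N) + L * ?N + \<sigma> * ?N + \<delta> * ?N"
    by (intro norm_triangle_le norm_triangle_le_diff add_mono 1 2)
  moreover have "norm ?b \<le> \<rho> * (L * ?N) + \<sigma> * ?N + \<sigma> * ?N"
    by (intro norm_triangle_le norm_triangle_le_diff add_mono 1 2)
  ultimately have "norm (vi_op \<rho> \<sigma> \<delta> x v - vi_op \<rho> \<sigma> \<delta> x w)
      \<le> (\<rho> * (L * ?N) + L * ?N + \<sigma> * ?N + \<delta> * ?N) + (\<rho> * (L * ?N) + \<sigma> * ?N + \<sigma> * ?N)"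
    by (simp only: norm_Pair_le_add)
  then show ?thesis by (simp add: algebra_simps)
qed

lemma vi_op_lipschitz_x:
  assumes "x \<in> X" "x' \<in> X" "w \<in> Y \<times> Y" "0 < \<rho>"
  shows "norm (vi_op \<rho> \<sigma> \<delta> x w - vi_op \<rho> \<sigma> \<delta> x' w) \<le> (L + 2 * \<rho> * L) * norm (x - x')"
proof -
  let ?N = "norm (x - x')"
  have Yw: "fst w \<in> Y" "snd w \<in> Y" using assms by auto
  have 1: "norm (fy x (fst w) - fy x' (fst w)) \<le> L * ?N" "norm (fy x (snd w) - fy x' (snd w)) \<le> L * ?N"
    "norm (Fy x (fst w) - Fy x' (fst w)) \<le> L * ?N"
    using lipschitz_gradients[OF assms(1,2) Yw(1,1)] lipschitz_gradients[OF assms(1,2) Yw(2,2)] by simp_all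
  then have 2: "norm (\<rho> *\<^sub>R (fy x (fst w) - fy x' (fst w))) \<le> \<rho> * (L * ?N)"
    "norm (\<rho> *\<^sub>R (fy x (snd w) - fy x' (snd w))) \<le> \<rho> * (L * ?N)"
    using assms(4) by simp_all
  have "vi_op \<rho> \<sigma> \<delta> x w - vi_op \<rho> \<sigma> \<delta> x' w =
     (\<rho> *\<^sub>R (fy x (fst w) - fy x' (fst w)) - (Fy x (fst w) - Fy x' (fst w)),
      \<rho> *\<^sub>R (fy x (snd w) - fy x' (snd w)))" (is "_ = (?a, ?b)")
    by (simp add: vi_op_def algebra_simps)
  moreover have "norm ?a \<le> \<rho> * (L * ?N) + L * ?N"
    by (intro norm_triangle_le_diff add_mono 1 2)
  ultimately have "norm (vi_op \<rho> \<sigma> \<delta> x w - vi_op \<rho> \<sigma> \<delta> x' w) \<le> (\<rho> * (L * ?N) + L * ?N) + \<rho> * (L * ?N)"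
    using 2(2) by (simp only: norm_Pair_le_add)
  then show ?thesis by (simp add: algebra_simps)
qed

text \<open>Test points that change one component only split the inequality into first-order
  conditions for y and for z. These are necessary by differentiation along segments and sufficient
  because \<psi> is concave in y and convex in z.\<close>

lemma saddle_iff_VI:
  assumes x: "x \<in> X" and pos: "0 < \<rho>" "0 < \<sigma>" "0 < \<delta>" and w: "w \<in> Y \<times> Y"
  shows "is_saddle_point Y (psi F f \<rho> \<sigma> \<delta> x) w \<longleftrightarrow> (\<forall>c\<in>Y \<times> Y. 0 \<le> inner (vi_op \<rho> \<sigma> \<delta> x w) (c - w))"
proof -
  obtain y z where yz: "w = (y, z)" by force
  have Yw: "y \<in> Y" "z \<in> Y" using w yz by auto
  define a b where ab: "a = fst (vi_op \<rho> \<sigma> \<delta> x (y, z))" "b = snd (vi_op \<rho> \<sigma> \<delta> x (y, z))"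
  have VI: "(\<forall>c\<in>Y \<times> Y. 0 \<le> inner (vi_op \<rho> \<sigma> \<delta> x w) (c - w))
      \<longleftrightarrow> (\<forall>u\<in>Y. 0 \<le> inner a (u - y)) \<and> (\<forall>u\<in>Y. 0 \<le> inner b (u - z))" (is "?l \<longleftrightarrow> ?r")
  proof
    assume l: ?l
    have "0 \<le> inner a (u - y)" if "u \<in> Y" for u
      using bspec[OF l, of "(u, z)"] that Yw by (simp add: yz inner_prod_def ab)
    moreover have "0 \<le> inner b (u - z)" if "u \<in> Y" for u
      using bspec[OF l, of "(y, u)"] that Yw by (simp add: yz inner_prod_def ab)
    ultimately show ?r by blast
  next
    assume ?r then show ?l by (auto simp: yz inner_prod_def ab)
  qed
  have Fd: "((\<lambda>v. F (x, v)) has_derivative (\<lambda>h. inner h (Fy x y))) (at y within Y)"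
    using partial_has_derivative(2)[OF F_diff[of "(x, y)"]]
    by (simp add: Fy_def inner_prod_def has_derivative_at_withinI)
  have fd: "((\<lambda>v. f (x, v)) has_derivative (\<lambda>h. inner h (fy x v))) (at v within Y)" for v
    using partial_has_derivative(2)[OF f_diff[of "(x, v)"]]
    by (simp add: fy_def inner_prod_def has_derivative_at_withinI)
  show ?thesis unfolding VI
  proof (intro iffI conjI ballI)
    fix u assume u: "u \<in> Y" and s: "is_saddle_point Y (psi F f \<rho> \<sigma> \<delta> x) w"
    have "((\<lambda>v. - psi F f \<rho> \<sigma> \<delta> x v z) has_derivative (\<lambda>h. inner a h)) (at y within Y)"
      unfolding psi_def ab vi_op_def power2_norm_eq_inner
      by (auto intro!: derivative_eq_intros Fd fd simp: algebra_simps inner_commute)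
    from minimum_variational_inequality[OF this Y(3) Yw(1) u] s
    show "0 \<le> inner a (u - y)" by (auto simp: is_saddle_point_def yz)
    have "((\<lambda>v. psi F f \<rho> \<sigma> \<delta> x y v) has_derivative (\<lambda>h. inner b h)) (at z within Y)"
      unfolding psi_def ab vi_op_def power2_norm_eq_inner
      by (auto intro!: derivative_eq_intros Fd fd simp: algebra_simps inner_commute)
    from minimum_variational_inequality[OF this Y(3) Yw(2) u] s
    show "0 \<le> inner b (u - z)" by (auto simp: is_saddle_point_def yz)
  next
    assume r: "(\<forall>u\<in>Y. 0 \<le> inner a (u - y)) \<and> (\<forall>u\<in>Y. 0 \<le> inner b (u - z))"
    have nn: "0 \<le> c / 2 * (norm v)\<^sup>2" if "0 < c" for c :: real and v :: 'b using that by simp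
    have "psi F f \<rho> \<sigma> \<delta> x u z \<le> psi F f \<rho> \<sigma> \<delta> x y z" if "u \<in> Y" for u
      using psi_upper[OF x Yw(1) that pos(1), of \<sigma> \<delta> z] bspec[OF conjunct1[OF r] that]
        nn[of \<delta> "u - y"] pos unfolding ab by linarith
    moreover have "psi F f \<rho> \<sigma> \<delta> x y z \<le> psi F f \<rho> \<sigma> \<delta> x y u" if "u \<in> Y" for u
      using psi_lower[OF x Yw(2) that pos(1), of \<sigma> \<delta> y] bspec[OF conjunct2[OF r] that]
        nn[of \<sigma> "u - z"] pos unfolding ab by linarith
    ultimately show "is_saddle_point Y (psi F f \<rho> \<sigma> \<delta> x) w"
      using Yw by (auto simp: is_saddle_point_def yz)
  qed
qed

lemma is_saddle_point_saddle_point: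
  assumes x: "x \<in> X" and pos: "0 < \<rho>" "0 < \<sigma>" "0 < \<delta>"
  shows "is_saddle_point Y (psi F f \<rho> \<sigma> \<delta> x) (saddle_point Y F f \<rho> \<sigma> \<delta> x)"
proof -
  note mono = vi_op_strongly_monotone[OF x _ _ pos(1), of _ _ \<sigma> \<delta>]
  have mu: "0 < min \<sigma> \<delta>" using pos by simp
  have "\<exists>w\<in>Y \<times> Y. \<forall>c\<in>Y \<times> Y. 0 \<le> inner (vi_op \<rho> \<sigma> \<delta> x w) (c - w)"
    using strongly_monotone_VI_exists[of "Y \<times> Y", OF _ _ _ mono vi_op_lipschitz[OF x _ _ pos] mu] Y
    by (simp add: convex_Times closed_Times)
  then obtain w where w: "w \<in> Y \<times> Y" "\<forall>c\<in>Y \<times> Y. 0 \<le> inner (vi_op \<rho> \<sigma> \<delta> x w) (c - w)"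
    by blast
  have "\<exists>!p. is_saddle_point Y (psi F f \<rho> \<sigma> \<delta> x) p"
  proof (rule ex1I)
    show "is_saddle_point Y (psi F f \<rho> \<sigma> \<delta> x) w" using saddle_iff_VI[OF x pos w(1)] w(2) by blast
    fix p assume p: "is_saddle_point Y (psi F f \<rho> \<sigma> \<delta> x) p"
    then have pY: "p \<in> Y \<times> Y" by (auto simp: is_saddle_point_def mem_Times_iff)
    with saddle_iff_VI[OF x pos pY] p
    have "\<forall>c\<in>Y \<times> Y. 0 \<le> inner (vi_op \<rho> \<sigma> \<delta> x p) (c - p)" by blast
    \<comment> \<open>Perturbation by nothing: with both operators equal the right-hand side is
      zero.\<close>
    then have "min \<sigma> \<delta> * norm (p - w) \<le> norm (vi_op \<rho> \<sigma> \<delta> x w - vi_op \<rho> \<sigma> \<delta> x w)"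
      using w pY by (intro VI_perturbation[where C = "Y \<times> Y"] mono) auto
    then have "norm (p - w) \<le> 0" using mu by (simp add: mult_le_0_iff)
    then show "p = w" by simp
  qed
  then show ?thesis unfolding saddle_point_def by (rule theI')
qed

context
  fixes x :: 'a and \<rho> \<sigma> \<delta> :: real
  assumes x: "x \<in> X" and pos: "0 < \<rho>" "0 < \<sigma>" "0 < \<delta>"
begin

lemma saddle_point_in: "saddle_point Y F f \<rho> \<sigma> \<delta> x \<in> Y \<times> Y"
  and fst_saddle_in: "fst (saddle_point Y F f \<rho> \<sigma> \<delta> x) \<in> Y"
  and snd_saddle_in: "snd (saddle_point Y F f \<rho> \<sigma> \<delta> x) \<in> Y"
  using is_saddle_point_saddle_point[OF x pos] by (auto simp: is_saddle_point_def mem_Times_iff)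

lemma saddle_point_VI:
  "c \<in> Y \<times> Y \<Longrightarrow> 0 \<le> inner (vi_op \<rho> \<sigma> \<delta> x (saddle_point Y F f \<rho> \<sigma> \<delta> x)) (c - saddle_point Y F f \<rho> \<sigma> \<delta> x)"
  using saddle_iff_VI[OF x pos saddle_point_in] is_saddle_point_saddle_point[OF x pos] by blast

lemma saddle_point_normal:
  defines "w \<equiv> saddle_point Y F f \<rho> \<sigma> \<delta> x"
  shows "- fst (vi_op \<rho> \<sigma> \<delta> x w) \<in> normal_cone Y (fst w)"
    and "- snd (vi_op \<rho> \<sigma> \<delta> x w) \<in> normal_cone Y (snd w)"
  using saddle_point_VI[of "(_, snd w)"] saddle_point_VI[of "(fst w, _)"] fst_saddle_in snd_saddle_in
  by (auto simp: normal_cone_def w_def inner_prod_def)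

lemma psi_le_saddle: "u \<in> Y \<Longrightarrow> psi F f \<rho> \<sigma> \<delta> x u (snd (saddle_point Y F f \<rho> \<sigma> \<delta> x))
    \<le> psi F f \<rho> \<sigma> \<delta> x (fst (saddle_point Y F f \<rho> \<sigma> \<delta> x)) (snd (saddle_point Y F f \<rho> \<sigma> \<delta> x))"
  and saddle_le_psi: "u \<in> Y \<Longrightarrow> psi F f \<rho> \<sigma> \<delta> x (fst (saddle_point Y F f \<rho> \<sigma> \<delta> x)) (snd (saddle_point Y F f \<rho> \<sigma> \<delta> x))
    \<le> psi F f \<rho> \<sigma> \<delta> x (fst (saddle_point Y F f \<rho> \<sigma> \<delta> x)) u"
  using is_saddle_point_saddle_point[OF x pos] by (auto simp: is_saddle_point_def)

lemma phi_approx_eq: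
  "phi_approx Y F f \<rho> \<sigma> \<delta> x
     = psi F f \<rho> \<sigma> \<delta> x (fst (saddle_point Y F f \<rho> \<sigma> \<delta> x)) (snd (saddle_point Y F f \<rho> \<sigma> \<delta> x))"
    (is "_ = psi F f \<rho> \<sigma> \<delta> x ?y ?z")
proof -
  \<comment> \<open>A real \<open>SUP\<close> carries information only for bounded sets. Here the
    term \<open>\<delta> / 2 * (norm (u - ?y))\<^sup>2\<close> dominates the linear one by Young's
    inequality, for every z.\<close>
  have bdd: "bdd_above ((\<lambda>y. psi F f \<rho> \<sigma> \<delta> x y z) ` Y)" for z
  proof (rule bdd_aboveI2)
    fix u assume u: "u \<in> Y"
    let ?a = "fst (vi_op \<rho> \<sigma> \<delta> x (?y, z))"
    have "- inner ?a (u - ?y) \<le> norm ?a * norm (u - ?y)"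
      by (metis Cauchy_Schwarz_ineq2 abs_le_D2)
    also have "\<dots> \<le> (norm ?a)\<^sup>2 / (2 * \<delta>) + \<delta> / 2 * (norm (u - ?y))\<^sup>2"
    proof -
      have "0 \<le> (norm ?a - \<delta> * norm (u - ?y))\<^sup>2 / (2 * \<delta>)" using pos by simp
      then show ?thesis using pos by (simp add: field_simps power2_eq_square)
    qed
    finally show "psi F f \<rho> \<sigma> \<delta> x u z \<le> psi F f \<rho> \<sigma> \<delta> x ?y z + (norm ?a)\<^sup>2 / (2 * \<delta>)"
      using psi_upper[OF x fst_saddle_in u pos(1), of \<sigma> \<delta> z] by linarith
  qed
  show ?thesis unfolding phi_approx_def
  proof (rule antisym)
    have lb: "psi F f \<rho> \<sigma> \<delta> x ?y ?z \<le> (SUP y\<in>Y. psi F f \<rho> \<sigma> \<delta> x y z)" if "z \<in> Y" for z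
      using cSUP_upper[OF fst_saddle_in bdd, of z] saddle_le_psi[OF that] by linarith
    then show "psi F f \<rho> \<sigma> \<delta> x ?y ?z \<le> (INF z\<in>Y. SUP y\<in>Y. psi F f \<rho> \<sigma> \<delta> x y z)"
      using Y(1) by (intro cINF_greatest)
    have "(INF z\<in>Y. SUP y\<in>Y. psi F f \<rho> \<sigma> \<delta> x y z) \<le> (SUP y\<in>Y. psi F f \<rho> \<sigma> \<delta> x y ?z)"
      using lb by (intro cINF_lower snd_saddle_in bdd_belowI2)
    also have "\<dots> \<le> psi F f \<rho> \<sigma> \<delta> x ?y ?z"
      using psi_le_saddle Y(1) by (intro cSUP_least)
    finally show "(INF z\<in>Y. SUP y\<in>Y. psi F f \<rho> \<sigma> \<delta> x y z) \<le> psi F f \<rho> \<sigma> \<delta> x ?y ?z" .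
  qed
qed

end

end

context bilevel_data
begin

section \<open>A priori bounds on the saddle point\<close>

text \<open>Coercivity is given for each x separately; compactness of \<open>X\<close> and concavity
  make it uniform. If points of a superlevel set ran off to infinity, concavity would keep the
  values large at a fixed distance \<open>T\<close> from \<open>y0\<close> on the segments towards
  them, and a limit of these nearer points would contradict coercivity at the limit of the
  x.\<close>

lemma superlevel_bounded: "\<exists>R. \<forall>x\<in>X. \<forall>y\<in>Y. M \<le> F (x, y) \<longrightarrow> norm y \<le> R"
proof (rule ccontr)
  assume "\<not> ?thesis"
  then have "\<forall>n::nat. \<exists>p. fst p \<in> X \<and> snd p \<in> Y \<and> M \<le> F p \<and> real n < norm (snd p)"
    by (metis fst_conv linorder_not_le snd_conv)
  then obtain p where p: "\<And>n. fst (p n) \<in> X" "\<And>n. snd (p n) \<in> Y" "\<And>n. M \<le> F (p n)"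
    "\<And>n::nat. real n < norm (snd (p n))" by metis
  obtain y0 where y0: "y0 \<in> Y" using Y(1) by blast
  have "continuous_on X (\<lambda>x. F (x, y0))"
    by (rule continuous_on_compose2[OF continuous_F[of UNIV]]) (auto intro!: continuous_intros)
  then obtain m where m: "\<And>x. x \<in> X \<Longrightarrow> m \<le> F (x, y0)"
    using continuous_attains_inf[OF X(2,1)] by meson
  \<comment> \<open>With this level both ends of the segment from \<open>y0\<close> to
    \<open>snd (p n)\<close> have values at least \<open>M'\<close>.\<close>
  define M' where "M' = min M m"
  define u where "u n = sgn (snd (p n) - y0)" for n
  have c: "compact (X \<times> cball 0 1 :: ('a \<times> 'b) set)" using X(2) by (intro compact_Times) auto
  have "(fst (p n), u n) \<in> X \<times> cball 0 1" for n using p(1) by (simp add: u_def norm_sgn)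
  then have "\<exists>l\<in>X \<times> cball 0 1. \<exists>r. strict_mono r \<and> ((\<lambda>n. (fst (p n), u n)) \<circ> r) \<longlonglongrightarrow> l"
    using spec[OF c[unfolded compact_def], of "\<lambda>n. (fst (p n), u n)"] by blast
  then obtain l r where l: "l \<in> X \<times> cball 0 1" and r: "strict_mono r"
    and lim: "((\<lambda>n. (fst (p n), u n)) \<circ> r) \<longlonglongrightarrow> l"
    by blast
  define x0 v where "x0 = fst l" and "v = snd l"
  have limx: "(\<lambda>n. fst (p (r n))) \<longlonglongrightarrow> x0" and limu: "(\<lambda>n. u (r n)) \<longlonglongrightarrow> v"
    using tendsto_fst[OF lim] tendsto_snd[OF lim] by (simp_all add: x0_def v_def o_def)
  have x0: "x0 \<in> X" using l by (auto simp: x0_def)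
  have "eventually (\<lambda>y. F (x0, y) < M') (inf at_infinity (principal Y))"
    using F_coercive[OF x0] by (simp add: filterlim_at_bot_dense)
  then obtain b where b: "\<And>y. y \<in> Y \<Longrightarrow> b \<le> norm y \<Longrightarrow> F (x0, y) < M'"
    by (auto simp: eventually_inf_principal eventually_at_infinity)
  \<comment> \<open>Chosen so that a point at distance \<open>T\<close> from \<open>y0\<close> has
    norm at least \<open>b\<close>, where coercivity at \<open>x0\<close> forces values below
    \<open>M'\<close>.\<close>
  define T where "T = max 0 (b + norm y0)"
  have far: "\<forall>\<^sub>F n in sequentially. T + norm y0 + 1 \<le> norm (snd (p (r n)))"
  proof -
    obtain N :: nat where N: "T + norm y0 + 1 \<le> real N" using real_arch_simple by blast
    have "T + norm y0 + 1 \<le> norm (snd (p (r n)))" if "N \<le> n" for n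
      using p(4)[of "r n"] N that seq_suble[OF r, of n] by (smt (verit) of_nat_mono)
    then show ?thesis by (auto simp: eventually_sequentially)
  qed
  have ev: "\<forall>\<^sub>F n in sequentially. y0 + T *\<^sub>R u (r n) \<in> Y \<and> M' \<le> F (fst (p (r n)), y0 + T *\<^sub>R u (r n))"
    using far
  proof eventually_elim
    case (elim n)
    let ?d = "snd (p (r n)) - y0"
    have d: "T + 1 \<le> norm ?d" using elim norm_triangle_ineq2[of "snd (p (r n))" y0] by linarith
    define t where "t = T / norm ?d"
    have T: "0 \<le> T" by (simp add: T_def)
    then have t: "0 \<le> t" "t \<le> 1" using d by (simp_all add: t_def divide_le_eq)
    have eq: "y0 + T *\<^sub>R u (r n) = (1 - t) *\<^sub>R y0 + t *\<^sub>R snd (p (r n))"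
      using d by (simp add: u_def sgn_div_norm t_def algebra_simps divide_inverse)
    have "M' = (1 - t) * M' + t * M'" by (simp add: algebra_simps)
    also have "\<dots> \<le> (1 - t) * F (fst (p (r n)), y0) + t * F (fst (p (r n)), snd (p (r n)))"
      using t m[OF p(1)[of "r n"]] p(3)[of "r n"] by (intro add_mono mult_left_mono) (auto simp: M'_def)
    also have "\<dots> \<le> F (fst (p (r n)), y0 + T *\<^sub>R u (r n))"
      unfolding eq using concave_onD[OF F_concave[OF p(1)] t y0 p(2)] .
    finally show ?case using Y(3) y0 p(2) t eq by (simp add: convexD_alt)
  qed
  have lim2: "(\<lambda>n. y0 + T *\<^sub>R u (r n)) \<longlonglongrightarrow> y0 + T *\<^sub>R v"
    by (intro tendsto_intros limu)
  have inY: "y0 + T *\<^sub>R v \<in> Y"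
    using ev by (intro Lim_in_closed_set[OF Y(2) _ _ lim2]) (auto elim: eventually_mono)
  have "isCont F (x0, y0 + T *\<^sub>R v)" using continuous_F[of UNIV] by (simp add: continuous_on_eq_continuous_at)
  then have "(\<lambda>n. F (fst (p (r n)), y0 + T *\<^sub>R u (r n))) \<longlonglongrightarrow> F (x0, y0 + T *\<^sub>R v)"
    by (rule isCont_tendsto_compose) (intro tendsto_Pair limx lim2)
  then have "M' \<le> F (x0, y0 + T *\<^sub>R v)"
    by (rule tendsto_lowerbound) (use ev in \<open>auto elim: eventually_mono\<close>)
  moreover have "norm v = 1"
  proof -
    have "(\<lambda>n. norm (u (r n))) \<longlonglongrightarrow> norm v" by (intro tendsto_intros limu)
    moreover have "\<forall>\<^sub>F n in sequentially. norm (u (r n)) = 1"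
      using far
    proof eventually_elim
      case (elim n)
      then have "snd (p (r n)) \<noteq> y0" by (auto simp: T_def)
      then show ?case by (simp add: u_def norm_sgn)
    qed
    then have "(\<lambda>n. norm (u (r n))) \<longlonglongrightarrow> 1" by (rule tendsto_eventually)
    ultimately show ?thesis by (rule LIMSEQ_unique)
  qed
  then have "b \<le> norm (y0 + T *\<^sub>R v)"
    using norm_triangle_ineq2[of "T *\<^sub>R v" "- y0"] by (simp add: T_def add.commute)
  ultimately show False using b[OF inY] by linarith
qed

context
  fixes x :: 'a and \<rho> \<sigma> \<delta> :: real and s y z :: 'b
  assumes x: "x \<in> X" and pos: "0 < \<rho>" "0 < \<sigma>" "0 < \<delta>" and s: "s \<in> lower_sol Y f x"
  defines "y \<equiv> fst (saddle_point Y F f \<rho> \<sigma> \<delta> x)" and "z \<equiv> snd (saddle_point Y F f \<rho> \<sigma> \<delta> x)"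
begin

lemma lower_solD: "s \<in> Y" "u \<in> Y \<Longrightarrow> f (x, s) \<le> f (x, u)"
  using s by (auto simp: lower_sol_def is_arg_min_linorder)

lemma saddle_in: "y \<in> Y" "z \<in> Y"
  using fst_saddle_in[OF x pos] snd_saddle_in[OF x pos] by (auto simp: y_def z_def)

text \<open>A lower-level solution \<open>s\<close> is a fixed point of the proximal map that takes
  \<open>y\<close> to \<open>z\<close>, and proximal maps are nonexpansive. The proof tests the
  variational inequality with \<open>s\<close> in the place of \<open>z\<close>.\<close>

lemma proximal_nonexpansive: "norm (z - s) \<le> norm (y - s)"
proof -
  have "0 \<le> inner (snd (vi_op \<rho> \<sigma> \<delta> x (y, z))) (s - z)"
    using saddle_point_VI[OF x pos, of "(y, s)"] saddle_in lower_solD(1) by (simp add: inner_prod_def y_def z_def)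
  then have "0 \<le> \<rho> * inner (s - z) (fy x z) + \<sigma> * inner (z - y) (s - z)"
    by (simp add: vi_op_def inner_add_left inner_add_right inner_commute)
  moreover have "\<rho> * inner (s - z) (fy x z) \<le> 0"
    using f_above_tangent[OF x saddle_in(2) lower_solD(1)] lower_solD(2)[OF saddle_in(2)] pos
    by (simp add: mult_le_0_iff)
  ultimately have "0 \<le> inner (z - y) (s - z)" using pos(2) by (smt (verit) mult_pos_neg)
  moreover have "(norm (y - s))\<^sup>2 = (norm (z - s))\<^sup>2 + (norm (y - z))\<^sup>2 + 2 * inner (z - y) (s - z)"
    by (simp add: power2_norm_eq_inner inner_diff_left inner_diff_right inner_commute)
  ultimately have "(norm (z - s))\<^sup>2 \<le> (norm (y - s))\<^sup>2" by (smt (verit) zero_le_power2)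
  then show ?thesis by simp
qed

text \<open>Completing the square exhibits the proximal objective that \<open>z\<close>
  minimises.\<close>

lemma psi_z_part:
  "psi F f \<rho> \<sigma> \<delta> x y u = F (x, y) - \<rho> * f (x, y) - (\<sigma> + \<delta>) / 2 * (norm y)\<^sup>2
      + (\<rho> * f (x, u) + \<sigma> / 2 * (norm (u - y))\<^sup>2)"
  by (simp add: psi_def power2_norm_eq_inner inner_diff_left inner_diff_right inner_commute field_simps)

lemma lower_value_z: "\<rho> * (f (x, z) - f (x, s)) \<le> \<sigma> / 2 * (norm (s - y))\<^sup>2"
proof -
  have "\<rho> * f (x, z) + \<sigma> / 2 * (norm (z - y))\<^sup>2 \<le> \<rho> * f (x, s) + \<sigma> / 2 * (norm (s - y))\<^sup>2"
    using saddle_le_psi[OF x pos lower_solD(1)] unfolding y_def[symmetric] z_def[symmetric] psi_z_part by simp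
  moreover have "0 \<le> \<sigma> / 2 * (norm (z - y))\<^sup>2" using pos by simp
  ultimately show ?thesis by (simp add: algebra_simps)
qed

lemma lower_value_y:
  "\<rho> * (f (x, y) - f (x, s)) + \<sigma> * inner (y - s) z + \<delta> / 2 * ((norm y)\<^sup>2 - (norm s)\<^sup>2) \<le> F (x, y) - F (x, s)"
  using psi_le_saddle[OF x pos lower_solD(1)] unfolding y_def[symmetric] z_def[symmetric]
  by (simp add: psi_def inner_diff_left inner_diff_right algebra_simps)

text \<open>A comparison of upper-level values free of \<open>\<rho>\<close>. The penalty
  \<open>\<rho> * (f (x, y) - f (x, s))\<close> is at least
  \<open>\<sigma> / 2 * (norm (z - y))\<^sup>2\<close> by the proximal inequality tested with
  \<open>y\<close>, and together with the coupling term it completes the square of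
  \<open>z - s\<close>. Uniform bounds and pessimistic optimality in the limit rest on this.\<close>

lemma upper_value_y: "(\<sigma> + \<delta>) / 2 * ((norm y)\<^sup>2 - (norm s)\<^sup>2) \<le> F (x, y) - F (x, s)"
proof -
  have "\<rho> * f (x, z) + \<sigma> / 2 * (norm (z - y))\<^sup>2 \<le> \<rho> * f (x, y)"
    using saddle_le_psi[OF x pos saddle_in(1)] unfolding y_def[symmetric] z_def[symmetric] psi_z_part by simp
  moreover have "\<rho> * f (x, s) \<le> \<rho> * f (x, z)"
    using lower_solD(2)[OF saddle_in(2)] pos by simp
  moreover have "\<sigma> / 2 * ((norm y)\<^sup>2 - (norm s)\<^sup>2) \<le> \<sigma> / 2 * (norm (z - y))\<^sup>2 + \<sigma> * inner (y - s) z"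
  proof -
    have "0 \<le> \<sigma> / 2 * (norm (z - y + (y - s)))\<^sup>2" using pos by simp
    then show ?thesis
      by (simp add: power2_norm_eq_inner inner_diff_left inner_diff_right inner_commute field_simps)
  qed
  ultimately show ?thesis using lower_value_y by (simp add: field_simps)
qed

end

section \<open>A radius for the saddle points that is uniform in x and in the parameters\<close>

definition uniform_radius :: "real \<Rightarrow> bool" where
  "uniform_radius R \<longleftrightarrow> 0 < R \<and> (\<forall>x\<in>X. \<exists>s\<in>lower_sol Y f x. norm s \<le> R) \<and>
     (\<forall>x\<in>X. \<forall>\<rho>>0. \<forall>\<sigma>>0. \<forall>\<delta>>0. norm (fst (saddle_point Y F f \<rho> \<sigma> \<delta> x)) \<le> R \<and>
        norm (snd (saddle_point Y F f \<rho> \<sigma> \<delta> x)) \<le> R)"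

lemma bounded_on_compact:
  fixes h :: "'a \<times> 'b \<Rightarrow> 'c::real_normed_vector"
  assumes "continuous_on (X \<times> Y) h"
  shows "\<exists>M>0. \<forall>x\<in>X. \<forall>y\<in>Y. norm y \<le> R \<longrightarrow> norm (h (x, y)) \<le> M"
proof -
  have "compact (X \<times> (Y \<inter> cball 0 R))" using X(2) Y(2) by (intro compact_Times) (auto intro: closed_Int_compact)
  then have "compact (h ` (X \<times> (Y \<inter> cball 0 R)))"
    by (rule compact_continuous_image[rotated]) (rule continuous_on_subset[OF assms], auto)
  then obtain M where "M > 0" "\<forall>u\<in>h ` (X \<times> (Y \<inter> cball 0 R)). norm u \<le> M"
    using compact_imp_bounded bounded_pos by metis
  then show ?thesis by (intro exI[of _ M]) auto
qed

text \<open>If \<open>y\<close> is longer than a bounded lower-level solution \<open>s\<close>, then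
  \<open>upper_value_y\<close> puts it in the superlevel set of \<open>F (x, s)\<close>, which is
  bounded uniformly in x. The bound for \<open>z\<close> follows by nonexpansiveness.\<close>

lemma uniform_radius_exists: "\<exists>R. uniform_radius R"
proof -
  obtain R where R: "\<forall>x\<in>X. \<exists>v\<in>lower_sol Y f x. norm v \<le> R" using bounded_selection by blast
  obtain M where M: "\<forall>x\<in>X. \<forall>y\<in>Y. norm y \<le> R \<longrightarrow> norm (F (x, y)) \<le> M"
    using bounded_on_compact[OF continuous_F] by metis
  obtain R' where R': "\<forall>x\<in>X. \<forall>y\<in>Y. - M \<le> F (x, y) \<longrightarrow> norm y \<le> R'"
    using superlevel_bounded by blast
  \<comment> \<open>The 1 keeps the radius positive. The factor 3 below comes from
    \<open>norm z \<le> norm y + 2 * norm s\<close>.\<close>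
  define B where "B = max (max 1 R) R'"
  have yB: "norm (fst (saddle_point Y F f \<rho> \<sigma> \<delta> x)) \<le> B"
    and zB: "norm (snd (saddle_point Y F f \<rho> \<sigma> \<delta> x)) \<le> 3 * B"
    if x: "x \<in> X" and pos: "0 < \<rho>" "0 < \<sigma>" "0 < \<delta>" for x \<rho> \<sigma> \<delta>
  proof -
    obtain s where s: "s \<in> lower_sol Y f x" "norm s \<le> R" using R x by blast
    let ?y = "fst (saddle_point Y F f \<rho> \<sigma> \<delta> x)" and ?z = "snd (saddle_point Y F f \<rho> \<sigma> \<delta> x)"
    have sB: "norm s \<le> B" using s by (simp add: B_def)
    show yB: "norm ?y \<le> B"
    proof (cases "norm ?y \<le> norm s")
      case False
      then have "0 \<le> (\<sigma> + \<delta>) / 2 * ((norm ?y)\<^sup>2 - (norm s)\<^sup>2)" using pos by (intro mult_nonneg_nonneg) auto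
      also have "\<dots> \<le> F (x, ?y) - F (x, s)" using upper_value_y[OF x pos s(1)] .
      finally have "F (x, s) \<le> F (x, ?y)" by simp
      moreover have "- M \<le> F (x, s)" using M x s lower_solD(1)[OF x pos s(1)] by (smt (verit) real_norm_def)
      ultimately show ?thesis using R' x fst_saddle_in[OF x pos] by (force simp: B_def)
    qed (use sB in simp)
    show "norm ?z \<le> 3 * B"
      using proximal_nonexpansive[OF x pos s(1)] sB yB norm_triangle_ineq4[of ?y s] norm_triangle_ineq2[of ?z s]
      by linarith
  qed
  have "uniform_radius (3 * B)" unfolding uniform_radius_def
  proof (intro conjI ballI allI impI)
    show "0 < 3 * B" by (simp add: B_def)
    fix x assume x: "x \<in> X"
    show "\<exists>s\<in>lower_sol Y f x. norm s \<le> 3 * B" using R x by (force simp: B_def)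
    fix \<rho> \<sigma> \<delta> :: real assume "0 < \<rho>" "0 < \<sigma>" "0 < \<delta>"
    then show "norm (fst (saddle_point Y F f \<rho> \<sigma> \<delta> x)) \<le> 3 * B" "norm (snd (saddle_point Y F f \<rho> \<sigma> \<delta> x)) \<le> 3 * B"
      using yB[of x \<rho> \<sigma> \<delta>] zB x \<open>0 < 3 * B\<close> by fastforce+
  qed
  then show ?thesis by blast
qed


section \<open>Sensitivity of the saddle point and of its value\<close>

lemma saddle_lipschitz_x:
  assumes "x \<in> X" "x' \<in> X" and pos: "0 < \<rho>" "0 < \<sigma>" "0 < \<delta>"
  shows "min \<sigma> \<delta> * norm (saddle_point Y F f \<rho> \<sigma> \<delta> x - saddle_point Y F f \<rho> \<sigma> \<delta> x')
      \<le> (L + 2 * \<rho> * L) * norm (x - x')"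
  using VI_perturbation[where C = "Y \<times> Y" and T = "vi_op \<rho> \<sigma> \<delta> x" and U = "vi_op \<rho> \<sigma> \<delta> x'",
      OF saddle_point_VI[OF assms(1) pos] saddle_point_VI[OF assms(2) pos]
        saddle_point_in[OF assms(1) pos] saddle_point_in[OF assms(2) pos]
        vi_op_strongly_monotone[OF assms(1) saddle_point_in[OF assms(1) pos] saddle_point_in[OF assms(2) pos] pos(1)]]
    vi_op_lipschitz_x[OF assms(1,2) saddle_point_in[OF assms(2) pos] pos(1), of \<sigma> \<delta>]
  by linarith

text \<open>The operators are compared at a saddle point, which lies in the ball of radius
  \<open>R\<close>; so a bound on the gradient of \<open>f\<close> over that ball suffices although
  \<open>Y\<close> may be unbounded.\<close>

lemma saddle_lipschitz_params:
  assumes x: "x \<in> X" and pos: "0 < \<rho>" "0 < \<sigma>" "0 < \<delta>" and pos': "0 < \<rho>'" "0 < \<sigma>'" "0 < \<delta>'"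
    and R: "uniform_radius R" and M: "\<forall>x\<in>X. \<forall>y\<in>Y. norm y \<le> R \<longrightarrow> norm (fy x y) \<le> M"
  shows "min \<sigma> \<delta> * norm (saddle_point Y F f \<rho> \<sigma> \<delta> x - saddle_point Y F f \<rho>' \<sigma>' \<delta>' x)
      \<le> 2 * M * \<bar>\<rho> - \<rho>'\<bar> + 3 * R * \<bar>\<sigma> - \<sigma>'\<bar> + R * \<bar>\<delta> - \<delta>'\<bar>"
proof -
  define y z where "y = fst (saddle_point Y F f \<rho>' \<sigma>' \<delta>' x)" and "z = snd (saddle_point Y F f \<rho>' \<sigma>' \<delta>' x)"
  have w: "saddle_point Y F f \<rho>' \<sigma>' \<delta>' x = (y, z)" by (simp add: y_def z_def)
  have yz: "norm y \<le> R" "norm z \<le> R" using R x pos' by (auto simp: uniform_radius_def y_def z_def)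
  have n: "norm (fy x y) \<le> M" "norm (fy x z) \<le> M" "norm (z - y) \<le> 2 * R"
    using M x yz fst_saddle_in[OF x pos'] snd_saddle_in[OF x pos'] norm_triangle_ineq4[of z y]
    by (auto simp: y_def z_def)
  have "vi_op \<rho> \<sigma> \<delta> x (y, z) - vi_op \<rho>' \<sigma>' \<delta>' x (y, z)
      = ((\<rho> - \<rho>') *\<^sub>R fy x y + (\<sigma> - \<sigma>') *\<^sub>R z + (\<delta> - \<delta>') *\<^sub>R y, (\<rho> - \<rho>') *\<^sub>R fy x z + (\<sigma> - \<sigma>') *\<^sub>R (z - y))" (is "_ = (?a, ?b)")
    by (simp add: vi_op_def algebra_simps)
  moreover have "norm ?a \<le> \<bar>\<rho> - \<rho>'\<bar> * M + \<bar>\<sigma> - \<sigma>'\<bar> * R + \<bar>\<delta> - \<delta>'\<bar> * R"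
    using n yz by (intro norm_triangle_le add_mono) (auto intro: mult_left_mono)
  moreover have "norm ?b \<le> \<bar>\<rho> - \<rho>'\<bar> * M + \<bar>\<sigma> - \<sigma>'\<bar> * (2 * R)"
    using n yz by (intro norm_triangle_le add_mono) (auto intro: mult_left_mono)
  ultimately have "norm (vi_op \<rho> \<sigma> \<delta> x (y, z) - vi_op \<rho>' \<sigma>' \<delta>' x (y, z))
      \<le> (\<bar>\<rho> - \<rho>'\<bar> * M + \<bar>\<sigma> - \<sigma>'\<bar> * R + \<bar>\<delta> - \<delta>'\<bar> * R) + (\<bar>\<rho> - \<rho>'\<bar> * M + \<bar>\<sigma> - \<sigma>'\<bar> * (2 * R))"
    by (simp only: norm_Pair_le_add)
  moreover have "min \<sigma> \<delta> * norm (saddle_point Y F f \<rho> \<sigma> \<delta> x - (y, z))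
      \<le> norm (vi_op \<rho> \<sigma> \<delta> x (y, z) - vi_op \<rho>' \<sigma>' \<delta>' x (y, z))"
    unfolding w[symmetric]
    by (intro VI_perturbation[where C = "Y \<times> Y"] saddle_point_VI x pos pos' saddle_point_in vi_op_strongly_monotone)
  ultimately show ?thesis unfolding w by (simp add: algebra_simps)
qed

text \<open>The partial gradient of \<psi> in x. At the saddle point it is the gradient of
  \<open>phi_approx\<close>; at the updated pair \<open>(y, z)\<close> it is the search direction of
  the algorithm.\<close>

definition phi_grad :: "real \<Rightarrow> 'a \<Rightarrow> 'b \<times> 'b \<Rightarrow> 'a" where
  "phi_grad \<rho> x w = Fx x (fst w) - \<rho> *\<^sub>R (fx x (fst w) - fx x (snd w))"

lemma phi_grad_lipschitz:
  assumes "x \<in> X" "v \<in> Y \<times> Y" "w \<in> Y \<times> Y" "0 < \<rho>"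
  shows "norm (phi_grad \<rho> x v - phi_grad \<rho> x w) \<le> (L + 2 * \<rho> * L) * norm (v - w)"
proof -
  let ?N = "norm (v - w)"
  have Yw: "fst v \<in> Y" "snd v \<in> Y" "fst w \<in> Y" "snd w \<in> Y" using assms by auto
  note n = norm_parts_le[of v w]
  have 1: "norm (fx x (fst v) - fx x (fst w)) \<le> L * ?N" "norm (fx x (snd v) - fx x (snd w)) \<le> L * ?N"
    "norm (Fx x (fst v) - Fx x (fst w)) \<le> L * ?N"
    using lipschitz_gradients[OF assms(1) assms(1) Yw(1,3)] lipschitz_gradients[OF assms(1) assms(1) Yw(2,4)]
      mult_left_mono[OF n(1) L_nonneg] mult_left_mono[OF n(2) L_nonneg]
    by simp_all
  have "phi_grad \<rho> x v - phi_grad \<rho> x w = (Fx x (fst v) - Fx x (fst w))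
      - \<rho> *\<^sub>R ((fx x (fst v) - fx x (fst w)) - (fx x (snd v) - fx x (snd w)))"
    by (simp add: phi_grad_def algebra_simps)
  also have "norm \<dots> \<le> L * ?N + \<rho> * (L * ?N + L * ?N)"
    using assms(4) 1(3) norm_triangle_le_diff[OF add_mono[OF 1(1,2)]]
    by (intro norm_triangle_le_diff[OF add_mono[OF 1(3)]]) simp
  finally show ?thesis by (simp add: algebra_simps)
qed

lemma psi_taylor:
  assumes "x \<in> X" "x' \<in> X" "w \<in> Y \<times> Y" "0 < \<rho>"
  shows "\<bar>psi F f \<rho> \<sigma> \<delta> x' (fst w) (snd w) - psi F f \<rho> \<sigma> \<delta> x (fst w) (snd w) - inner (x' - x) (phi_grad \<rho> x w)\<bar>
      \<le> (L + 2 * \<rho> * L) * (norm (x' - x))\<^sup>2"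
proof -
  define a b c where "a = F (x', fst w) - F (x, fst w) - inner (x' - x) (Fx x (fst w))"
    and "b = f (x', fst w) - f (x, fst w) - inner (x' - x) (fx x (fst w))"
    and "c = f (x', snd w) - f (x, snd w) - inner (x' - x) (fx x (snd w))"
  have Yw: "fst w \<in> Y" "snd w \<in> Y" using assms by auto
  have "\<bar>a\<bar> \<le> L * (norm (x' - x))\<^sup>2" "\<bar>b\<bar> \<le> L * (norm (x' - x))\<^sup>2" "\<bar>c\<bar> \<le> L * (norm (x' - x))\<^sup>2"
    using F_taylor f_taylor assms Yw by (auto simp: a_def b_def c_def)
  moreover from this have "\<bar>\<rho> * b\<bar> \<le> \<rho> * (L * (norm (x' - x))\<^sup>2)" "\<bar>\<rho> * c\<bar> \<le> \<rho> * (L * (norm (x' - x))\<^sup>2)"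
    using assms(4) by (auto simp: abs_mult)
  moreover have "psi F f \<rho> \<sigma> \<delta> x' (fst w) (snd w) - psi F f \<rho> \<sigma> \<delta> x (fst w) (snd w) - inner (x' - x) (phi_grad \<rho> x w)
      = a - \<rho> * b + \<rho> * c"
    by (simp add: psi_def phi_grad_def a_def b_def c_def algebra_simps)
  ultimately show ?thesis by (simp add: algebra_simps)
qed

text \<open>Danskin's theorem with a quadratic remainder. The saddle inequalities enclose the
  increment of the value between increments of \<psi> in x alone, at the mixed points (new y, old z)
  and (old y, new z). The first part of the constant is the Taylor remainder of \<psi>, the second
  the cost of moving the mixed points back to the saddle point at \<open>x\<close>.\<close>

lemma phi_expansion:
  assumes x: "x \<in> X" and x': "x' \<in> X" and pos: "0 < \<rho>" "0 < \<sigma>" "0 < \<delta>"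
  shows "\<bar>phi_approx Y F f \<rho> \<sigma> \<delta> x' - phi_approx Y F f \<rho> \<sigma> \<delta> x
      - inner (x' - x) (phi_grad \<rho> x (saddle_point Y F f \<rho> \<sigma> \<delta> x))\<bar>
      \<le> ((L + 2 * \<rho> * L) + (L + 2 * \<rho> * L)\<^sup>2 / min \<sigma> \<delta>) * (norm (x' - x))\<^sup>2"
proof -
  let ?w = "saddle_point Y F f \<rho> \<sigma> \<delta> x" and ?w' = "saddle_point Y F f \<rho> \<sigma> \<delta> x'"
  let ?K = "L + 2 * \<rho> * L" and ?d = "norm (x' - x)"
  have K: "0 \<le> ?K" using L_nonneg pos by simp
  have lip: "norm (?w' - ?w) \<le> ?K / min \<sigma> \<delta> * ?d"
    using saddle_lipschitz_x[OF x' x pos] pos by (simp add: field_simps split: if_splits)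
  have gr: "\<bar>inner (x' - x) (phi_grad \<rho> x u) - inner (x' - x) (phi_grad \<rho> x ?w)\<bar> \<le> ?K\<^sup>2 / min \<sigma> \<delta> * ?d\<^sup>2"
    if u: "u \<in> Y \<times> Y" "norm (u - ?w) \<le> norm (?w' - ?w)" for u
  proof -
    have "norm (phi_grad \<rho> x u - phi_grad \<rho> x ?w) \<le> ?K * norm (u - ?w)"
      using phi_grad_lipschitz[OF x u(1) saddle_point_in[OF x pos] pos(1)] .
    also have "\<dots> \<le> ?K * (?K / min \<sigma> \<delta> * ?d)" using K u(2) lip by (intro mult_left_mono) auto
    finally have "?d * norm (phi_grad \<rho> x u - phi_grad \<rho> x ?w) \<le> ?d * (?K * (?K / min \<sigma> \<delta> * ?d))"
      by (intro mult_left_mono) auto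
    then show ?thesis
      using Cauchy_Schwarz_ineq2[of "x' - x" "phi_grad \<rho> x u - phi_grad \<rho> x ?w"]
      by (simp add: inner_diff_right power2_eq_square mult_ac)
  qed
  have in1: "(fst ?w', snd ?w) \<in> Y \<times> Y" and in2: "(fst ?w, snd ?w') \<in> Y \<times> Y"
    using saddle_point_in[OF x pos] saddle_point_in[OF x' pos] by auto
  have n1: "norm ((fst ?w', snd ?w) - ?w) \<le> norm (?w' - ?w)"
    using norm_parts_le(1)[of ?w' ?w] by (cases ?w) (auto simp: norm_Pair)
  have n2: "norm ((fst ?w, snd ?w') - ?w) \<le> norm (?w' - ?w)"
    using norm_parts_le(2)[of ?w' ?w] by (cases ?w) (auto simp: norm_Pair)
  have up: "phi_approx Y F f \<rho> \<sigma> \<delta> x' - phi_approx Y F f \<rho> \<sigma> \<delta> x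
      \<le> psi F f \<rho> \<sigma> \<delta> x' (fst ?w') (snd ?w) - psi F f \<rho> \<sigma> \<delta> x (fst ?w') (snd ?w)"
    unfolding phi_approx_eq[OF x pos] phi_approx_eq[OF x' pos]
    using saddle_le_psi[OF x' pos snd_saddle_in[OF x pos]] psi_le_saddle[OF x pos fst_saddle_in[OF x' pos]] by linarith
  have lo: "psi F f \<rho> \<sigma> \<delta> x' (fst ?w) (snd ?w') - psi F f \<rho> \<sigma> \<delta> x (fst ?w) (snd ?w')
      \<le> phi_approx Y F f \<rho> \<sigma> \<delta> x' - phi_approx Y F f \<rho> \<sigma> \<delta> x"
    unfolding phi_approx_eq[OF x pos] phi_approx_eq[OF x' pos]
    using saddle_le_psi[OF x pos snd_saddle_in[OF x' pos]] psi_le_saddle[OF x' pos fst_saddle_in[OF x pos]] by linarith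
  show ?thesis
    using up lo psi_taylor[OF x x' in1 pos(1), of \<sigma> \<delta>] psi_taylor[OF x x' in2 pos(1), of \<sigma> \<delta>]
      gr[OF in1 n1] gr[OF in2 n2]
    by (simp add: distrib_right)
qed

lemma phi_has_derivative:
  assumes x: "x \<in> X" and pos: "0 < \<rho>" "0 < \<sigma>" "0 < \<delta>"
  shows "(phi_approx Y F f \<rho> \<sigma> \<delta> has_derivative
      (\<lambda>h. inner h (phi_grad \<rho> x (saddle_point Y F f \<rho> \<sigma> \<delta> x)))) (at x within X)"
proof -
  define K where "K = (L + 2 * \<rho> * L) + (L + 2 * \<rho> * L)\<^sup>2 / min \<sigma> \<delta>"
  let ?g = "phi_grad \<rho> x (saddle_point Y F f \<rho> \<sigma> \<delta> x)"
  have K: "0 \<le> K" using L_nonneg pos by (simp add: K_def)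
  show ?thesis
  proof (rule has_derivativeI_sandwich[where e = 1])
    show "bounded_linear (\<lambda>h. inner h ?g)" by (rule bounded_linear_inner_left)
    show "((\<lambda>u. K * norm (u - x)) \<longlongrightarrow> 0) (at x within X)"
      by (rule tendsto_eq_intros | simp)+
    fix u assume u: "u \<in> X" "u \<noteq> x"
    have "norm (phi_approx Y F f \<rho> \<sigma> \<delta> u - phi_approx Y F f \<rho> \<sigma> \<delta> x - inner (u - x) ?g) \<le> K * (norm (u - x))\<^sup>2"
      using phi_expansion[OF x u(1) pos] by (simp add: K_def)
    then show "norm (phi_approx Y F f \<rho> \<sigma> \<delta> u - phi_approx Y F f \<rho> \<sigma> \<delta> x - inner (u - x) ?g) / norm (u - x)
        \<le> K * norm (u - x)"
      using u by (simp add: field_simps power2_eq_square)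
  qed simp
qed

lemma proj_grad_map_eq:
  assumes x: "x \<in> X" and pos: "0 < \<rho>" "0 < \<sigma>" "0 < \<delta>" and a: "0 < \<alpha>"
  shows "proj_grad_map X Y F f \<alpha> \<rho> \<sigma> \<delta> x
      = (1 / \<alpha>) *\<^sub>R (x - closest_point X (x - \<alpha> *\<^sub>R phi_grad \<rho> x (saddle_point Y F f \<rho> \<sigma> \<delta> x)))"
proof -
  let ?g = "phi_grad \<rho> x (saddle_point Y F f \<rho> \<sigma> \<delta> x)"
  let ?v = "gradient (phi_approx Y F f \<rho> \<sigma> \<delta>) (at x within X)"
  let ?p = "closest_point X (x - \<alpha> *\<^sub>R ?g)"
  note der = phi_has_derivative[OF x pos]
  have eq: "inner (c - x) ?v = inner (c - x) ?g" if "c \<in> X" for c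
    using gradient_within_unique[OF has_derivative_gradient[OF der] der X(3) x that] .
  have p: "?p \<in> X" using closed_X X(1) by (rule closest_point_in_set)
  have "closest_point X (x - \<alpha> *\<^sub>R ?v) = ?p"
  proof (subst closest_point_eq_iff[OF X(3) closed_X p], intro ballI)
    fix c assume c: "c \<in> X"
    have "inner (?v - ?g) (c - ?p) = 0"
      using eq[OF c] eq[OF p] by (simp add: inner_diff_left inner_diff_right inner_commute)
    then have "inner (x - \<alpha> *\<^sub>R ?v - ?p) (c - ?p) = inner (x - \<alpha> *\<^sub>R ?g - ?p) (c - ?p)"
      by (simp add: inner_diff_left)
    also have "\<dots> \<le> 0" using closest_point_dot[OF X(3) closed_X c] .
    finally show "inner (x - \<alpha> *\<^sub>R ?v - ?p) (c - ?p) \<le> 0" .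
  qed
  then show ?thesis by (simp add: proj_grad_map_def)
qed

end

section \<open>Powers of the iteration counter and summability\<close>

text \<open>The shift by one keeps the base positive at \<open>k = 0\<close>, so exponents add
  without side conditions and every rate becomes a single exponent.\<close>

definition pw :: "nat \<Rightarrow> real \<Rightarrow> real" where "pw k a = real (k + 1) powr a"

lemma pw_pos [simp]: "0 < pw k a" and pw_nonneg [simp]: "0 \<le> pw k a" and pw_0 [simp]: "pw k 0 = 1"
  by (simp_all add: pw_def)

lemma pw_mult: "pw k a * pw k b = pw k (a + b)"
  by (simp add: pw_def powr_add)

lemma pw_power2: "(pw k a)\<^sup>2 = pw k (2 * a)"
  by (simp add: power2_eq_square pw_mult)

lemma pw_inverse: "inverse (pw k a) = pw k (- a)"
  by (simp add: pw_def powr_minus)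

lemma divide_pw_minus: "c / (d * pw k (- a)) = c * pw k a / d"
  by (simp add: pw_inverse[symmetric] inverse_eq_divide)

lemma pw_mono: "a \<le> b \<Longrightarrow> pw k a \<le> pw k b"
  by (simp add: pw_def powr_mono)

lemma pw_le_1: "a \<le> 0 \<Longrightarrow> pw k a \<le> 1" and pw_ge_1: "0 \<le> a \<Longrightarrow> 1 \<le> pw k a"
  using pw_mono[of a 0 k] pw_mono[of 0 a k] by simp_all

lemma pw_Suc_mono: "0 \<le> a \<Longrightarrow> pw k a \<le> pw (Suc k) a"
  unfolding pw_def by (rule powr_mono2) auto

lemma pw_Suc_antimono: "a \<le> 0 \<Longrightarrow> pw (Suc k) a \<le> pw k a"
  unfolding pw_def by (rule powr_mono2') auto

text \<open>Mean value theorem; for \<open>a \<le> 1\<close> the derivative is largest in modulus at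
  the left end.\<close>

lemma pw_diff:
  assumes "a \<le> 1"
  shows "\<bar>pw (Suc k) a - pw k a\<bar> \<le> \<bar>a\<bar> * pw k (a - 1)"
proof -
  have "\<exists>u>real (k + 1). u < real (Suc k + 1) \<and>
      real (Suc k + 1) powr a - real (k + 1) powr a = (real (Suc k + 1) - real (k + 1)) * (a * u powr (a - 1))"
    by (rule MVT2) (auto intro!: DERIV_powr derivative_eq_intros simp: field_simps)
  then obtain u where u: "real (k + 1) < u" "pw (Suc k) a - pw k a = a * u powr (a - 1)"
    by (auto simp: pw_def)
  have "u powr (a - 1) \<le> pw k (a - 1)"
    unfolding pw_def using u(1) assms by (intro powr_mono2') auto
  then show ?thesis unfolding u(2) abs_mult by (intro mult_left_mono) auto
qed

lemma pw_tendsto_0: "a < 0 \<Longrightarrow> (\<lambda>k. pw k a) \<longlonglongrightarrow> 0"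
  unfolding pw_def
  by (rule tendsto_neg_powr, assumption)
     (rule filterlim_compose[OF filterlim_real_sequentially], simp add: filterlim_Suc)

lemma pw_summable: "a < - 1 \<Longrightarrow> summable (\<lambda>k. pw k a)"
  using summable_Suc_iff[of "\<lambda>k. real k powr a"] summable_real_powr_iff[of a] by (simp add: pw_def)

lemma pw_eventually_le:
  assumes "a < b" "0 < c"
  shows "\<forall>\<^sub>F k in sequentially. C * pw k a \<le> c * pw k b"
proof -
  have "(\<lambda>k. C * pw k (a - b)) \<longlonglongrightarrow> C * 0" using assms by (intro tendsto_intros pw_tendsto_0) simp
  then have "\<forall>\<^sub>F k in sequentially. C * pw k (a - b) < c" using assms(2) by (intro order_tendstoD) auto
  then show ?thesis
  proof eventually_elim
    case (elim k)
    then have "C * pw k (a - b) * pw k b \<le> c * pw k b" by (intro mult_right_mono) auto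
    then show ?case by (simp add: mult.assoc pw_mult)
  qed
qed

section \<open>From descent to summability, and subsequences of small terms\<close>

lemma summable_of_descent:
  fixes V a \<eta> :: "nat \<Rightarrow> real"
  assumes desc: "\<forall>\<^sub>F k in sequentially. V (Suc k) \<le> V k - a k + \<eta> k"
    and lb: "\<And>k. m \<le> V k" and a: "\<And>k. 0 \<le> a k" and \<eta>: "summable \<eta>" "\<And>k. 0 \<le> \<eta> k"
  shows "summable a"
proof -
  obtain N where N: "\<And>k. N \<le> k \<Longrightarrow> V (Suc k) \<le> V k - a k + \<eta> k"
    using desc by (auto simp: eventually_sequentially)
  have bound: "(\<Sum>k<n. a (k + N)) \<le> V N - V (n + N) + (\<Sum>k<n. \<eta> (k + N))" for n
  proof (induction n)
    case (Suc n)
    then show ?case using N[of "n + N"] by simp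
  qed simp
  have "summable (\<lambda>k. \<eta> (k + N))" using \<eta>(1) by (simp add: summable_iff_shift)
  then have "(\<Sum>k<n. \<eta> (k + N)) \<le> (\<Sum>k. \<eta> (k + N))" for n
    using \<eta>(2) by (intro sum_le_suminf) auto
  then have "(\<Sum>k<n. a (k + N)) \<le> V N - m + (\<Sum>k. \<eta> (k + N))" for n
    using bound[of n] lb[of "n + N"] by (meson add_mono diff_left_mono order_trans)
  then have "summable (\<lambda>k. a (k + N))" by (rule summableI_nonneg_bounded[OF a])
  then show ?thesis by (simp add: summable_iff_shift)
qed

lemma frequently_subseq:
  assumes "\<And>j::nat. \<exists>\<^sub>F k in sequentially. P j k"
  shows "\<exists>r. strict_mono r \<and> (\<forall>j. P j (r j))"
proof -
  have "\<exists>r. \<forall>j. P j (r j) \<and> r j < r (Suc j)"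
  proof (rule dependent_nat_choice)
    show "\<exists>k. P 0 k" using assms[of 0] by (auto simp: frequently_sequentially)
    fix k j show "\<exists>k'. P (Suc j) k' \<and> k < k'"
      using assms[of "Suc j"] by (force simp: frequently_sequentially Suc_le_eq dest: spec[of _ "Suc k"])
  qed
  then show ?thesis by (auto simp: strict_mono_Suc_iff)
qed

text \<open>Otherwise the terms would eventually dominate a multiple of the harmonic series.\<close>

lemma summable_subseq_small:
  fixes a :: "nat \<Rightarrow> real"
  assumes "summable a" "\<And>k. 0 \<le> a k"
  shows "\<exists>r. strict_mono r \<and> (\<lambda>j. pw (r j) 1 * a (r j)) \<longlonglongrightarrow> 0"
proof -
  have ex: "\<exists>k\<ge>N. pw k 1 * a k < \<epsilon>" if e: "0 < \<epsilon>" for N \<epsilon>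
  proof (rule ccontr)
    assume "\<not> ?thesis"
    then have le: "\<epsilon> \<le> pw k 1 * a k" if "N \<le> k" for k using that by force
    have "norm (inverse (real (Suc k))) \<le> a k / \<epsilon>" if "N \<le> k" for k
      using le[OF that] e by (simp add: pw_def field_simps)
    then have "summable (\<lambda>k. inverse (real (Suc k)))"
      by (rule summable_comparison_test'[OF summable_divide[OF assms(1)]])
    then show False using not_summable_harmonic[where 'a = real] summable_Suc_iff[of "\<lambda>n. inverse (real n)"] by simp
  qed
  have "\<exists>\<^sub>F k in sequentially. pw k 1 * a k < inverse (real (Suc j))" for j
    using ex[of "inverse (real (Suc j))"] unfolding frequently_sequentially by (simp del: of_nat_Suc)
  then obtain r where r: "strict_mono r" "\<And>j. pw (r j) 1 * a (r j) < inverse (real (Suc j))"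
    using frequently_subseq[of "\<lambda>j k. pw k 1 * a k < inverse (real (Suc j))"] by blast
  have "(\<lambda>j. pw (r j) 1 * a (r j)) \<longlonglongrightarrow> 0"
    by (rule tendsto_sandwich[OF _ _ tendsto_const LIMSEQ_inverse_real_of_nat])
       (use r(2) assms(2) in \<open>auto intro!: always_eventually less_imp_le\<close>)
  then show ?thesis using r(1) by blast
qed

lemma norm_add_sq_le:
  fixes u v c :: real
  assumes "0 < \<epsilon>" "0 \<le> c" "c \<le> u + v" 
  shows "c\<^sup>2 \<le> (1 + \<epsilon>) * u\<^sup>2 + (1 + 1 / \<epsilon>) * v\<^sup>2"
proof -
  have "c\<^sup>2 \<le> (u + v)\<^sup>2" using assms by (intro power_mono) auto
  also have "0 \<le> (\<epsilon> * u - v)\<^sup>2 / \<epsilon>" using assms by simp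
  then have "(u + v)\<^sup>2 \<le> (1 + \<epsilon>) * u\<^sup>2 + (1 + 1 / \<epsilon>) * v\<^sup>2"
    using assms by (simp add: field_simps power2_eq_square)
  finally show ?thesis .
qed

section \<open>Descent of the merit function\<close>

context bilevel_data
begin

text \<open>A lower-level solution \<open>s\<close> inserted for y makes the penalty term
  nonnegative, whatever \<open>\<rho>\<close> is, and the remaining terms involving z complete to a
  square.\<close>

lemma phi_lower_bound:
  assumes x: "x \<in> X" and pos: "0 < \<rho>" "0 < \<sigma>" "0 < \<delta>" and R: "uniform_radius R"
    and M: "\<forall>x\<in>X. \<forall>y\<in>Y. norm y \<le> R \<longrightarrow> norm (F (x, y)) \<le> M"
  shows "- M - (\<sigma> + \<delta>) / 2 * R\<^sup>2 \<le> phi_approx Y F f \<rho> \<sigma> \<delta> x"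
proof -
  obtain s where s: "s \<in> lower_sol Y f x" "norm s \<le> R" using R x by (auto simp: uniform_radius_def)
  let ?z = "snd (saddle_point Y F f \<rho> \<sigma> \<delta> x)"
  have sY: "s \<in> Y" using lower_solD(1)[OF x pos s(1)] .
  have "psi F f \<rho> \<sigma> \<delta> x s ?z \<le> phi_approx Y F f \<rho> \<sigma> \<delta> x"
    unfolding phi_approx_eq[OF x pos] using psi_le_saddle[OF x pos sY] .
  moreover have "psi F f \<rho> \<sigma> \<delta> x s ?z = F (x, s) + \<rho> * (f (x, ?z) - f (x, s)) + \<sigma> / 2 * (norm (?z - s))\<^sup>2
      - (\<sigma> + \<delta>) / 2 * (norm s)\<^sup>2"
    by (simp add: psi_def power2_norm_eq_inner inner_diff_left inner_diff_right inner_commute field_simps)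
  moreover have "0 \<le> \<rho> * (f (x, ?z) - f (x, s))" "0 \<le> \<sigma> / 2 * (norm (?z - s))\<^sup>2"
    using lower_solD(2)[OF x pos s(1) snd_saddle_in[OF x pos]] pos by simp_all
  moreover have "- M \<le> F (x, s)" using M x sY s(2) by force
  moreover have "(\<sigma> + \<delta>) / 2 * (norm s)\<^sup>2 \<le> (\<sigma> + \<delta>) / 2 * R\<^sup>2"
    using s(2) pos by (intro mult_left_mono power_mono) auto
  ultimately show ?thesis by linarith
qed

text \<open>
  The gain from increasing \<open>\<rho>\<close> is of order \<open>\<sigma> / \<rho>\<close>, because the proximal point \<open>z\<close> is that close to
  being a minimiser of the lower-level problem. This makes the total drift of the value functions
  summable although \<open>\<rho>\<close> tends to infinity.
\<close>
lemma phi_params: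
  assumes x: "x \<in> X" and pos: "0 < \<rho>" "0 < \<sigma>" "0 < \<delta>" and pos': "0 < \<rho>'" "0 < \<sigma>'" "0 < \<delta>'"
    and R: "uniform_radius R" and le: "\<rho> \<le> \<rho>'"
  shows "phi_approx Y F f \<rho>' \<sigma>' \<delta>' x - phi_approx Y F f \<rho> \<sigma> \<delta> x
      \<le> (\<rho>' - \<rho>) * (2 * R\<^sup>2 * \<sigma> / \<rho>) + 2 * R\<^sup>2 * \<bar>\<sigma>' - \<sigma>\<bar> + R\<^sup>2 * \<bar>\<delta>' - \<delta>\<bar>"
proof -
  obtain s where s: "s \<in> lower_sol Y f x" "norm s \<le> R" using R x by (auto simp: uniform_radius_def)
  define y y' z where "y = fst (saddle_point Y F f \<rho> \<sigma> \<delta> x)" and "y' = fst (saddle_point Y F f \<rho>' \<sigma>' \<delta>' x)"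
    and "z = snd (saddle_point Y F f \<rho> \<sigma> \<delta> x)"
  have n: "norm y \<le> R" "norm y' \<le> R" "norm z \<le> R" using R x pos pos' by (auto simp: uniform_radius_def y_def y'_def z_def)
  have R0: "0 < R" using R by (simp add: uniform_radius_def)
  \<comment> \<open>At the mixed pair (new y, old z) both saddle inequalities point the right way,
    and only the parameters change.\<close>
  have "phi_approx Y F f \<rho>' \<sigma>' \<delta>' x - phi_approx Y F f \<rho> \<sigma> \<delta> x
      \<le> psi F f \<rho>' \<sigma>' \<delta>' x y' z - psi F f \<rho> \<sigma> \<delta> x y' z"
    unfolding phi_approx_eq[OF x pos] phi_approx_eq[OF x pos'] y'_def z_def
    using saddle_le_psi[OF x pos' snd_saddle_in[OF x pos]] psi_le_saddle[OF x pos fst_saddle_in[OF x pos']] by linarith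
  also have "\<dots> = (\<rho>' - \<rho>) * (f (x, z) - f (x, y')) + ((\<sigma>' - \<sigma>) * ((norm z)\<^sup>2 / 2 - inner y' z) - (\<delta>' - \<delta>) * ((norm y')\<^sup>2 / 2))"
    by (simp add: psi_def field_simps)
  also have "\<dots> \<le> (\<rho>' - \<rho>) * (2 * R\<^sup>2 * \<sigma> / \<rho>) + (\<bar>\<sigma>' - \<sigma>\<bar> * (2 * R\<^sup>2) + \<bar>\<delta>' - \<delta>\<bar> * R\<^sup>2)"
  proof (intro add_mono)
    have "norm (s - y) \<le> 2 * R" using s(2) n(1) norm_triangle_ineq4[of s y] by linarith
    then have "(norm (s - y))\<^sup>2 \<le> (2 * R)\<^sup>2" by (intro power_mono) auto
    then have "\<sigma> / 2 * (norm (s - y))\<^sup>2 \<le> \<sigma> / 2 * (4 * R\<^sup>2)"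
      using pos by (intro mult_left_mono) (auto simp: power_mult_distrib)
    then have "\<rho> * (f (x, z) - f (x, s)) \<le> 2 * R\<^sup>2 * \<sigma>"
      using lower_value_z[OF x pos s(1)] unfolding y_def[symmetric] z_def[symmetric] by (simp add: algebra_simps)
    moreover have "f (x, s) \<le> f (x, y')"
      using lower_solD(2)[OF x pos s(1) fst_saddle_in[OF x pos']] by (simp add: y'_def)
    then have "\<rho> * f (x, s) \<le> \<rho> * f (x, y')" using pos by simp
    ultimately have "\<rho> * (f (x, z) - f (x, y')) \<le> 2 * R\<^sup>2 * \<sigma>" by (simp add: algebra_simps)
    then have "f (x, z) - f (x, y') \<le> 2 * R\<^sup>2 * \<sigma> / \<rho>" using pos by (simp add: field_simps)
    then show "(\<rho>' - \<rho>) * (f (x, z) - f (x, y')) \<le> (\<rho>' - \<rho>) * (2 * R\<^sup>2 * \<sigma> / \<rho>)"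
      using le by (intro mult_left_mono) auto
    have z2: "(norm z)\<^sup>2 \<le> R\<^sup>2" "(norm y')\<^sup>2 \<le> R\<^sup>2" using n by (auto intro: power_mono)
    have "norm y' * norm z \<le> R * R" using n R0 by (intro mult_mono) auto
    then have "\<bar>inner y' z\<bar> \<le> R\<^sup>2" using Cauchy_Schwarz_ineq2[of y' z] by (simp add: power2_eq_square)
    then have "\<bar>(norm z)\<^sup>2 / 2 - inner y' z\<bar> \<le> 2 * R\<^sup>2" 
      using z2 zero_le_power2[of "norm z"] zero_le_power2[of R] unfolding abs_le_iff by (intro conjI) linarith+
    then have "(\<sigma>' - \<sigma>) * ((norm z)\<^sup>2 / 2 - inner y' z) \<le> \<bar>\<sigma>' - \<sigma>\<bar> * (2 * R\<^sup>2)"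
      using abs_ge_self[of "(\<sigma>' - \<sigma>) * ((norm z)\<^sup>2 / 2 - inner y' z)"]
        mult_left_mono[OF _ abs_ge_zero[of "\<sigma>' - \<sigma>"]] unfolding abs_mult by (meson order_trans)
    moreover have "- ((\<delta>' - \<delta>) * ((norm y')\<^sup>2 / 2)) \<le> \<bar>\<delta>' - \<delta>\<bar> * R\<^sup>2"
    proof -
      have "- ((\<delta>' - \<delta>) * ((norm y')\<^sup>2 / 2)) \<le> \<bar>\<delta>' - \<delta>\<bar> * ((norm y')\<^sup>2 / 2)"
        by (simp add: abs_if mult_right_mono flip: mult_minus_left) 
      also have "\<dots> \<le> \<bar>\<delta>' - \<delta>\<bar> * R\<^sup>2" using z2(2) zero_le_power2[of R] by (intro mult_left_mono) linarith+
      finally show ?thesis .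
    qed
    ultimately show "(\<sigma>' - \<sigma>) * ((norm z)\<^sup>2 / 2 - inner y' z) - (\<delta>' - \<delta>) * ((norm y')\<^sup>2 / 2)
        \<le> \<bar>\<sigma>' - \<sigma>\<bar> * (2 * R\<^sup>2) + \<bar>\<delta>' - \<delta>\<bar> * R\<^sup>2" by linarith
  qed
  finally show ?thesis by (simp add: algebra_simps)
qed

end

text \<open>\<open>\<beta>0_small\<close> says that \<beta> times the squared Lipschitz constant is
  at most the monotonicity modulus at \<open>k = 0\<close>. The exponents are matched so that the
  same constants work for every \<open>k\<close>.\<close>

locale sipba = bilevel_data X Y F f L
  for X :: "'a::euclidean_space set" and Y :: "'b::euclidean_space set" and F f L +
  fixes \<alpha>0 \<sigma>0 \<delta>0 \<rho>0 \<beta>0 s t :: real and \<alpha> \<sigma> \<delta> \<rho> \<beta> :: "nat \<Rightarrow> real"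
    and x :: "nat \<Rightarrow> 'a" and y z :: "nat \<Rightarrow> 'b"
  assumes pos: "\<alpha>0 > 0" "\<sigma>0 > 0" "\<delta>0 > 0" "\<rho>0 > 0" "\<beta>0 > 0" "t > 0"
    and exponents: "s > 7 * t" "s < 1"
    and \<alpha>: "\<And>k. \<alpha> k = \<alpha>0 * pw k (- s)"
    and \<sigma>: "\<And>k. \<sigma> k = \<sigma>0 * pw k (- t)"
    and \<delta>: "\<And>k. \<delta> k = \<delta>0 * pw k (- t)"
    and \<rho>: "\<And>k. \<rho> k = \<rho>0 * pw k t"
    and \<beta>: "\<And>k. \<beta> k = \<beta>0 * pw k (- 3 * t)"
    and \<beta>0_small: "\<beta>0 * (L + 2 * \<rho>0 * L + 3 * \<sigma>0 + \<delta>0)\<^sup>2 \<le> min \<sigma>0 \<delta>0"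
    and run: "SiPBA X Y F f \<alpha> \<beta> \<rho> \<sigma> \<delta> x y z"
begin

definition "\<mu>0 = min \<sigma>0 \<delta>0"
abbreviation "w k \<equiv> (y k, z k)"
abbreviation "sol k \<equiv> saddle_point Y F f (\<rho> k) (\<sigma> k) (\<delta> k)"
abbreviation "phi k \<equiv> phi_approx Y F f (\<rho> k) (\<sigma> k) (\<delta> k)"
definition "err k = norm (w k - sol k (x k))"
definition "disp k = norm (x (Suc k) - x k)"
definition "B = L + 2 * \<rho>0 * L"

lemma params_pos [simp]: "0 < \<alpha> k" "0 < \<sigma> k" "0 < \<delta> k" "0 < \<rho> k" "0 < \<beta> k" "0 < \<mu>0"
  using pos by (simp_all add: \<alpha> \<sigma> \<delta> \<rho> \<beta> \<mu>0_def)

lemma params_neq [simp]: "\<alpha> k \<noteq> 0" "\<mu>0 \<noteq> 0"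
  using params_pos(1)[of k] params_pos(6) by (metis less_irrefl)+

lemma min_params: "min (\<sigma> k) (\<delta> k) = \<mu>0 * pw k (- t)"
  by (simp add: \<sigma> \<delta> \<mu>0_def min_mult_distrib_right)

lemma B_nonneg: "0 \<le> B" using L_nonneg pos by (simp add: B_def)

lemma grad_const_le: "L + 2 * \<rho> k * L \<le> B * pw k t"
proof -
  have "L * 1 \<le> L * pw k t" using L_nonneg pos by (intro mult_left_mono pw_ge_1) auto
  then show ?thesis by (simp add: B_def \<rho> algebra_simps)
qed

lemma iterates_in: "x k \<in> X" "y k \<in> Y" "z k \<in> Y"
proof -
  have "x (Suc k) \<in> X \<and> y (Suc k) \<in> Y \<and> z (Suc k) \<in> Y" for k
    using run closest_point_in_set[OF closed_X X(1)] closest_point_in_set[OF Y(2,1)]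
    by (auto simp: SiPBA_def Let_def)
  moreover have "x 0 \<in> X \<and> y 0 \<in> Y \<and> z 0 \<in> Y" using run by (simp add: SiPBA_def)
  ultimately have "x k \<in> X \<and> y k \<in> Y \<and> z k \<in> Y" by (cases k) auto
  then show "x k \<in> X" "y k \<in> Y" "z k \<in> Y" by auto
qed

lemma w_in: "w k \<in> Y \<times> Y" using iterates_in by simp

lemma sol_in: "u \<in> X \<Longrightarrow> sol k u \<in> Y \<times> Y" by (rule saddle_point_in) auto

lemma w_step: "w (Suc k) = closest_point (Y \<times> Y) (w k - \<beta> k *\<^sub>R vi_op (\<rho> k) (\<sigma> k) (\<delta> k) (x k) (w k))"
proof -
  have 1: "y (Suc k) = closest_point Y (y k + \<beta> k *\<^sub>R (Fy (x k) (y k) - \<rho> k *\<^sub>R fy (x k) (y k) - \<sigma> k *\<^sub>R z k - \<delta> k *\<^sub>R y k))"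
    and 2: "z (Suc k) = closest_point Y (z k - \<beta> k *\<^sub>R (\<rho> k *\<^sub>R fy (x k) (z k) + \<sigma> k *\<^sub>R (z k - y k)))"
    using run by (auto simp: SiPBA_def Let_def partials)
  have "w k - \<beta> k *\<^sub>R vi_op (\<rho> k) (\<sigma> k) (\<delta> k) (x k) (w k)
    = (y k + \<beta> k *\<^sub>R (Fy (x k) (y k) - \<rho> k *\<^sub>R fy (x k) (y k) - \<sigma> k *\<^sub>R z k - \<delta> k *\<^sub>R y k),
       z k - \<beta> k *\<^sub>R (\<rho> k *\<^sub>R fy (x k) (z k) + \<sigma> k *\<^sub>R (z k - y k)))"
    by (simp add: vi_op_def algebra_simps)
  then show ?thesis
    using closest_point_Times[OF Y(3,2,1) Y(3,2,1)] 1 2 by simp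
qed

lemma x_step: "x (Suc k) = closest_point X (x k - \<alpha> k *\<^sub>R phi_grad (\<rho> k) (x k) (w (Suc k)))"
  using run by (auto simp: SiPBA_def Let_def partials phi_grad_def)

text \<open>The gain and the quadratic loss of a projected step both have exponent -4t, and
  \<open>\<beta>0_small\<close> makes the loss at most half of the gain.\<close>

lemma tracking_contraction:
  "(norm (w (Suc k) - sol k (x k)))\<^sup>2 \<le> (1 - \<beta>0 * \<mu>0 * pw k (- 4 * t)) * (err k)\<^sup>2"
proof -
  define C where "C = L + 2 * \<rho>0 * L + 3 * \<sigma>0 + \<delta>0"
  let ?T = "vi_op (\<rho> k) (\<sigma> k) (\<delta> k) (x k)" and ?S = "sol k (x k)"
  have S: "?S \<in> Y \<times> Y" using sol_in iterates_in by blast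
  have YY: "convex (Y \<times> Y)" "closed (Y \<times> Y)" using Y by (auto intro: convex_Times closed_Times)
  have fix_S: "closest_point (Y \<times> Y) (?S - \<beta> k *\<^sub>R ?T ?S) = ?S"
    using VI_iff_fixed_point[OF YY S, of "\<beta> k" ?T] saddle_point_VI[OF iterates_in(1)] by simp
  have "L + 2 * \<rho> k * L + 3 * \<sigma> k + \<delta> k \<le> C * pw k t"
  proof -
    have "\<sigma>0 * pw k (- t) \<le> \<sigma>0 * pw k t" "\<delta>0 * pw k (- t) \<le> \<delta>0 * pw k t"
      using pos by (intro mult_left_mono pw_mono; simp)+
    then show ?thesis using grad_const_le[of k] by (simp add: C_def B_def \<sigma> \<delta> algebra_simps)
  qed
  then have lip: "norm (?T (w k) - ?T ?S) \<le> (C * pw k t) * norm (w k - ?S)"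
    using vi_op_lipschitz[OF iterates_in(1) w_in S, of "\<rho> k" "\<sigma> k" "\<delta> k"]
    by (meson mult_right_mono norm_ge_zero order_trans params_pos)
  have "(norm (w (Suc k) - ?S))\<^sup>2
      \<le> (1 - 2 * \<beta> k * (\<mu>0 * pw k (- t)) + (\<beta> k)\<^sup>2 * (C * pw k t)\<^sup>2) * (norm (w k - ?S))\<^sup>2"
    using projected_step_contraction[OF YY w_in S _ lip, of "\<mu>0 * pw k (- t)" "\<beta> k"]
      vi_op_strongly_monotone[OF iterates_in(1) w_in S, of "\<rho> k" "\<sigma> k" "\<delta> k"]
    by (simp add: min_params fix_S w_step[symmetric] less_imp_le)
  also have "\<dots> \<le> (1 - \<beta>0 * \<mu>0 * pw k (- 4 * t)) * (norm (w k - ?S))\<^sup>2"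
  proof (rule mult_right_mono)
    have 1: "\<beta> k * (\<mu>0 * pw k (- t)) = \<beta>0 * \<mu>0 * pw k (- 4 * t)"
      using pw_mult[of k "- 3 * t" "- t"] by (simp add: \<beta> mult_ac)
    have "pw k (- 3 * t) * pw k (- 3 * t) * (pw k t * pw k t) = pw k (- 4 * t)"
      by (simp add: pw_mult)
    then have "(\<beta> k)\<^sup>2 * (C * pw k t)\<^sup>2 = \<beta>0 * (\<beta>0 * C\<^sup>2) * pw k (- 4 * t)"
      unfolding \<beta> power2_eq_square by (metis (no_types, lifting) mult.assoc mult.left_commute)
    also have "\<dots> \<le> \<beta>0 * \<mu>0 * pw k (- 4 * t)"
      using \<beta>0_small pos by (intro mult_right_mono mult_left_mono) (auto simp: C_def \<mu>0_def)
    finally show "1 - 2 * \<beta> k * (\<mu>0 * pw k (- t)) + (\<beta> k)\<^sup>2 * (C * pw k t)\<^sup>2 \<le> 1 - \<beta>0 * \<mu>0 * pw k (- 4 * t)"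
      using 1 by linarith
  qed simp
  finally show ?thesis by (simp add: err_def)
qed

lemma tracking_le: "norm (w (Suc k) - sol k (x k)) \<le> err k"
proof -
  have "(1 - \<beta>0 * \<mu>0 * pw k (- 4 * t)) * (err k)\<^sup>2 \<le> 1 * (err k)\<^sup>2"
    using pos by (intro mult_right_mono) (auto simp: less_imp_le)
  then have "(norm (w (Suc k) - sol k (x k)))\<^sup>2 \<le> (err k)\<^sup>2" using tracking_contraction[of k] by linarith
  then show ?thesis by (simp add: err_def)
qed

text \<open>First x moves with the parameters fixed, then the parameters change at the new x. A
  Lipschitz constant of order (k + 1)^t over a modulus of order (k + 1)^(-t) gives the exponent 2t;
  the increments of the parameters, at most of order (k + 1)^(t - 1), give 2t - 1 in the same
  way.\<close>

lemma drift: "\<exists>A>0. \<forall>k. norm (sol k (x k) - sol (Suc k) (x (Suc k))) \<le> A * (pw k (2 * t) * disp k + pw k (2 * t - 1))"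
proof -
  obtain R where R: "uniform_radius R" using uniform_radius_exists by blast
  have R0: "0 < R" using R by (simp add: uniform_radius_def)
  have "continuous_on (X \<times> Y) (\<lambda>p. snd (gradient f (at p)))"
    using lipschitz_on_continuous_on[OF f_lip] by (intro continuous_intros)
  from bounded_on_compact[OF this, of R]
  obtain M where M0: "0 < M" and M: "\<forall>x\<in>X. \<forall>y\<in>Y. norm y \<le> R \<longrightarrow> norm (fy x y) \<le> M"
    by (auto simp: fy_def)
  define A where "A = B / \<mu>0 + (2 * M * \<rho>0 + 3 * R * \<sigma>0 + R * \<delta>0) / \<mu>0"
  have N: "0 < 2 * M * \<rho>0 + 3 * R * \<sigma>0 + R * \<delta>0" using M0 R0 pos by (simp add: add_pos_pos)
  have t1: "t < 1" using exponents pos(6) by simp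
  have "norm (sol k (x k) - sol (Suc k) (x (Suc k))) \<le> A * (pw k (2 * t) * disp k + pw k (2 * t - 1))" for k
  proof -
    have "\<mu>0 * pw k (- t) * norm (sol k (x k) - sol k (x (Suc k))) \<le> (L + 2 * \<rho> k * L) * disp k"
      using saddle_lipschitz_x[OF iterates_in(1) iterates_in(1), of "\<rho> k" "\<sigma> k" "\<delta> k" k "Suc k"]
      by (simp add: min_params disp_def norm_minus_commute)
    also have "\<dots> \<le> B * pw k t * disp k" using grad_const_le by (intro mult_right_mono) (auto simp: disp_def)
    finally have "pw k t / \<mu>0 * (\<mu>0 * pw k (- t) * norm (sol k (x k) - sol k (x (Suc k)))) \<le> pw k t / \<mu>0 * (B * pw k t * disp k)"
      by (rule mult_left_mono[OF _ divide_nonneg_pos[OF pw_nonneg params_pos(6)]])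
    moreover have "pw k t / \<mu>0 * (\<mu>0 * pw k (- t) * c) = c" for c
      using pw_mult[of k t "- t"] params_pos(6) by (simp add: mult_ac)
    moreover have "pw k t / \<mu>0 * (B * pw k t * disp k) = B / \<mu>0 * (pw k (2 * t) * disp k)"
      using pw_mult[of k t t] by (simp add: mult_ac)
    ultimately have 1: "norm (sol k (x k) - sol k (x (Suc k))) \<le> B / \<mu>0 * (pw k (2 * t) * disp k)" by metis
    have rho: "\<bar>\<rho> k - \<rho> (Suc k)\<bar> \<le> \<rho>0 * pw k (t - 1)"
    proof -
      have "\<bar>\<rho> k - \<rho> (Suc k)\<bar> = \<rho>0 * \<bar>pw (Suc k) t - pw k t\<bar>"
        unfolding \<rho> right_diff_distrib[symmetric] abs_mult using pos by (simp add: abs_minus_commute)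
      also have "\<dots> \<le> \<rho>0 * (\<bar>t\<bar> * pw k (t - 1))" using pos t1 by (intro mult_left_mono pw_diff) auto
      also have "\<dots> \<le> \<rho>0 * pw k (t - 1)" using pos t1 by (intro mult_left_mono mult_left_le_one_le) auto
      finally show ?thesis .
    qed
    have dec: "\<bar>c * pw k (- t) - c * pw (Suc k) (- t)\<bar> \<le> c * pw k (t - 1)" if "0 < c" for c
    proof -
      have "\<bar>c * pw k (- t) - c * pw (Suc k) (- t)\<bar> = c * \<bar>pw (Suc k) (- t) - pw k (- t)\<bar>"
        unfolding right_diff_distrib[symmetric] abs_mult using that by (simp add: abs_minus_commute)
      also have "\<dots> \<le> c * (\<bar>- t\<bar> * pw k (- t - 1))" using pos t1 that by (intro mult_left_mono pw_diff) auto
      also have "\<dots> \<le> c * pw k (- t - 1)" using pos t1 that by (intro mult_left_mono mult_left_le_one_le) auto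
      also have "\<dots> \<le> c * pw k (t - 1)" using pos that by (intro mult_left_mono pw_mono) auto
      finally show ?thesis .
    qed
    have "\<mu>0 * pw k (- t) * norm (sol k (x (Suc k)) - sol (Suc k) (x (Suc k)))
        \<le> 2 * M * \<bar>\<rho> k - \<rho> (Suc k)\<bar> + 3 * R * \<bar>\<sigma> k - \<sigma> (Suc k)\<bar> + R * \<bar>\<delta> k - \<delta> (Suc k)\<bar>"
      using saddle_lipschitz_params[OF iterates_in(1) _ _ _ _ _ _ R M, of "\<rho> k" "\<sigma> k" "\<delta> k" "\<rho> (Suc k)" "\<sigma> (Suc k)" "\<delta> (Suc k)" "Suc k"]
      by (simp add: min_params)
    also have "\<dots> \<le> 2 * M * (\<rho>0 * pw k (t - 1)) + 3 * R * (\<sigma>0 * pw k (t - 1)) + R * (\<delta>0 * pw k (t - 1))"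
      using rho dec[OF pos(2)] dec[OF pos(3)] M0 R0 unfolding \<sigma> \<delta> by (intro add_mono mult_left_mono) auto
    finally have "pw k t / \<mu>0 * (\<mu>0 * pw k (- t) * norm (sol k (x (Suc k)) - sol (Suc k) (x (Suc k))))
        \<le> pw k t / \<mu>0 * ((2 * M * \<rho>0 + 3 * R * \<sigma>0 + R * \<delta>0) * pw k (t - 1))"
      by (intro mult_left_mono[OF _ divide_nonneg_pos[OF pw_nonneg params_pos(6)]]) (simp add: algebra_simps)
    moreover have "pw k t / \<mu>0 * (\<mu>0 * pw k (- t) * c) = c" for c
      using pw_mult[of k t "- t"] params_pos(6) by (simp add: mult_ac)
    moreover have "pw k t / \<mu>0 * (c * pw k (t - 1)) = c / \<mu>0 * pw k (2 * t - 1)" for c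
      using pw_mult[of k t "t - 1"] by (simp add: mult_ac)
    ultimately have 2: "norm (sol k (x (Suc k)) - sol (Suc k) (x (Suc k)))
        \<le> (2 * M * \<rho>0 + 3 * R * \<sigma>0 + R * \<delta>0) / \<mu>0 * pw k (2 * t - 1)" by metis
    have "norm (sol k (x k) - sol (Suc k) (x (Suc k)))
        \<le> B / \<mu>0 * (pw k (2 * t) * disp k) + (2 * M * \<rho>0 + 3 * R * \<sigma>0 + R * \<delta>0) / \<mu>0 * pw k (2 * t - 1)"
      using norm_triangle_ineq[of "sol k (x k) - sol k (x (Suc k))" "sol k (x (Suc k)) - sol (Suc k) (x (Suc k))"] 1 2 by simp
    also have "\<dots> \<le> A * (pw k (2 * t) * disp k) + A * pw k (2 * t - 1)"
      using B_nonneg N by (intro add_mono mult_right_mono) (auto simp: A_def disp_def less_imp_le)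
    finally show ?thesis by (simp add: distrib_left)
  qed
  moreover have "0 < A" unfolding A_def by (rule add_nonneg_pos[OF divide_nonneg_pos[OF B_nonneg params_pos(6)] divide_pos_pos[OF N params_pos(6)]])
  ultimately show ?thesis by blast
qed

text \<open>Half of the contraction is given up to separate the drift by Young's inequality. The
  price is a factor of order (k + 1)^(4t) on the squared drift, which raises its exponents from 4t
  and 4t - 2 to 8t and 8t - 2.\<close>

lemma err_recursion:
  "\<exists>A>0. \<forall>k. (err (Suc k))\<^sup>2 \<le> (1 - \<beta>0 * \<mu>0 / 2 * pw k (- 4 * t)) * (err k)\<^sup>2
      + A * (pw k (8 * t) * (disp k)\<^sup>2 + pw k (8 * t - 2))"
proof -
  obtain A where A0: "0 < A" and A: "\<And>k. norm (sol k (x k) - sol (Suc k) (x (Suc k))) \<le> A * (pw k (2 * t) * disp k + pw k (2 * t - 1))"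
    using drift by blast
  define b where "b = \<beta>0 * \<mu>0"
  have b0: "0 < b" using pos by (simp add: b_def)
  define A' where "A' = (1 + 2 / b) * (2 * A\<^sup>2)"
  have "(err (Suc k))\<^sup>2 \<le> (1 - b / 2 * pw k (- 4 * t)) * (err k)\<^sup>2 + A' * (pw k (8 * t) * (disp k)\<^sup>2 + pw k (8 * t - 2))" for k
  proof -
    define q where "q = b * pw k (- 4 * t)"
    have q0: "0 < q" using b0 by (simp add: q_def)
    define d where "d = A * (pw k (2 * t) * disp k + pw k (2 * t - 1))"
    have "err (Suc k) \<le> norm (w (Suc k) - sol k (x k)) + d"
      using norm_triangle_ineq[of "w (Suc k) - sol k (x k)" "sol k (x k) - sol (Suc k) (x (Suc k))"] A[of k]
      by (simp add: err_def d_def)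
    \<comment> \<open>The weight \<open>q / 2\<close> is chosen because
      \<open>(1 + q / 2) * (1 - q) \<le> 1 - q / 2\<close>.\<close>
    from norm_add_sq_le[of "q / 2", OF _ _ this]
    have "(err (Suc k))\<^sup>2 \<le> (1 + q / 2) * (norm (w (Suc k) - sol k (x k)))\<^sup>2 + (1 + 1 / (q / 2)) * d\<^sup>2"
      using q0 by (simp add: err_def)
    also have "\<dots> \<le> (1 - q / 2) * (err k)\<^sup>2 + ((1 + 2 / b) * pw k (4 * t)) * (2 * A\<^sup>2 * (pw k (4 * t) * (disp k)\<^sup>2 + pw k (4 * t - 2)))"
    proof (rule add_mono)
      have "(1 + q / 2) * (norm (w (Suc k) - sol k (x k)))\<^sup>2 \<le> (1 + q / 2) * ((1 - q) * (err k)\<^sup>2)"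
        using tracking_contraction[of k] q0 by (intro mult_left_mono) (auto simp: q_def b_def)
      also have "\<dots> = (1 - q / 2) * (err k)\<^sup>2 - q\<^sup>2 / 2 * (err k)\<^sup>2" by (simp add: field_simps power2_eq_square)
      also have "\<dots> \<le> (1 - q / 2) * (err k)\<^sup>2" by simp
      finally show "(1 + q / 2) * (norm (w (Suc k) - sol k (x k)))\<^sup>2 \<le> (1 - q / 2) * (err k)\<^sup>2" .
      have i: "1 / (q / 2) = 2 / b * pw k (4 * t)"
        using pw_inverse[of k "- 4 * t"] b0 by (simp add: q_def field_simps inverse_eq_divide)
      have "1 \<le> pw k (4 * t)" using pos by (intro pw_ge_1) auto
      then have 1: "1 + 1 / (q / 2) \<le> (1 + 2 / b) * pw k (4 * t)" by (simp only: i distrib_right)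
      have "(u + v)\<^sup>2 \<le> 2 * u\<^sup>2 + 2 * v\<^sup>2" for u v :: real
        using zero_le_power2[of "u - v"] by (simp add: power2_eq_square algebra_simps)
      from this[of "pw k (2 * t) * disp k" "pw k (2 * t - 1)"]
      have "A\<^sup>2 * (pw k (2 * t) * disp k + pw k (2 * t - 1))\<^sup>2 \<le> A\<^sup>2 * (2 * (pw k (2 * t) * disp k)\<^sup>2 + 2 * (pw k (2 * t - 1))\<^sup>2)"
        by (intro mult_left_mono) auto
      then have 2: "d\<^sup>2 \<le> 2 * A\<^sup>2 * (pw k (4 * t) * (disp k)\<^sup>2 + pw k (4 * t - 2))"
        unfolding d_def power_mult_distrib pw_power2 by (simp add: algebra_simps)
      show "(1 + 1 / (q / 2)) * d\<^sup>2 \<le> ((1 + 2 / b) * pw k (4 * t)) * (2 * A\<^sup>2 * (pw k (4 * t) * (disp k)\<^sup>2 + pw k (4 * t - 2)))"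
        using 1 2 b0 by (intro mult_mono) auto
    qed
    also have "((1 + 2 / b) * pw k (4 * t)) * (2 * A\<^sup>2 * (pw k (4 * t) * (disp k)\<^sup>2 + pw k (4 * t - 2)))
       = A' * ((pw k (4 * t) * pw k (4 * t)) * (disp k)\<^sup>2 + pw k (4 * t) * pw k (4 * t - 2))"
      by (simp add: A'_def algebra_simps)
    also have "\<dots> = A' * (pw k (8 * t) * (disp k)\<^sup>2 + pw k (8 * t - 2))" by (simp add: pw_mult)
    finally show ?thesis by (simp add: q_def)
  qed
  moreover have "0 < A'" using A0 b0 by (simp add: A'_def add_pos_pos)
  ultimately show ?thesis unfolding b_def by blast
qed

lemma direction_error:
  "norm (phi_grad (\<rho> k) (x k) (w (Suc k)) - phi_grad (\<rho> k) (x k) (sol k (x k))) \<le> B * pw k t * err k"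
proof -
  have "norm (phi_grad (\<rho> k) (x k) (w (Suc k)) - phi_grad (\<rho> k) (x k) (sol k (x k)))
      \<le> (L + 2 * \<rho> k * L) * norm (w (Suc k) - sol k (x k))"
    by (rule phi_grad_lipschitz) (auto simp: iterates_in sol_in simp del: mem_Times_iff)
  also have "\<dots> \<le> B * pw k t * err k"
    using grad_const_le tracking_le B_nonneg by (intro mult_mono) auto
  finally show ?thesis .
qed

text \<open>The projection gives a decrease of \<open>(disp k)\<^sup>2 / \<alpha> k\<close>; half of
  it pays for using the inexact direction instead of the gradient. The exponent 3t is that of the
  constant in \<open>phi_expansion\<close>: squared (k + 1)^t over (k + 1)^(-t).\<close>

lemma value_descent:
  "\<exists>K\<ge>0. \<forall>k. phi k (x (Suc k)) \<le> phi k (x k) - (disp k)\<^sup>2 * pw k s / (2 * \<alpha>0)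
      + K * pw k (3 * t) * (disp k)\<^sup>2 + \<alpha>0 * B\<^sup>2 * pw k (2 * t - s) * (err k)\<^sup>2"
proof -
  define K where "K = B + B\<^sup>2 / \<mu>0"
  have "phi k (x (Suc k)) \<le> phi k (x k) - (disp k)\<^sup>2 * pw k s / (2 * \<alpha>0)
      + K * pw k (3 * t) * (disp k)\<^sup>2 + \<alpha>0 * B\<^sup>2 * pw k (2 * t - s) * (err k)\<^sup>2" for k
  proof -
    let ?g = "phi_grad (\<rho> k) (x k) (sol k (x k))" and ?d = "phi_grad (\<rho> k) (x k) (w (Suc k))"
    let ?D = "x (Suc k) - x k"
    have c: "(L + 2 * \<rho> k * L) + (L + 2 * \<rho> k * L)\<^sup>2 / min (\<sigma> k) (\<delta> k) \<le> K * pw k (3 * t)"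
    proof -
      have g0: "0 \<le> L + 2 * \<rho> k * L" using L_nonneg mult_nonneg_nonneg[OF less_imp_le[OF params_pos(4)[of k]] L_nonneg] by simp
      have "(L + 2 * \<rho> k * L)\<^sup>2 / min (\<sigma> k) (\<delta> k) \<le> (B * pw k t)\<^sup>2 / min (\<sigma> k) (\<delta> k)"
        using grad_const_le g0 by (intro divide_right_mono power_mono) (auto simp: less_imp_le)
      also have "\<dots> = B\<^sup>2 / \<mu>0 * (pw k (2 * t) * pw k t)"
        unfolding min_params divide_pw_minus by (simp add: power_mult_distrib pw_power2)
      also have "\<dots> = B\<^sup>2 / \<mu>0 * pw k (3 * t)" by (simp add: pw_mult)
      finally have "(L + 2 * \<rho> k * L)\<^sup>2 / min (\<sigma> k) (\<delta> k) \<le> B\<^sup>2 / \<mu>0 * pw k (3 * t)" .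
      moreover have "B * pw k t \<le> B * pw k (3 * t)" using B_nonneg pos by (intro mult_left_mono pw_mono) auto
      ultimately show ?thesis using grad_const_le[of k] by (simp add: K_def distrib_right)
    qed
    have "phi k (x (Suc k)) - phi k (x k) - inner ?D ?g
        \<le> ((L + 2 * \<rho> k * L) + (L + 2 * \<rho> k * L)\<^sup>2 / min (\<sigma> k) (\<delta> k)) * (disp k)\<^sup>2"
      using phi_expansion[OF iterates_in(1) iterates_in(1), of "\<rho> k" "\<sigma> k" "\<delta> k" "Suc k" k] by (simp add: disp_def)
    also have "\<dots> \<le> K * pw k (3 * t) * (disp k)\<^sup>2" using c by (rule mult_right_mono) simp
    finally have 1: "phi k (x (Suc k)) \<le> phi k (x k) + inner ?D ?g + K * pw k (3 * t) * (disp k)\<^sup>2" by simp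
    have "inner (x k - \<alpha> k *\<^sub>R ?d - x (Suc k)) (x k - x (Suc k)) \<le> 0"
      unfolding x_step using closest_point_dot[OF X(3) closed_X iterates_in(1)] .
    then have "(disp k)\<^sup>2 + \<alpha> k * inner ?D ?d \<le> 0"
      by (simp add: disp_def power2_norm_eq_inner inner_diff_left inner_diff_right inner_commute algebra_simps)
    then have 2: "inner ?D ?d \<le> - (disp k)\<^sup>2 / \<alpha> k"
      using params_pos(1)[of k] by (simp add: field_simps)
    have "inner ?D (?g - ?d) \<le> disp k * norm (?g - ?d)"
      unfolding disp_def by (rule norm_cauchy_schwarz)
    also have "\<dots> \<le> disp k * (B * pw k t * err k)"
      using direction_error[of k] by (intro mult_left_mono) (auto simp: norm_minus_commute disp_def)
    also have "\<dots> \<le> (disp k)\<^sup>2 / (2 * \<alpha> k) + \<alpha> k * (B * pw k t * err k)\<^sup>2"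
    proof -
      define u v where "u = disp k" and "v = B * pw k t * err k"
      have "0 \<le> ((u - \<alpha> k * v)\<^sup>2 + (\<alpha> k * v)\<^sup>2) / (2 * \<alpha> k)"
        using params_pos(1)[of k] by (intro divide_nonneg_pos) auto
      also have "\<dots> = u\<^sup>2 / (2 * \<alpha> k) + \<alpha> k * v\<^sup>2 - u * v"
        using params_pos(1)[of k] by (simp add: field_simps power2_eq_square)
      finally show ?thesis by (simp add: u_def v_def)
    qed
    also have "\<alpha> k * (B * pw k t * err k)\<^sup>2 = \<alpha>0 * B\<^sup>2 * (pw k (- s) * pw k (2 * t)) * (err k)\<^sup>2"
      by (simp add: \<alpha> power_mult_distrib pw_power2)
    also have "\<dots> = \<alpha>0 * B\<^sup>2 * pw k (2 * t - s) * (err k)\<^sup>2" by (simp add: pw_mult)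
    finally have 3: "inner ?D ?g \<le> inner ?D ?d + (disp k)\<^sup>2 / (2 * \<alpha> k) + \<alpha>0 * B\<^sup>2 * pw k (2 * t - s) * (err k)\<^sup>2"
      by (simp add: inner_diff_right)
    have "(disp k)\<^sup>2 / \<alpha> k = 2 * ((disp k)\<^sup>2 / (2 * \<alpha> k))" by simp
    moreover have "(disp k)\<^sup>2 / (2 * \<alpha> k) = (disp k)\<^sup>2 * pw k s / (2 * \<alpha>0)"
      unfolding \<alpha> mult.assoc[symmetric] divide_pw_minus ..
    ultimately show ?thesis using 1 2 3 by simp
  qed
  moreover have "0 \<le> K" using B_nonneg by (simp add: K_def less_imp_le)
  ultimately show ?thesis by blast
qed

text \<open>The increment of \<rho> has exponent t - 1 and the gain per unit of \<rho> has exponent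
  -2t, so the product has exponent -t - 1, which is summable. The increments of \<sigma> and
  \<delta> have this exponent by themselves.\<close>

lemma value_drift: "\<exists>C\<ge>0. \<forall>k. \<forall>u\<in>X. phi (Suc k) u - phi k u \<le> C * pw k (- t - 1)"
proof -
  obtain R where R: "uniform_radius R" using uniform_radius_exists by blast
  have t1: "t < 1" using exponents pos(6) by simp
  have "phi (Suc k) u - phi k u \<le> (4 * R\<^sup>2 * \<sigma>0 + R\<^sup>2 * \<delta>0) * pw k (- t - 1)" if u: "u \<in> X" for k u
  proof -
    have le: "\<rho> k \<le> \<rho> (Suc k)" using pos by (simp add: \<rho> pw_Suc_mono)
    have inc: "\<bar>c * pw (Suc k) a - c * pw k a\<bar> \<le> c * pw k (a - 1)" if "0 < c" "\<bar>a\<bar> \<le> 1" for c a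
    proof -
      have "\<bar>c * pw (Suc k) a - c * pw k a\<bar> = c * \<bar>pw (Suc k) a - pw k a\<bar>"
        unfolding right_diff_distrib[symmetric] abs_mult using that(1) by simp
      also have "\<dots> \<le> c * (\<bar>a\<bar> * pw k (a - 1))" using that by (intro mult_left_mono pw_diff) auto
      also have "\<dots> \<le> c * pw k (a - 1)" using that by (intro mult_left_mono mult_left_le_one_le) auto
      finally show ?thesis .
    qed
    have q: "2 * R\<^sup>2 * \<sigma> k / \<rho> k = 2 * R\<^sup>2 * \<sigma>0 / \<rho>0 * pw k (- 2 * t)"
    proof -
      have "pw k (- t) / pw k t = pw k (- 2 * t)"
        using pw_inverse[of k t] pw_mult[of k "- t" "- t"] by (simp add: divide_inverse)
      moreover have "2 * R\<^sup>2 * \<sigma> k / \<rho> k = 2 * R\<^sup>2 * \<sigma>0 / \<rho>0 * (pw k (- t) / pw k t)"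
        by (simp add: \<sigma> \<rho>)
      ultimately show ?thesis by simp
    qed
    have "(\<rho> (Suc k) - \<rho> k) * (2 * R\<^sup>2 * \<sigma> k / \<rho> k) \<le> \<rho>0 * pw k (t - 1) * (2 * R\<^sup>2 * \<sigma>0 / \<rho>0 * pw k (- 2 * t))"
      unfolding q using inc[of \<rho>0 t] pos t1 by (intro mult_right_mono) (auto simp: \<rho>)
    also have "\<dots> = 2 * R\<^sup>2 * \<sigma>0 * (pw k (t - 1) * pw k (- 2 * t))" using pos by simp
    also have "\<dots> = 2 * R\<^sup>2 * \<sigma>0 * pw k (- t - 1)" unfolding pw_mult by simp
    finally have 1: "(\<rho> (Suc k) - \<rho> k) * (2 * R\<^sup>2 * \<sigma> k / \<rho> k) \<le> 2 * R\<^sup>2 * \<sigma>0 * pw k (- t - 1)" .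
    have 2: "2 * R\<^sup>2 * \<bar>\<sigma> (Suc k) - \<sigma> k\<bar> \<le> 2 * R\<^sup>2 * (\<sigma>0 * pw k (- t - 1))"
      "R\<^sup>2 * \<bar>\<delta> (Suc k) - \<delta> k\<bar> \<le> R\<^sup>2 * (\<delta>0 * pw k (- t - 1))"
      using inc[of \<sigma>0 "- t"] inc[of \<delta>0 "- t"] pos t1 by (intro mult_left_mono; auto simp: \<sigma> \<delta>)+
    show ?thesis
      using phi_params[OF u _ _ _ _ _ _ R le, of "\<sigma> k" "\<delta> k" "\<sigma> (Suc k)" "\<delta> (Suc k)"] 1 2
      by (simp add: algebra_simps)
  qed
  moreover have "0 \<le> 4 * R\<^sup>2 * \<sigma>0 + R\<^sup>2 * \<delta>0" using pos by simp
  ultimately show ?thesis by blast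
qed

text \<open>
  The weight \<open>(k + 1)\<^sup>-\<^sup>t\<close> of the tracking error is the midpoint of the range of exponents
  for which both error terms are absorbed; that range is nonempty exactly if \<open>s > 7 t\<close>.
\<close>
lemma merit_summable: "summable (\<lambda>k. pw k s * (disp k)\<^sup>2 + pw k (- 5 * t) * (err k)\<^sup>2)"
proof -
  obtain A where A0: "0 < A" and A: "\<And>k. (err (Suc k))\<^sup>2 \<le> (1 - \<beta>0 * \<mu>0 / 2 * pw k (- 4 * t)) * (err k)\<^sup>2
      + A * (pw k (8 * t) * (disp k)\<^sup>2 + pw k (8 * t - 2))" using err_recursion by blast
  obtain K where K0: "0 \<le> K" and K: "\<And>k. phi k (x (Suc k)) \<le> phi k (x k) - (disp k)\<^sup>2 * pw k s / (2 * \<alpha>0)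
      + K * pw k (3 * t) * (disp k)\<^sup>2 + \<alpha>0 * B\<^sup>2 * pw k (2 * t - s) * (err k)\<^sup>2" using value_descent by blast
  obtain C where C0: "0 \<le> C" and C: "\<And>k u. u \<in> X \<Longrightarrow> phi (Suc k) u - phi k u \<le> C * pw k (- t - 1)"
    using value_drift by blast
  obtain R where R: "uniform_radius R" using uniform_radius_exists by blast
  obtain M where M: "\<forall>x\<in>X. \<forall>y\<in>Y. norm y \<le> R \<longrightarrow> norm (F (x, y)) \<le> M"
    using bounded_on_compact[OF continuous_F] by metis
  define V where "V k = phi k (x k) + pw k (- t) * (err k)\<^sup>2" for k
  \<comment> \<open>For large \<open>k\<close> half of each decrement absorbs the error terms;
    \<open>c\<close> is a common lower bound for the halves that remain.\<close>
  define c where "c = min (1 / (4 * \<alpha>0)) (\<beta>0 * \<mu>0 / 4)"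
  have c0: "0 < c" using pos by (simp add: c_def)
  let ?q = "\<lambda>k. pw k s * (disp k)\<^sup>2 + pw k (- 5 * t) * (err k)\<^sup>2"
  have e1: "\<forall>\<^sub>F k in sequentially. (K + A) * pw k (7 * t) \<le> 1 / (4 * \<alpha>0) * pw k s"
    using exponents pos by (intro pw_eventually_le) auto
  have e2: "\<forall>\<^sub>F k in sequentially. \<alpha>0 * B\<^sup>2 * pw k (2 * t - s) \<le> \<beta>0 * \<mu>0 / 4 * pw k (- 5 * t)"
    using exponents pos by (intro pw_eventually_le) auto
  have "\<forall>\<^sub>F k in sequentially. V (Suc k) \<le> V k - c * ?q k + (A * pw k (7 * t - 2) + C * pw k (- t - 1))"
    using e1 e2
  proof eventually_elim
    case (elim k)
    have d1: "(K + A) * pw k (7 * t) * (disp k)\<^sup>2 \<le> 1 / (4 * \<alpha>0) * pw k s * (disp k)\<^sup>2"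
      using elim(1) by (rule mult_right_mono) simp
    have d2: "\<alpha>0 * B\<^sup>2 * pw k (2 * t - s) * (err k)\<^sup>2 \<le> \<beta>0 * \<mu>0 / 4 * pw k (- 5 * t) * (err k)\<^sup>2"
      using elim(2) by (rule mult_right_mono) simp
    have "pw (Suc k) (- t) * (err (Suc k))\<^sup>2 \<le> pw k (- t) * (err (Suc k))\<^sup>2"
      using pos by (intro mult_right_mono pw_Suc_antimono) auto
    also have "\<dots> \<le> pw k (- t) * ((1 - \<beta>0 * \<mu>0 / 2 * pw k (- 4 * t)) * (err k)\<^sup>2 + A * (pw k (8 * t) * (disp k)\<^sup>2 + pw k (8 * t - 2)))"
      using A by (intro mult_left_mono) auto
    also have "\<dots> = pw k (- t) * (err k)\<^sup>2 - \<beta>0 * \<mu>0 / 2 * (pw k (- t) * pw k (- 4 * t)) * (err k)\<^sup>2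
        + A * (pw k (- t) * pw k (8 * t)) * (disp k)\<^sup>2 + A * (pw k (- t) * pw k (8 * t - 2))"
      by (simp add: algebra_simps)
    also have "\<dots> = pw k (- t) * (err k)\<^sup>2 - \<beta>0 * \<mu>0 / 2 * pw k (- 5 * t) * (err k)\<^sup>2
        + A * pw k (7 * t) * (disp k)\<^sup>2 + A * pw k (7 * t - 2)"
      unfolding pw_mult by simp
    finally have m1: "pw (Suc k) (- t) * (err (Suc k))\<^sup>2 \<le> pw k (- t) * (err k)\<^sup>2 - \<beta>0 * \<mu>0 / 2 * pw k (- 5 * t) * (err k)\<^sup>2
        + A * pw k (7 * t) * (disp k)\<^sup>2 + A * pw k (7 * t - 2)" .
    have m2: "K * pw k (3 * t) * (disp k)\<^sup>2 \<le> K * pw k (7 * t) * (disp k)\<^sup>2"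
      using K0 pos by (intro mult_right_mono mult_left_mono pw_mono) auto
    have m3: "c * (pw k s * (disp k)\<^sup>2) \<le> 1 / (4 * \<alpha>0) * (pw k s * (disp k)\<^sup>2)"
      "c * (pw k (- 5 * t) * (err k)\<^sup>2) \<le> \<beta>0 * \<mu>0 / 4 * (pw k (- 5 * t) * (err k)\<^sup>2)"
      by (intro mult_right_mono; simp add: c_def)+
    have h: "(disp k)\<^sup>2 * pw k s / (2 * \<alpha>0) = 2 * (1 / (4 * \<alpha>0) * (pw k s * (disp k)\<^sup>2))" by simp
    have h2: "\<beta>0 * \<mu>0 / 2 * pw k (- 5 * t) * (err k)\<^sup>2 = 2 * (\<beta>0 * \<mu>0 / 4 * (pw k (- 5 * t) * (err k)\<^sup>2))" by simp
    show ?case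
      using m1 m2 m3 d1 d2 K[of k] C[OF iterates_in(1)[of "Suc k"], of k] unfolding h h2 V_def
      by (simp only: distrib_left distrib_right mult.assoc)
  qed
  then have "summable (\<lambda>k. c * ?q k)"
  proof (rule summable_of_descent)
    show "- M - (\<sigma>0 + \<delta>0) / 2 * R\<^sup>2 \<le> V k" for k
    proof -
      have "\<sigma> k \<le> \<sigma>0 * 1" "\<delta> k \<le> \<delta>0 * 1"
        unfolding \<sigma> \<delta> using pos by (intro mult_left_mono pw_le_1; simp)+
      then have "(\<sigma> k + \<delta> k) / 2 * R\<^sup>2 \<le> (\<sigma>0 + \<delta>0) / 2 * R\<^sup>2" by (intro mult_right_mono) auto
      moreover have "0 \<le> pw k (- t) * (err k)\<^sup>2" by simp
      moreover have "- M - (\<sigma> k + \<delta> k) / 2 * R\<^sup>2 \<le> phi k (x k)"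
        by (rule phi_lower_bound[OF iterates_in(1) _ _ _ R M]) simp_all
      ultimately show ?thesis unfolding V_def by linarith
    qed
    show "summable (\<lambda>k. A * pw k (7 * t - 2) + C * pw k (- t - 1))"
      using exponents pos by (intro summable_add summable_mult pw_summable) auto
  qed (use c0 A0 C0 in \<open>auto intro!: mult_nonneg_nonneg add_nonneg_nonneg\<close>)
  then show ?thesis using c0 by (simp add: summable_cmult_iff)
qed

text \<open>The factor k + 1 won along the subsequence covers what is lost by rescaling. Dividing
  \<open>disp\<close> by \<alpha> squares to exponent 2s, and 2s <= 1 + s; multiplying
  \<open>err\<close> by (k + 1)^t squares to exponent 2t, and 2t <= 1 - 5t because 7t < s <
  1.\<close>

theorem stationary_subseq_exists: "\<exists>r. stationary_subseq X Y F f \<alpha> \<rho> \<sigma> \<delta> x y z r"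
proof -
  define m where "m k = pw k 1 * (pw k s * (disp k)\<^sup>2 + pw k (- 5 * t) * (err k)\<^sup>2)" for k
  obtain r where r: "strict_mono r"
    and lim: "(\<lambda>j. m (r j)) \<longlonglongrightarrow> 0"
    using summable_subseq_small[OF merit_summable] by (auto simp: m_def)
  have sq: "(\<lambda>j. u j) \<longlonglongrightarrow> (0::real)" if "\<And>j. (u j)\<^sup>2 \<le> c * m (r j)" for u c
  proof -
    have "(\<lambda>j. (u j)\<^sup>2) \<longlonglongrightarrow> 0"
      by (rule tendsto_sandwich[OF _ _ tendsto_const]) (use that tendsto_mult_right_zero[OF lim, of c] in auto)
    then show ?thesis by simp
  qed
  have e: "(err k)\<^sup>2 * pw k (2 * t) \<le> m k" for k
  proof -
    have "(err k)\<^sup>2 * pw k (2 * t) \<le> (err k)\<^sup>2 * pw k (1 - 5 * t)"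
      using exponents pos by (intro mult_left_mono pw_mono) auto
    also have "\<dots> = (err k)\<^sup>2 * (pw k 1 * pw k (- 5 * t))" by (simp add: pw_mult)
    also have "\<dots> \<le> m k"
      by (simp add: m_def algebra_simps)
    finally show ?thesis .
  qed
  have err0: "(\<lambda>j. err (r j)) \<longlonglongrightarrow> 0"
  proof (rule sq[of _ 1])
    fix j
    have "(err (r j))\<^sup>2 * 1 \<le> (err (r j))\<^sup>2 * pw (r j) (2 * t)"
      using pos by (intro mult_left_mono pw_ge_1) auto
    then show "(err (r j))\<^sup>2 \<le> 1 * m (r j)"
      using e[of "r j"] by linarith
  qed
  have err1: "(\<lambda>j. B * pw (r j) t * err (r j)) \<longlonglongrightarrow> 0"
  proof (rule sq[of _ "B\<^sup>2"])
    fix j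
    have "(B * pw (r j) t * err (r j))\<^sup>2 = B\<^sup>2 * ((err (r j))\<^sup>2 * pw (r j) (2 * t))"
      by (simp add: power_mult_distrib pw_power2)
    then show "(B * pw (r j) t * err (r j))\<^sup>2 \<le> B\<^sup>2 * m (r j)"
      using e[of "r j"] by (simp add: mult_left_mono)
  qed
  have disp0: "(\<lambda>j. disp (r j) / \<alpha> (r j)) \<longlonglongrightarrow> 0"
  proof (rule sq[of _ "1 / \<alpha>0\<^sup>2"])
    fix j
    have a: "disp (r j) / \<alpha> (r j) = disp (r j) * pw (r j) s / \<alpha>0"
      by (simp add: \<alpha> divide_pw_minus)
    have "(disp (r j))\<^sup>2 * pw (r j) (2 * s) \<le> (disp (r j))\<^sup>2 * pw (r j) (1 + s)"
      using exponents by (intro mult_left_mono pw_mono) auto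
    also have "\<dots> = (disp (r j))\<^sup>2 * (pw (r j) 1 * pw (r j) s)" by (simp add: pw_mult)
    also have "\<dots> \<le> m (r j)"
      by (simp add: m_def algebra_simps)
    finally show "(disp (r j) / \<alpha> (r j))\<^sup>2 \<le> 1 / \<alpha>0\<^sup>2 * m (r j)"
      unfolding a by (simp add: power_mult_distrib power_divide pw_power2 divide_right_mono)
  qed
  have G: "norm (proj_grad_map X Y F f (\<alpha> k) (\<rho> k) (\<sigma> k) (\<delta> k) (x k)) \<le> disp k / \<alpha> k + B * pw k t * err k" for k
  proof -
    let ?g = "phi_grad (\<rho> k) (x k) (sol k (x k))" and ?d = "phi_grad (\<rho> k) (x k) (w (Suc k))"
    let ?P = "closest_point X"
    have "norm (?P (x k - \<alpha> k *\<^sub>R ?d) - ?P (x k - \<alpha> k *\<^sub>R ?g)) \<le> norm (\<alpha> k *\<^sub>R (?g - ?d))"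
      using closest_point_lipschitz[OF X(3) closed_X X(1), of "x k - \<alpha> k *\<^sub>R ?d" "x k - \<alpha> k *\<^sub>R ?g"]
      by (simp add: dist_norm algebra_simps)
    also have "\<dots> \<le> \<alpha> k * (B * pw k t * err k)"
      using direction_error[of k] by (simp add: norm_minus_commute abs_of_pos)
    finally have "norm (x k - ?P (x k - \<alpha> k *\<^sub>R ?g)) \<le> disp k + \<alpha> k * (B * pw k t * err k)"
      using norm_triangle_ineq[of "x k - x (Suc k)" "x (Suc k) - ?P (x k - \<alpha> k *\<^sub>R ?g)"]
      by (simp add: x_step[symmetric] disp_def norm_minus_commute)
    then show ?thesis
      using params_pos(1)[of k]
      by (simp add: proj_grad_map_eq[OF iterates_in(1)] abs_of_pos pos_divide_le_eq distrib_left mult.commute)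
  qed
  have "(\<lambda>j. proj_grad_map X Y F f (\<alpha> (r j)) (\<rho> (r j)) (\<sigma> (r j)) (\<delta> (r j)) (x (r j))) \<longlonglongrightarrow> 0"
    by (rule Lim_null_comparison[OF always_eventually tendsto_add_zero[OF disp0 err1]]) (use G in blast)
  moreover have "(\<lambda>j. w (r j) - sol (r j) (x (r j))) \<longlonglongrightarrow> 0"
    using err0 unfolding err_def by (rule tendsto_norm_zero_cancel)
  ultimately show ?thesis using r unfolding stationary_subseq_def by blast
qed

end

section \<open>Strict and second derivatives\<close>

text \<open>Continuous differentiability makes the map strictly differentiable at \<open>p\<close>,
  so both ends of the difference may move. This is needed because \<rho> multiplies differences
  between two moving points.\<close>

lemma C1_difference_quotient_tendsto:
  fixes h :: "'a::real_normed_vector \<Rightarrow> 'b::real_normed_vector" and h' :: "'a \<Rightarrow> 'a \<Rightarrow>\<^sub>L 'b"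
  assumes W: "open W" "p \<in> W" and der: "\<And>u. u \<in> W \<Longrightarrow> (h has_derivative blinfun_apply (h' u)) (at u)"
    and cont: "continuous_on W h'" and a: "a \<longlonglongrightarrow> p" and b: "b \<longlonglongrightarrow> p"
    and d: "(\<lambda>k. \<rho> k *\<^sub>R (a k - b k)) \<longlonglongrightarrow> d"
  shows "(\<lambda>k. \<rho> k *\<^sub>R (h (a k) - h (b k))) \<longlonglongrightarrow> h' p d"
proof -
  define u where "u k = \<rho> k *\<^sub>R (a k - b k)" for k
  define v where "v k = \<rho> k *\<^sub>R (h (a k) - h (b k)) - h' p (u k)" for k
  have "v \<longlonglongrightarrow> 0"
  proof (rule tendstoI)
    fix e :: real assume e: "0 < e"
    \<comment> \<open>Eventually \<open>norm (u k) \<le> norm d + 1\<close>; the further unit makes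
      the final inequality strict.\<close>
    define \<epsilon> where "\<epsilon> = e / (norm d + 2)"
    have \<epsilon>: "0 < \<epsilon>" using e by (simp add: \<epsilon>_def add_nonneg_pos)
    have "isCont h' p" using cont W by (simp add: continuous_on_eq_continuous_at)
    then obtain r1 where r1: "0 < r1" "\<And>u. dist u p < r1 \<Longrightarrow> dist (h' u) (h' p) < \<epsilon>"
      unfolding continuous_at_eps_delta using \<epsilon> by blast
    obtain r2 where r2: "0 < r2" "ball p r2 \<subseteq> W" using W by (meson openE)
    define r where "r = min r1 r2"
    have r: "0 < r" using r1 r2 by (simp add: r_def)
    have lin: "norm (h x - h y - h' p (x - y)) \<le> norm (x - y) * \<epsilon>" if "x \<in> ball p r" "y \<in> ball p r" for x y
    proof (rule differentiable_bound_linearization[where S = "ball p r" and f' = "\<lambda>u. blinfun_apply (h' u)"])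
      fix t :: real assume "t \<in> {0..1}"
      moreover have "y + t *\<^sub>R (x - y) = (1 - t) *\<^sub>R y + t *\<^sub>R x" by (simp add: algebra_simps)
      ultimately show "y + t *\<^sub>R (x - y) \<in> ball p r"
        using convexD_alt[OF convex_ball that(2,1)] by simp
    next
      fix u assume u: "u \<in> ball p r"
      then have "u \<in> W" using r2 by (auto simp: r_def)
      then show "(h has_derivative blinfun_apply (h' u)) (at u within ball p r)"
        using der has_derivative_at_withinI by blast
      have "norm (h' u - h' p) \<le> \<epsilon>" using r1(2)[of u] u by (simp add: r_def dist_commute flip: dist_norm)
      then show "onorm (blinfun_apply (h' u) - blinfun_apply (h' p)) \<le> \<epsilon>"
        by (simp add: norm_blinfun.rep_eq minus_blinfun.rep_eq fun_diff_def)
    qed (use r in simp)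
    have ev: "\<forall>\<^sub>F k in sequentially. dist (a k) p < r" "\<forall>\<^sub>F k in sequentially. dist (b k) p < r"
      using a b r by (auto dest: tendstoD)
    have "\<forall>\<^sub>F k in sequentially. dist (u k) d < 1" using tendstoD[OF d, of 1] by (simp add: u_def)
    with ev show "\<forall>\<^sub>F k in sequentially. dist (v k) 0 < e"
    proof eventually_elim
      case (elim k)
      have "v k = \<rho> k *\<^sub>R (h (a k) - h (b k) - h' p (a k - b k))"
        by (simp only: v_def u_def blinfun.scaleR_right scaleR_diff_right[symmetric])
      then have "norm (v k) \<le> \<bar>\<rho> k\<bar> * (norm (a k - b k) * \<epsilon>)"
        using lin[of "a k" "b k"] elim by (simp add: dist_commute mult_left_mono)
      also have "\<dots> = norm (u k) * \<epsilon>" by (simp add: u_def)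
      also have "\<dots> \<le> (norm d + 1) * \<epsilon>"
        using elim(3) norm_triangle_ineq2[of "u k" d] \<epsilon> by (intro mult_right_mono) (auto simp: dist_norm)
      also have "\<dots> < e" using e by (simp add: \<epsilon>_def field_simps add_nonneg_pos)
      finally show ?case by simp
    qed
  qed
  moreover have "(\<lambda>k. h' p (u k)) \<longlonglongrightarrow> h' p d" using d unfolding u_def by (intro tendsto_intros)
  ultimately have "(\<lambda>k. v k + h' p (u k)) \<longlonglongrightarrow> 0 + h' p d" by (rule tendsto_add)
  then show ?thesis by (simp add: v_def)
qed

text \<open>The second difference is symmetric in \<open>h\<close> and \<open>k\<close>, so its
  limit proves the symmetry of the second derivative. Pairing with \<open>c\<close> makes the
  function real-valued, as the mean value theorem requires; the intermediate first derivatives are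
  then linearised at \<open>p\<close>.\<close>

lemma second_difference_tendsto:
  fixes f :: "'a::real_normed_vector \<Rightarrow> 'b::real_inner" and f' :: "'a \<Rightarrow> 'a \<Rightarrow>\<^sub>L 'b"
  assumes W: "open W" "p \<in> W" and der: "\<And>u. u \<in> W \<Longrightarrow> (f has_derivative blinfun_apply (f' u)) (at u)"
    and der2: "(f' has_derivative f'') (at p)"
  shows "((\<lambda>t. inner c (f (p + t *\<^sub>R h + t *\<^sub>R k) - f (p + t *\<^sub>R h) - f (p + t *\<^sub>R k) + f p) / t\<^sup>2)
      \<longlongrightarrow> inner c (f'' k h)) (at_right 0)"
proof (rule tendstoI)
  define \<Delta> where "\<Delta> t = f (p + t *\<^sub>R h + t *\<^sub>R k) - f (p + t *\<^sub>R h) - f (p + t *\<^sub>R k) + f p" for t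
  fix e :: real assume e: "0 < e"
  define N where "N = norm h + norm k + 1"
  have N: "0 < N" "norm h \<le> N" "norm k \<le> N" "norm h + norm k \<le> N" by (auto simp: N_def add_nonneg_pos)
  \<comment> \<open>The two linearisation remainders contribute at most
    \<open>2 * N * N * norm c * \<epsilon>\<close>; the added units make the bound strict and the
    denominator positive.\<close>
  define \<epsilon> where "\<epsilon> = e / (2 * N * N * (norm c + 1) + 1)"
  have \<epsilon>: "0 < \<epsilon>" using e N by (simp add: \<epsilon>_def add_nonneg_pos)
  obtain d1 where d1: "0 < d1" "\<And>u. norm (u - p) < d1 \<Longrightarrow> norm (f' u - f' p - f'' (u - p)) \<le> \<epsilon> * norm (u - p)"
    using der2 \<epsilon> unfolding has_derivative_at_alt by blast
  obtain d2 where d2: "0 < d2" "ball p d2 \<subseteq> W" using W by (meson openE)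
  define T where "T = min d1 d2 / N"
  have T: "0 < T" using d1 d2 N by (simp add: T_def)
  have lin: "linear f''" using der2 has_derivative_linear by blast
  have main: "dist (inner c (\<Delta> t) / t\<^sup>2) (inner c (f'' k h)) < e"
    if t: "0 < t" "t < T" for t
  proof -
    have small: "norm (\<xi> *\<^sub>R h + \<eta> *\<^sub>R k) \<le> t * N" "t * N < d1" "t * N < d2"
      if "0 \<le> \<xi>" "\<xi> \<le> t" "0 \<le> \<eta>" "\<eta> \<le> t" for \<xi> \<eta>
    proof -
      have "norm (\<xi> *\<^sub>R h + \<eta> *\<^sub>R k) \<le> \<xi> * norm h + \<eta> * norm k"
        using norm_triangle_ineq[of "\<xi> *\<^sub>R h" "\<eta> *\<^sub>R k"] that by simp
      also have "\<dots> \<le> t * norm h + t * norm k" using that by (intro add_mono mult_right_mono) auto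
      also have "\<dots> \<le> t * N" using N t by (simp add: distrib_left[symmetric])
      finally show "norm (\<xi> *\<^sub>R h + \<eta> *\<^sub>R k) \<le> t * N" .
      show "t * N < d1" "t * N < d2" using t N by (simp_all add: T_def field_simps)
    qed
    have inW: "p + \<xi> *\<^sub>R h + \<eta> *\<^sub>R k \<in> W" if "0 \<le> \<xi>" "\<xi> \<le> t" "0 \<le> \<eta>" "\<eta> \<le> t" for \<xi> \<eta>
    proof -
      have "dist p (p + \<xi> *\<^sub>R h + \<eta> *\<^sub>R k) = norm (\<xi> *\<^sub>R h + \<eta> *\<^sub>R k)"
        by (metis add.assoc add_diff_cancel_left' dist_commute dist_norm)
      then show ?thesis using small[OF that] d2(2) by auto
    qed
    have rem: "norm (f' (p + \<xi> *\<^sub>R h + \<eta> *\<^sub>R k) - f' p - f'' (\<xi> *\<^sub>R h + \<eta> *\<^sub>R k)) \<le> \<epsilon> * (t * N)"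
      if "0 \<le> \<xi>" "\<xi> \<le> t" "0 \<le> \<eta>" "\<eta> \<le> t" for \<xi> \<eta>
    proof -
      have "norm (f' (p + \<xi> *\<^sub>R h + \<eta> *\<^sub>R k) - f' p - f'' (\<xi> *\<^sub>R h + \<eta> *\<^sub>R k)) \<le> \<epsilon> * norm (\<xi> *\<^sub>R h + \<eta> *\<^sub>R k)"
        using d1(2)[of "p + \<xi> *\<^sub>R h + \<eta> *\<^sub>R k"] small[OF that] by (simp add: add.assoc)
      also have "\<dots> \<le> \<epsilon> * (t * N)" using small(1)[OF that] \<epsilon> by (intro mult_left_mono) auto
      finally show ?thesis .
    qed
    define \<psi> where "\<psi> u = inner c (f (p + u *\<^sub>R h + t *\<^sub>R k) - f (p + u *\<^sub>R h))" for u
    define \<psi>' where "\<psi>' u = inner c (f' (p + u *\<^sub>R h + t *\<^sub>R k) h - f' (p + u *\<^sub>R h) h)" for u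
    have "\<exists>\<xi>>0. \<xi> < t \<and> \<psi> t - \<psi> 0 = (t - 0) * \<psi>' \<xi>"
    proof (rule MVT2[OF t(1)])
      fix u assume u: "0 \<le> u" "u \<le> t"
      have "(f has_derivative blinfun_apply (f' (p + u *\<^sub>R h + t *\<^sub>R k))) (at (p + u *\<^sub>R h + t *\<^sub>R k))"
        using der inW[of u t] u t by simp
      moreover have "((\<lambda>u. p + u *\<^sub>R h + t *\<^sub>R k) has_derivative (\<lambda>s. s *\<^sub>R h)) (at u)"
        by (auto intro!: derivative_eq_intros)
      ultimately have 1: "((\<lambda>u. f (p + u *\<^sub>R h + t *\<^sub>R k)) has_derivative (\<lambda>s. f' (p + u *\<^sub>R h + t *\<^sub>R k) (s *\<^sub>R h))) (at u)"
        by (rule has_derivative_compose[rotated])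
      have "(f has_derivative blinfun_apply (f' (p + u *\<^sub>R h))) (at (p + u *\<^sub>R h))"
        using der inW[of u 0] u t by simp
      moreover have "((\<lambda>u. p + u *\<^sub>R h) has_derivative (\<lambda>s. s *\<^sub>R h)) (at u)"
        by (auto intro!: derivative_eq_intros)
      ultimately have 2: "((\<lambda>u. f (p + u *\<^sub>R h)) has_derivative (\<lambda>s. f' (p + u *\<^sub>R h) (s *\<^sub>R h))) (at u)"
        by (rule has_derivative_compose[rotated])
      have "(\<psi> has_derivative (\<lambda>s. inner c (f' (p + u *\<^sub>R h + t *\<^sub>R k) (s *\<^sub>R h) - f' (p + u *\<^sub>R h) (s *\<^sub>R h)))) (at u)"
        unfolding \<psi>_def by (auto intro!: derivative_eq_intros 1 2)
      then show "(\<psi> has_real_derivative \<psi>' u) (at u)"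
        unfolding has_field_derivative_def
        by (rule has_derivative_eq_rhs) (auto simp: \<psi>'_def blinfun.scaleR_right scaleR_diff_right[symmetric] mult.commute)
    qed
    then obtain \<xi> where \<xi>: "0 < \<xi>" "\<xi> < t" "\<psi> t - \<psi> 0 = t * \<psi>' \<xi>" by auto
    define r1 r2 where "r1 = f' (p + \<xi> *\<^sub>R h + t *\<^sub>R k) - f' p - f'' (\<xi> *\<^sub>R h + t *\<^sub>R k)"
      and "r2 = f' (p + \<xi> *\<^sub>R h) - f' p - f'' (\<xi> *\<^sub>R h)"
    have r: "norm r1 \<le> \<epsilon> * (t * N)" "norm r2 \<le> \<epsilon> * (t * N)"
      using rem[of \<xi> t] rem[of \<xi> 0] \<xi> t by (simp_all add: r1_def r2_def)
    have "f' (p + \<xi> *\<^sub>R h + t *\<^sub>R k) - f' (p + \<xi> *\<^sub>R h) = t *\<^sub>R f'' k + (r1 - r2)"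
      by (simp add: r1_def r2_def linear_add[OF lin] linear_cmul[OF lin])
    then have "f' (p + \<xi> *\<^sub>R h + t *\<^sub>R k) h - f' (p + \<xi> *\<^sub>R h) h = t *\<^sub>R f'' k h + (r1 - r2) h"
      by (metis blinfun.add_left blinfun.diff_left blinfun.scaleR_left)
    then have "\<psi>' \<xi> = t * inner c (f'' k h) + inner c ((r1 - r2) h)"
      by (simp add: \<psi>'_def inner_add_right)
    moreover have "inner c (\<Delta> t) = \<psi> t - \<psi> 0"
      by (simp add: \<Delta>_def \<psi>_def inner_diff_right inner_add_right)
    ultimately have "inner c (\<Delta> t) / t\<^sup>2 - inner c (f'' k h)
        = inner c ((r1 - r2) h) / t"
      using \<xi> t by (simp add: field_simps power2_eq_square)
    moreover have "\<bar>inner c ((r1 - r2) h)\<bar> \<le> norm c * (2 * \<epsilon> * (t * N) * N)"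
    proof -
      have "norm ((r1 - r2) h) \<le> norm (r1 - r2) * norm h" by (rule norm_blinfun)
      also have "\<dots> \<le> (\<epsilon> * (t * N) + \<epsilon> * (t * N)) * N"
        using order_trans[OF norm_triangle_ineq4 add_mono[OF r]] N t \<epsilon> by (intro mult_mono) auto
      finally have "norm ((r1 - r2) h) \<le> 2 * \<epsilon> * (t * N) * N" by (simp add: algebra_simps)
      then show ?thesis
        using Cauchy_Schwarz_ineq2[of c "(r1 - r2) h"] by (meson mult_left_mono norm_ge_zero order_trans)
    qed
    ultimately have "\<bar>inner c (\<Delta> t) / t\<^sup>2 - inner c (f'' k h)\<bar>
        \<le> norm c * (2 * \<epsilon> * (t * N) * N) / t"
      by (simp only: abs_divide abs_of_pos[OF t(1)] divide_right_mono less_imp_le[OF t(1)])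
    also have "\<dots> = (2 * N * N * norm c) * \<epsilon>" using t by simp
    also have "\<dots> \<le> (2 * N * N * (norm c + 1)) * \<epsilon>" using \<epsilon> N by (intro mult_right_mono mult_left_mono) auto
    also have "\<dots> < (2 * N * N * (norm c + 1) + 1) * \<epsilon>" using \<epsilon> by simp
    also have "\<dots> = e" using N by (simp add: \<epsilon>_def add_nonneg_pos less_imp_neq[symmetric] add_pos_nonneg)
    finally show ?thesis by (simp add: dist_real_def)
  qed
  show "\<forall>\<^sub>F t in at_right 0. dist (inner c (f (p + t *\<^sub>R h + t *\<^sub>R k) - f (p + t *\<^sub>R h) - f (p + t *\<^sub>R k) + f p) / t\<^sup>2)
      (inner c (f'' k h)) < e"
    using T main unfolding \<Delta>_def by (auto simp: eventually_at_right_field)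
qed

lemma symmetric_second_derivative:
  fixes f :: "'a::real_normed_vector \<Rightarrow> 'b::real_inner" and f' :: "'a \<Rightarrow> 'a \<Rightarrow>\<^sub>L 'b"
  assumes "open W" "p \<in> W" "\<And>u. u \<in> W \<Longrightarrow> (f has_derivative blinfun_apply (f' u)) (at u)"
    and "(f' has_derivative f'') (at p)"
  shows "f'' h k = f'' k h"
proof -
  have "inner c (f'' h k) = inner c (f'' k h)" for c
  proof -
    have eq: "f (p + t *\<^sub>R k + t *\<^sub>R h) - f (p + t *\<^sub>R k) - f (p + t *\<^sub>R h) + f p
        = f (p + t *\<^sub>R h + t *\<^sub>R k) - f (p + t *\<^sub>R h) - f (p + t *\<^sub>R k) + f p" for t
      by (simp add: algebra_simps)
    show ?thesis
      using tendsto_unique[OF _ second_difference_tendsto[OF assms, of c k h, unfolded eq]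
          second_difference_tendsto[OF assms, of c h k]] by simp
  qed
  then show ?thesis by (metis vector_eq_ldot)
qed

section \<open>Multipliers for smooth convex inequality systems\<close>

text \<open>Equations between transposed Jacobians are checked by pairing with an arbitrary
  direction, so that the arguments can use derivative maps instead of matrices.\<close>

lemma transpose_jacobian_inner:
  fixes h :: "real^'n \<Rightarrow> real^'m"
  assumes "(h has_derivative h') (at x)"
  shows "inner (transpose (jacobian h (at x)) *v v) k = inner v (h' k)"
proof -
  have "(\<lambda>k. jacobian h (at x) *v k) = h'"
    using assms jacobian_works has_derivative_unique differentiable_def by blast
  then show ?thesis by (metis dot_lmul_matrix transpose_matrix_vector)
qed

lemma complementarity_componentwise:
  fixes v w :: "real^'n"
  assumes "\<And>i. 0 \<le> v $ i" "\<And>i. w $ i \<le> 0" "inner v w = 0"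
  shows "v $ i * w $ i = 0"
proof -
  have "(\<Sum>i\<in>UNIV. - (v $ i * w $ i)) = 0" using assms(3) by (simp add: inner_vec_def sum_negf)
  then have "- (v $ i * w $ i) = 0"
    using assms(1,2) by (subst (asm) sum_nonneg_eq_0_iff) (auto simp: mult_nonneg_nonpos)
  then show ?thesis by simp
qed

text \<open>Membership in the normal cone says that \<open>p\<close> minimises
  \<open>inner n (p - u)\<close> over the feasible \<open>u\<close>. Separating 0 from the convex
  set of attainable objective and constraint bounds gives a multiplier pair without any
  qualification, with \<open>r\<close> possibly zero.\<close>

lemma fritz_john_normal_cone:
  fixes G :: "real^'n \<Rightarrow> real^'q"
  assumes conv: "\<And>i. convex_on UNIV (\<lambda>u. G u $ i)" and der: "(G has_derivative G') (at p)"
    and n: "n \<in> normal_cone {u. \<forall>i. G u $ i \<le> 0} p"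
  shows "\<exists>r \<pi>. (r, \<pi>) \<noteq> 0 \<and> 0 \<le> r \<and> (\<forall>i. 0 \<le> \<pi> $ i) \<and> inner \<pi> (G p) = 0 \<and> (\<forall>h. r * inner n h = inner \<pi> (G' h))"
proof -
  have p: "\<And>i. G p $ i \<le> 0" and n': "\<And>u. (\<And>i. G u $ i \<le> 0) \<Longrightarrow> inner n (u - p) \<le> 0"
    using n by (auto simp: normal_cone_def split: if_splits)
  \<comment> \<open>The strict inequality in the objective is what keeps 0 out of
    \<open>S\<close>.\<close>
  define S where "S = {q :: real \<times> (real^'q). \<exists>u. inner n (p - u) < fst q \<and> (\<forall>i. G u $ i \<le> snd q $ i)}"
  have "convex S"
  proof (rule convexI)
    fix a b :: "real \<times> (real^'q)" and s t :: real
    assume a: "a \<in> S" and b: "b \<in> S" and st: "0 \<le> s" "0 \<le> t" "s + t = 1"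
    obtain u v where u: "inner n (p - u) < fst a" "\<And>i. G u $ i \<le> snd a $ i"
      and v: "inner n (p - v) < fst b" "\<And>i. G v $ i \<le> snd b $ i" using a b by (auto simp: S_def)
    have "inner n (p - (s *\<^sub>R u + t *\<^sub>R v)) = s * inner n (p - u) + t * inner n (p - v)"
    proof -
      have "s *\<^sub>R p + t *\<^sub>R p = p" using st(3) by (simp flip: scaleR_add_left)
      then have "p - (s *\<^sub>R u + t *\<^sub>R v) = s *\<^sub>R (p - u) + t *\<^sub>R (p - v)"
        by (simp add: scaleR_diff_right add_diff_add[symmetric])
      then show ?thesis by (simp add: inner_add_right)
    qed
    also have "\<dots> < s * fst a + t * fst b"
    proof (cases "s = 0")
      case False
      then show ?thesis using st u(1) v(1) by (intro add_less_le_mono mult_strict_left_mono mult_left_mono) auto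
    qed (use st v(1) in simp)
    finally have "inner n (p - (s *\<^sub>R u + t *\<^sub>R v)) < fst (s *\<^sub>R a + t *\<^sub>R b)" by simp
    moreover have "G (s *\<^sub>R u + t *\<^sub>R v) $ i \<le> snd (s *\<^sub>R a + t *\<^sub>R b) $ i" for i
    proof -
      have "G (s *\<^sub>R u + t *\<^sub>R v) $ i \<le> s * G u $ i + t * G v $ i"
        using conv[of i] st by (auto simp: convex_on_def)
      also have "\<dots> \<le> s * snd a $ i + t * snd b $ i" using st u v by (intro add_mono mult_left_mono) auto
      finally show ?thesis by simp
    qed
    ultimately show "s *\<^sub>R a + t *\<^sub>R b \<in> S" unfolding S_def by blast
  qed
  moreover have "(1, G p) \<in> S" by (auto simp: S_def intro!: exI[of _ p])
  then have "S \<noteq> {}" by blast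
  moreover have "0 \<notin> S"
  proof
    assume "0 \<in> S"
    then obtain u where "inner n (p - u) < 0" "\<And>i. G u $ i \<le> 0" by (auto simp: S_def)
    with n'[of u] show False by (simp add: inner_diff_right)
  qed
  ultimately obtain a where a: "a \<noteq> 0" "\<And>q. q \<in> S \<Longrightarrow> 0 \<le> inner a q"
    by (rule separating_hyperplane_set_0_inspan) blast
  define r \<pi> where "r = fst a" and "\<pi> = snd a"
  have sep: "0 \<le> r * s + inner \<pi> v" if "inner n (p - u) < s" "\<And>i. G u $ i \<le> v $ i" for s v u
    using a(2)[of "(s, v)"] that by (auto simp: S_def inner_prod_def r_def \<pi>_def)
  have r0: "0 \<le> r"
  proof (rule ccontr)
    assume "\<not> 0 \<le> r"
    \<comment> \<open>\<open>S\<close> is closed under increasing any coordinate, so a negative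
      coefficient would make the functional negative for large \<open>M\<close>; here and for
      \<open>\<pi>\<close> below.\<close>
    define M where "M = 1 + \<bar>inner \<pi> (G p)\<bar> / - r"
    have "0 \<le> r * M + inner \<pi> (G p)"
      using \<open>\<not> 0 \<le> r\<close> by (intro sep[of p]) (auto simp: M_def add_pos_nonneg divide_nonneg_neg intro: divide_nonneg_pos add_pos_nonneg)
    moreover have "r * M = r - \<bar>inner \<pi> (G p)\<bar>" using \<open>\<not> 0 \<le> r\<close> by (simp add: M_def field_simps)
    ultimately show False using \<open>\<not> 0 \<le> r\<close> by linarith
  qed
  have pi0: "0 \<le> \<pi> $ i" for i
  proof (rule ccontr)
    assume neg: "\<not> 0 \<le> \<pi> $ i"
    define M where "M = (1 + \<bar>r + inner \<pi> (G p)\<bar>) / - (\<pi> $ i)"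
    have M: "0 \<le> M" using neg by (simp add: M_def divide_nonneg_neg divide_nonneg_pos)
    have "0 \<le> r * 1 + inner \<pi> (G p + M *\<^sub>R axis i 1)"
      using M by (intro sep[of p]) (auto simp: axis_def)
    then have "0 \<le> r + inner \<pi> (G p) + M * \<pi> $ i" by (simp add: inner_add_right inner_axis)
    moreover have "M * \<pi> $ i = - (1 + \<bar>r + inner \<pi> (G p)\<bar>)" using neg by (simp add: M_def field_simps)
    ultimately show False by linarith
  qed
  \<comment> \<open>The slack in the objective tends to 0. The function obtained is nonnegative and
    vanishes at \<open>p\<close>, so its derivative there is zero.\<close>
  have main: "0 \<le> inner \<pi> (G u) - r * inner n (u - p)" for u
  proof (rule field_le_epsilon)
    fix e :: real assume e: "0 < e"
    define e' where "e' = e / (r + 1)"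
    have "0 \<le> r * (inner n (p - u) + e') + inner \<pi> (G u)"
      using e r0 by (intro sep[of u]) (auto simp: e'_def add_nonneg_pos)
    moreover have "r * e' \<le> e" using e r0 by (simp add: e'_def field_simps)
    ultimately show "0 \<le> inner \<pi> (G u) - r * inner n (u - p) + e"
      by (simp add: inner_diff_right algebra_simps)
  qed
  have "inner \<pi> (G p) \<le> 0"
    unfolding inner_vec_def using pi0 p by (auto intro!: sum_nonpos simp: mult_nonneg_nonpos)
  with main[of p] have comp: "inner \<pi> (G p) = 0" by simp
  have D: "((\<lambda>u. inner \<pi> (G u) - r * inner n (u - p)) has_derivative (\<lambda>h. inner \<pi> (G' h) - r * inner n h)) (at p within UNIV)"
    using der by (auto intro!: derivative_eq_intros)
  have nn: "0 \<le> inner \<pi> (G' h) - r * inner n h" for h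
    using minimum_variational_inequality[OF D, of "p + h"] main comp by simp
  have lin: "linear G'" using der has_derivative_linear by blast
  have "r * inner n h = inner \<pi> (G' h)" for h
    using nn[of h] nn[of "- h"] by (simp add: linear_neg[OF lin])
  then show ?thesis using a(1) r0 pi0 comp by (intro exI[of _ r] exI[of _ \<pi>]) (auto simp: r_def \<pi>_def)
qed

text \<open>The last conjunct is \<open>v = G'(p)\<^sup>T \<pi>\<close>, stated by duality.\<close>
definition is_multiplier :: "(real^'n \<Rightarrow> real^'q) \<Rightarrow> (real^'n \<Rightarrow> (real^'n) \<Rightarrow>\<^sub>L (real^'q)) \<Rightarrow> real^'n \<Rightarrow> real^'n \<Rightarrow> real^'q \<Rightarrow> bool" where
  "is_multiplier G G' p v \<pi> \<longleftrightarrow>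
     (\<forall>i. 0 \<le> \<pi> $ i) \<and> inner \<pi> (G p) = 0 \<and> (\<forall>h. inner v h = inner \<pi> (G' p h))"

section \<open>Boundedness of multipliers under the constraint qualifications\<close>

lemma bounded_subseq:
  fixes a :: "nat \<Rightarrow> 'a::heine_borel"
  assumes "bounded (range a)"
  obtains l r where "strict_mono r" "(\<lambda>j. a (r j)) \<longlonglongrightarrow> l"
  using bounded_imp_convergent_subsequence[OF assms] unfolding o_def by metis

text \<open>Fritz John pairs are normalised to length one. If their first components were not
  bounded away from zero, a limit would be a pair \<open>(0, \<pi>)\<close> of length one, which
  \<open>mfcq\<close> excludes. Dividing by the first component then gives bounded multipliers. It
  is applied to \<open>X\<close> and, with the weaker consequence of LICQ for nonnegative vectors,
  to \<open>Y\<close>.\<close>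

lemma multipliers_bounded:
  fixes G :: "real^'n \<Rightarrow> real^'q" and G' :: "real^'n \<Rightarrow> (real^'n) \<Rightarrow>\<^sub>L (real^'q)"
  assumes conv: "\<And>i. convex_on UNIV (\<lambda>u. G u $ i)"
    and der: "\<And>u. (G has_derivative blinfun_apply (G' u)) (at u)" and cont: "continuous_on UNIV G'"
    and mfcq: "\<And>\<pi>. \<forall>i. 0 \<le> \<pi> $ i \<Longrightarrow> inner \<pi> (G xb) = 0 \<Longrightarrow> \<forall>h. inner \<pi> (G' xb h) = 0 \<Longrightarrow> \<pi> = 0"
    and p: "p \<longlonglongrightarrow> xb" and v: "\<And>k. v k \<in> normal_cone {u. \<forall>i. G u $ i \<le> 0} (p k)"
    and bd: "\<forall>\<^sub>F k in sequentially. norm (v k) \<le> C"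
  shows "\<exists>B. \<forall>\<^sub>F k in sequentially. \<exists>\<pi>. is_multiplier G G' (p k) (v k) \<pi> \<and> norm \<pi> \<le> B"
proof -
  have "\<exists>q :: real \<times> (real^'q). norm q = 1 \<and> 0 \<le> fst q \<and> (\<forall>i. 0 \<le> snd q $ i) \<and> inner (snd q) (G (p k)) = 0 \<and>
      (\<forall>h. fst q * inner (v k) h = inner (snd q) (G' (p k) h))" for k
  proof -
    obtain r \<pi> where q: "(r, \<pi>) \<noteq> 0" "0 \<le> r" "\<forall>i. 0 \<le> \<pi> $ i" "inner \<pi> (G (p k)) = 0"
      "\<forall>h. r * inner (v k) h = inner \<pi> (G' (p k) h)"
      using fritz_john_normal_cone[OF conv der v] by blast
    define c where "c = inverse (norm (r, \<pi>))"
    have c: "0 < c" using q(1) by (simp add: c_def)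
    have "norm (c *\<^sub>R (r, \<pi>)) = 1" using q(1) by (simp add: c_def del: scaleR_Pair)
    then show ?thesis using c q by (intro exI[of _ "c *\<^sub>R (r, \<pi>)"]) (auto simp: mult.assoc)
  qed
  then obtain q :: "nat \<Rightarrow> real \<times> (real^'q)" where q: "\<And>k. norm (q k) = 1" "\<And>k. 0 \<le> fst (q k)" "\<And>k i. 0 \<le> snd (q k) $ i"
    "\<And>k. inner (snd (q k)) (G (p k)) = 0" "\<And>k h. fst (q k) * inner (v k) h = inner (snd (q k)) (G' (p k) h)"
    by metis
  have "\<exists>c>0. \<forall>\<^sub>F k in sequentially. c \<le> fst (q k)"
  proof (rule ccontr)
    assume neg: "\<not> ?thesis"
    have "\<exists>\<^sub>F k in sequentially. fst (q k) < inverse (real (Suc j)) \<and> norm (v k) \<le> C" for j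
    proof -
      have "\<exists>\<^sub>F k in sequentially. fst (q k) < inverse (real (Suc j))"
        using neg unfolding frequently_def not_less by (metis inverse_positive_iff_positive of_nat_0_less_iff zero_less_Suc)
      from frequently_eventually_frequently[OF this bd] show ?thesis by simp
    qed
    then obtain r1 where r1: "strict_mono r1" "\<And>j. fst (q (r1 j)) < inverse (real (Suc j))" "\<And>j. norm (v (r1 j)) \<le> C"
      using frequently_subseq[of "\<lambda>j k. fst (q k) < inverse (real (Suc j)) \<and> norm (v k) \<le> C"] by blast
    have "bounded (range (\<lambda>j. q (r1 j)))" using q(1) by (intro boundedI[of _ 1]) auto
    then obtain l r2 where r2: "strict_mono r2" and lim: "(\<lambda>j. q (r1 (r2 j))) \<longlonglongrightarrow> l" by (rule bounded_subseq)
    define s where "s j = r1 (r2 j)" for j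
    have s: "strict_mono s" using strict_mono_o[OF r1(1) r2] by (simp add: s_def[abs_def] o_def)
    have ps: "(\<lambda>j. p (s j)) \<longlonglongrightarrow> xb" using LIMSEQ_subseq_LIMSEQ[OF p s] by (simp add: o_def)
    have lim1: "(\<lambda>j. fst (q (s j))) \<longlonglongrightarrow> fst l" and lim2: "(\<lambda>j. snd (q (s j))) \<longlonglongrightarrow> snd l"
      using lim by (auto simp: s_def intro: tendsto_intros)
    have "(\<lambda>j. fst (q (r1 j))) \<longlonglongrightarrow> 0"
      by (rule tendsto_sandwich[OF _ _ tendsto_const LIMSEQ_inverse_real_of_nat])
         (use r1(2) q(2) in \<open>auto intro!: always_eventually less_imp_le\<close>)
    then have l0: "fst l = 0"
      using LIMSEQ_unique[OF lim1] LIMSEQ_subseq_LIMSEQ[OF _ r2] by (auto simp: s_def o_def)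
    have G'c: "(\<lambda>j. G' (p (s j))) \<longlonglongrightarrow> G' xb" and Gc: "(\<lambda>j. G (p (s j))) \<longlonglongrightarrow> G xb"
      using cont has_derivative_continuous[OF der] ps
      by (auto simp: continuous_on_eq_continuous_at intro: isCont_tendsto_compose)
    have "snd l = 0"
    proof (rule mfcq)
      show "\<forall>i. 0 \<le> snd l $ i"
        using q(3) by (auto intro: tendsto_lowerbound[OF tendsto_vec_nth[OF lim2]])
      show "inner (snd l) (G xb) = 0"
        using LIMSEQ_unique[OF tendsto_inner[OF lim2 Gc]] q(4) by simp
      show "\<forall>h. inner (snd l) (G' xb h) = 0"
      proof
        fix h
        have "(\<lambda>j. fst (q (s j)) * inner (v (s j)) h) \<longlonglongrightarrow> 0"
        proof (rule Lim_null_comparison)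
          show "(\<lambda>j. fst (q (s j)) * (C * norm h)) \<longlonglongrightarrow> 0"
            using tendsto_mult_right[OF lim1, of "C * norm h"] l0 by simp
          have "\<bar>inner (v (s j)) h\<bar> \<le> C * norm h" for j
            using Cauchy_Schwarz_ineq2[of "v (s j)" h] r1(3)[of "r2 j"]
            by (metis mult_right_mono norm_ge_zero order_trans s_def)
          then show "\<forall>\<^sub>F j in sequentially. norm (fst (q (s j)) * inner (v (s j)) h) \<le> fst (q (s j)) * (C * norm h)"
            using q(2) by (auto simp: abs_mult intro!: always_eventually mult_left_mono)
        qed
        moreover have "(\<lambda>j. inner (snd (q (s j))) (G' (p (s j)) h)) \<longlonglongrightarrow> inner (snd l) (G' xb h)"
          by (intro tendsto_intros lim2 G'c)
        ultimately show "inner (snd l) (G' xb h) = 0" unfolding q(5) by (rule LIMSEQ_unique[rotated])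
      qed
    qed
    moreover have "norm l = 1"
      using LIMSEQ_unique[OF tendsto_norm[OF lim]] q(1) by simp
    ultimately show False using l0 by (cases l) simp
  qed
  then obtain c where c: "0 < c" "\<forall>\<^sub>F k in sequentially. c \<le> fst (q k)" by blast
  from c(2) have "\<forall>\<^sub>F k in sequentially. \<exists>\<pi>. is_multiplier G G' (p k) (v k) \<pi> \<and> norm \<pi> \<le> 1 / c"
  proof eventually_elim
    case (elim k)
    define \<pi> where "\<pi> = (1 / fst (q k)) *\<^sub>R snd (q k)"
    have pos: "0 < fst (q k)" using elim c by linarith
    have "norm (snd (q k)) \<le> 1" using q(1)[of k] norm_snd_le[of "snd (q k)" "fst (q k)"] by simp
    then have "norm \<pi> \<le> 1 / c" using pos elim c by (simp add: \<pi>_def frac_le)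
    moreover have "is_multiplier G G' (p k) (v k) \<pi>"
      using pos q(3,4)[of k] q(5)[of k] by (auto simp: is_multiplier_def \<pi>_def field_simps)
    ultimately show ?case by blast
  qed
  then show ?thesis by blast
qed

text \<open>Normalised counterexamples would converge to a unit vector supported on \<open>A\<close>
  that the limit map annihilates. No sign is imposed on \<open>c\<close>, because the estimate is
  meant for a scaled difference of two multipliers.\<close>

lemma independent_multipliers_bounded:
  fixes g' :: "real^'m \<Rightarrow> (real^'m) \<Rightarrow>\<^sub>L (real^'p)"
  assumes cont: "continuous_on UNIV g'" and q: "q \<longlonglongrightarrow> yb"
    and indep: "\<And>c. (\<And>i. i \<notin> A \<Longrightarrow> c $ i = 0) \<Longrightarrow> (\<And>h. inner c (g' yb h) = 0) \<Longrightarrow> c = 0"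
  shows "\<exists>B. \<forall>\<^sub>F k in sequentially. \<forall>c v. (\<forall>i. i \<notin> A \<longrightarrow> c $ i = 0) \<longrightarrow> (\<forall>h. inner v h = inner c (g' (q k) h)) \<longrightarrow>
      norm c \<le> B * norm v"
proof (rule ccontr)
  assume neg: "\<not> ?thesis"
  have "\<exists>\<^sub>F k in sequentially. \<exists>c v. (\<forall>i. i \<notin> A \<longrightarrow> c $ i = 0) \<and> (\<forall>h. inner v h = inner c (g' (q k) h)) \<and>
      real (Suc j) * norm v < norm c" for j
  proof -
    have "\<not> (\<forall>\<^sub>F k in sequentially. \<forall>c v. (\<forall>i. i \<notin> A \<longrightarrow> c $ i = 0) \<longrightarrow> (\<forall>h. inner v h = inner c (g' (q k) h)) \<longrightarrow>
      norm c \<le> real (Suc j) * norm v)" using neg by blast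
    then show ?thesis unfolding frequently_def
      by (rule contrapos_nn) (erule eventually_mono, meson not_le_imp_less)
  qed
  from frequently_subseq[of "\<lambda>j k. \<exists>c v. (\<forall>i. i \<notin> A \<longrightarrow> c $ i = 0) \<and> (\<forall>h. inner v h = inner c (g' (q k) h)) \<and>
      real (Suc j) * norm v < norm c", OF this]
  obtain r1 where r1: "strict_mono r1" and "\<And>j. \<exists>c v. (\<forall>i. i \<notin> A \<longrightarrow> c $ i = 0) \<and> (\<forall>h. inner v h = inner c (g' (q (r1 j)) h)) \<and>
      real (Suc j) * norm v < norm c" by blast
  then obtain c v where cv: "\<And>j i. i \<notin> A \<Longrightarrow> c j $ i = 0" "\<And>j h. inner (v j) h = inner (c j) (g' (q (r1 j)) h)"
    "\<And>j. real (Suc j) * norm (v j) < norm (c j)" by metis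
  have c0: "0 < norm (c j)" for j using cv(3)[of j] by (meson le_less_trans mult_nonneg_nonneg norm_ge_zero of_nat_0_le_iff)
  define d where "d j = sgn (c j)" for j
  have d1: "norm (d j) = 1" for j using c0[of j] by (simp add: d_def norm_sgn)
  then have "bounded (range d)" by (intro boundedI[of _ 1]) auto
  then obtain l r2 where r2: "strict_mono r2" and lim: "(\<lambda>j. d (r2 j)) \<longlonglongrightarrow> l" by (rule bounded_subseq)
  have s: "strict_mono (\<lambda>j. r1 (r2 j))" using strict_mono_o[OF r1 r2] by (simp add: o_def)
  have "(\<lambda>j. q (r1 (r2 j))) \<longlonglongrightarrow> yb" using LIMSEQ_subseq_LIMSEQ[OF q s] by (simp add: o_def)
  then have g'c: "(\<lambda>j. g' (q (r1 (r2 j)))) \<longlonglongrightarrow> g' yb"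
    using cont by (auto simp: continuous_on_eq_continuous_at intro: isCont_tendsto_compose)
  have "l = 0"
  proof (rule indep)
    fix i assume "i \<notin> A"
    then show "l $ i = 0"
      using LIMSEQ_unique[OF tendsto_vec_nth[OF lim, of i]] cv(1) by (simp add: d_def sgn_div_norm)
  next
    fix h
    have "(\<lambda>j. inner (d j) (g' (q (r1 j)) h)) \<longlonglongrightarrow> 0"
    proof (rule Lim_null_comparison)
      show "(\<lambda>j. inverse (real (Suc j)) * norm h) \<longlonglongrightarrow> 0"
        using tendsto_mult_right[OF LIMSEQ_inverse_real_of_nat, of "norm h"] by simp
      have "\<bar>inner (d j) (g' (q (r1 j)) h)\<bar> \<le> inverse (real (Suc j)) * norm h" for j
      proof -
        have "inner (d j) (g' (q (r1 j)) h) = inner (v j) h / norm (c j)"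
          using cv(2)[of j h] by (simp add: d_def sgn_div_norm divide_inverse mult.commute)
        then have "\<bar>inner (d j) (g' (q (r1 j)) h)\<bar> \<le> norm (v j) * norm h / norm (c j)"
          using Cauchy_Schwarz_ineq2[of "v j" h] by (simp add: abs_divide divide_right_mono)
        also have "\<dots> = (norm (v j) / norm (c j)) * norm h" by simp
        also have "\<dots> \<le> inverse (real (Suc j)) * norm h"
          using cv(3)[of j] c0[of j] by (intro mult_right_mono) (auto simp: field_simps)
        finally show ?thesis .
      qed
      then show "\<forall>\<^sub>F j in sequentially. norm (inner (d j) (g' (q (r1 j)) h)) \<le> inverse (real (Suc j)) * norm h" by simp
    qed
    from LIMSEQ_subseq_LIMSEQ[OF this r2]
    have "(\<lambda>j. inner (d (r2 j)) (g' (q (r1 (r2 j))) h)) \<longlonglongrightarrow> 0" by (simp add: o_def)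
    moreover have "(\<lambda>j. inner (d (r2 j)) (g' (q (r1 (r2 j))) h)) \<longlonglongrightarrow> inner l (g' yb h)"
      by (intro tendsto_intros lim g'c)
    ultimately show "inner l (g' yb h) = 0" by (rule LIMSEQ_unique[rotated])
  qed
  moreover have "norm l = 1" using LIMSEQ_unique[OF tendsto_norm[OF lim]] d1 by simp
  ultimately show False by simp
qed

lemma has_derivative_vec_component:
  fixes g :: "'a::real_normed_vector \<Rightarrow> real^'p"
  assumes "(g has_derivative g') F"
  shows "((\<lambda>y. g y $ i) has_derivative (\<lambda>h. g' h $ i)) F"
  using bounded_linear.has_derivative[OF bounded_linear_vec_nth assms] .

lemma lower_LICQ_D:
  fixes g :: "real^'m \<Rightarrow> real^'p"
  assumes licq: "lower_LICQ g yb" and der: "(g has_derivative g') (at yb)"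
    and supp: "\<And>i. g yb $ i \<noteq> 0 \<Longrightarrow> c $ i = 0" and zero: "\<And>h. inner c (g' h) = 0"
  shows "c = 0"
proof -
  define A where "A = {i. g yb $ i = 0}"
  define dg where "dg i = gradient (\<lambda>y. g y $ i) (at yb)" for i
  have inj: "inj_on dg A" and ind: "independent (dg ` A)"
    using licq by (simp_all add: lower_LICQ_def Let_def A_def dg_def[abs_def])
  have dg: "inner h (dg i) = g' h $ i" for h i
    unfolding dg_def by (rule inner_gradient[OF has_derivative_vec_component[OF der]])
  have "inner h (\<Sum>i\<in>A. c $ i *\<^sub>R dg i) = 0" for h
  proof -
    have "inner h (\<Sum>i\<in>A. c $ i *\<^sub>R dg i) = (\<Sum>i\<in>A. c $ i * g' h $ i)"
      by (simp add: inner_sum_right dg)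
    also have "\<dots> = (\<Sum>i\<in>UNIV. c $ i * g' h $ i)"
      using supp by (intro sum.mono_neutral_left) (auto simp: A_def)
    also have "\<dots> = 0" using zero[of h] by (simp add: inner_vec_def)
    finally show ?thesis .
  qed
  then have z: "(\<Sum>i\<in>A. c $ i *\<^sub>R dg i) = 0" by (metis inner_eq_zero_iff)
  \<comment> \<open>\<open>independent\<close> speaks of sets of vectors; injectivity of
    \<open>dg\<close> carries the coefficients from indices over to vectors.\<close>
  define u where "u w = c $ (the_inv_into A dg w)" for w
  have "(\<Sum>w\<in>dg ` A. u w *\<^sub>R w) = (\<Sum>i\<in>A. c $ i *\<^sub>R dg i)"
    using inj by (subst sum.reindex) (auto simp: u_def the_inv_into_f_f intro!: sum.cong)
  with z have "\<forall>w\<in>dg ` A. u w = 0"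
    using ind independentD[of "dg ` A" "dg ` A" u] by auto
  then have "c $ i = 0" if "i \<in> A" for i using that inj by (force simp: u_def the_inv_into_f_f)
  with supp show ?thesis by (auto simp: vec_eq_iff A_def)
qed

section \<open>Limits of saddle points\<close>

lemma tendsto_eventually_norm_le:
  fixes a :: "nat \<Rightarrow> 'a::real_normed_vector"
  assumes "a \<longlonglongrightarrow> l"
  shows "\<forall>\<^sub>F k in sequentially. norm (a k) \<le> norm l + 1"
proof -
  have "\<forall>\<^sub>F k in sequentially. norm (a k) < norm l + 1"
    using tendsto_norm[OF assms] by (intro order_tendstoD) auto
  then show ?thesis by (auto elim: eventually_mono)
qed

context bilevel_data
begin

lemma gradient_limits:
  fixes u :: "nat \<Rightarrow> 'a" and a :: "nat \<Rightarrow> 'b"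
  assumes "\<And>k. u k \<in> X" "\<And>k. a k \<in> Y" "xb \<in> X" "yb \<in> Y" "u \<longlonglongrightarrow> xb" "a \<longlonglongrightarrow> yb"
  shows "(\<lambda>k. Fx (u k) (a k)) \<longlonglongrightarrow> Fx xb yb" "(\<lambda>k. Fy (u k) (a k)) \<longlonglongrightarrow> Fy xb yb" "(\<lambda>k. fy (u k) (a k)) \<longlonglongrightarrow> fy xb yb"
proof -
  have "(\<lambda>k. L * (norm (u k - xb) + norm (a k - yb))) \<longlonglongrightarrow> L * (norm (xb - xb) + norm (yb - yb))"
    by (intro tendsto_intros assms(5,6))
  then have 0: "(\<lambda>k. L * (norm (u k - xb) + norm (a k - yb))) \<longlonglongrightarrow> 0" by simp
  note b = lipschitz_gradients[OF assms(1) assms(3) assms(2) assms(4)]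
  show "(\<lambda>k. Fx (u k) (a k)) \<longlonglongrightarrow> Fx xb yb" "(\<lambda>k. Fy (u k) (a k)) \<longlonglongrightarrow> Fy xb yb" "(\<lambda>k. fy (u k) (a k)) \<longlonglongrightarrow> fy xb yb"
    by (rule LIM_zero_cancel[OF Lim_null_comparison[OF always_eventually 0]], use b in blast)+
qed

end

text \<open>The algorithm has disappeared: only points of \<open>X\<close> and their exact saddle
  points remain. Convergence is assumed for the y component alone; that of z is derived in
  \<open>zs_lim\<close>.\<close>

locale approx_seq = bilevel_data X Y F f L
  for X :: "'a::euclidean_space set" and Y :: "'b::euclidean_space set" and F f L +
  fixes u :: "nat \<Rightarrow> 'a" and \<rho> \<sigma> \<delta> :: "nat \<Rightarrow> real" and xb :: 'a and yb :: 'b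
  assumes u_in: "\<And>k. u k \<in> X"
    and params: "\<And>k. 0 < \<rho> k" "\<And>k. 0 < \<sigma> k" "\<And>k. 0 < \<delta> k"
    and \<rho>_lim: "filterlim \<rho> at_top sequentially" and \<sigma>_lim: "\<sigma> \<longlonglongrightarrow> 0" and \<delta>_lim: "\<delta> \<longlonglongrightarrow> 0"
    and u_lim: "u \<longlonglongrightarrow> xb"
    and saddle_lim: "(\<lambda>k. fst (saddle_point Y F f (\<rho> k) (\<sigma> k) (\<delta> k) (u k))) \<longlonglongrightarrow> yb"
    and isc: "inner_semicontinuous_at X (lower_sol Y f) xb"
begin

definition "ys k = fst (saddle_point Y F f (\<rho> k) (\<sigma> k) (\<delta> k) (u k))"
definition "zs k = snd (saddle_point Y F f (\<rho> k) (\<sigma> k) (\<delta> k) (u k))"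

lemma ys_lim: "ys \<longlonglongrightarrow> yb"
  using saddle_lim by (simp add: ys_def[abs_def])

lemma ys_in: "ys k \<in> Y" and zs_in: "zs k \<in> Y"
  unfolding ys_def zs_def by (rule fst_saddle_in[OF u_in params] snd_saddle_in[OF u_in params])+

lemma xb_in: "xb \<in> X"
  using closed_X u_in u_lim by (rule closed_sequentially)

lemma yb_in: "yb \<in> Y"
  using Y(2) ys_in ys_lim by (rule closed_sequentially)

lemma inverse_\<rho>_lim: "(\<lambda>k. 1 / \<rho> k) \<longlonglongrightarrow> 0"
  using tendsto_inverse_0_at_top[OF \<rho>_lim] by (simp add: inverse_eq_divide)

lemma continuous_composites:
  assumes "a \<longlonglongrightarrow> a0" "b \<longlonglongrightarrow> b0"
  shows "(\<lambda>k. F (a k, b k)) \<longlonglongrightarrow> F (a0, b0)" "(\<lambda>k. f (a k, b k)) \<longlonglongrightarrow> f (a0, b0)"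
  using continuous_F[of UNIV] continuous_f[of UNIV] tendsto_Pair[OF assms]
  by (auto simp: continuous_on_eq_continuous_at intro: isCont_tendsto_compose)

text \<open>The maximality of y, compared with a lower-level solution of norm at most
  \<open>R\<close>, bounds \<open>\<rho>\<close> times the lower-level gap of \<open>ys\<close>. The
  gap therefore vanishes like \<open>1 / \<rho>\<close>.\<close>

lemma lower_optimal: "yb \<in> lower_sol Y f xb"
proof -
  obtain R where R: "uniform_radius R" using uniform_radius_exists by blast
  have "\<exists>s. \<forall>k. s k \<in> lower_sol Y f (u k) \<and> norm (s k) \<le> R"
    using R u_in by (intro choice) (auto simp: uniform_radius_def)
  then obtain s where s: "\<And>k. s k \<in> lower_sol Y f (u k)" "\<And>k. norm (s k) \<le> R" by blast
  obtain M where M0: "0 < M" and M: "\<forall>x\<in>X. \<forall>y\<in>Y. norm y \<le> R \<longrightarrow> norm (F (x, y)) \<le> M"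
    using bounded_on_compact[OF continuous_F] by metis
  have R0: "0 < R" using R by (simp add: uniform_radius_def)
  have gap: "f (u k, ys k) - f (u k, s k) \<le> (2 * M + 2 * R\<^sup>2 * \<sigma> k + R\<^sup>2 * \<delta> k) * (1 / \<rho> k)" for k
  proof -
    have n: "norm (ys k) \<le> R" "norm (zs k) \<le> R"
      using R u_in params by (auto simp: uniform_radius_def ys_def zs_def)
    have sY: "s k \<in> Y" using lower_solD(1)[OF u_in params s(1)] .
    have "\<bar>F (u k, ys k)\<bar> \<le> M" "\<bar>F (u k, s k)\<bar> \<le> M"
      using M u_in ys_in sY n s(2) by auto
    moreover have "- (2 * R\<^sup>2) * \<sigma> k \<le> \<sigma> k * inner (ys k - s k) (zs k)"
    proof -
      have "norm (ys k - s k) * norm (zs k) \<le> (2 * R) * R"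
        using n s(2)[of k] R0 norm_triangle_ineq4[of "ys k" "s k"] by (intro mult_mono) auto
      then have "- (2 * R\<^sup>2) \<le> inner (ys k - s k) (zs k)"
        using Cauchy_Schwarz_ineq2[of "ys k - s k" "zs k"] by (simp add: power2_eq_square abs_le_iff)
      from mult_left_mono[OF this less_imp_le[OF params(2)[of k]]] show ?thesis by (simp add: mult_ac)
    qed
    moreover have "- R\<^sup>2 * \<delta> k \<le> \<delta> k / 2 * ((norm (ys k))\<^sup>2 - (norm (s k))\<^sup>2)"
    proof -
      have "(norm (s k))\<^sup>2 \<le> R\<^sup>2" using s(2) by (intro power_mono) auto
      then have "- (2 * R\<^sup>2) \<le> (norm (ys k))\<^sup>2 - (norm (s k))\<^sup>2"
        using zero_le_power2[of "norm (ys k)"] zero_le_power2[of R] by linarith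
      then have "\<delta> k / 2 * - (2 * R\<^sup>2) \<le> \<delta> k / 2 * ((norm (ys k))\<^sup>2 - (norm (s k))\<^sup>2)"
        using params(3)[of k] by (intro mult_left_mono) auto
      then show ?thesis by (simp add: mult_ac)
    qed
    ultimately have "\<rho> k * (f (u k, ys k) - f (u k, s k)) \<le> 2 * M + 2 * R\<^sup>2 * \<sigma> k + R\<^sup>2 * \<delta> k"
      using lower_value_y[OF u_in[of k] params(1)[of k] params(2)[of k] params(3)[of k] s(1)[of k]] unfolding ys_def[symmetric] zs_def[symmetric] by linarith
    then show ?thesis using params(1)[of k] by (simp add: field_simps)
  qed
  have "f (xb, yb) \<le> f (xb, v)" if v: "v \<in> Y" for v
  proof (rule LIMSEQ_le)
    show "(\<lambda>k. f (u k, ys k)) \<longlonglongrightarrow> f (xb, yb)" by (intro continuous_composites u_lim ys_lim)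
    have "(\<lambda>k. f (u k, v) + (2 * M + 2 * R\<^sup>2 * \<sigma> k + R\<^sup>2 * \<delta> k) * (1 / \<rho> k))
        \<longlonglongrightarrow> f (xb, v) + (2 * M + 2 * R\<^sup>2 * 0 + R\<^sup>2 * 0) * 0"
      by (intro tendsto_intros continuous_composites u_lim \<sigma>_lim \<delta>_lim inverse_\<rho>_lim)
    then show "(\<lambda>k. f (u k, v) + (2 * M + 2 * R\<^sup>2 * \<sigma> k + R\<^sup>2 * \<delta> k) * (1 / \<rho> k)) \<longlonglongrightarrow> f (xb, v)" by simp
    have "f (u k, ys k) \<le> f (u k, v) + (2 * M + 2 * R\<^sup>2 * \<sigma> k + R\<^sup>2 * \<delta> k) * (1 / \<rho> k)" for k
      using gap[of k] lower_solD(2)[OF u_in params s(1) v, of k] by linarith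
    then show "\<exists>N. \<forall>k\<ge>N. f (u k, ys k) \<le> f (u k, v) + (2 * M + 2 * R\<^sup>2 * \<sigma> k + R\<^sup>2 * \<delta> k) * (1 / \<rho> k)" by blast
  qed
  then show ?thesis using yb_in by (auto simp: lower_sol_def is_arg_min_linorder)
qed

lemma lower_selection:
  assumes "v \<in> lower_sol Y f xb"
  obtains s where "\<And>k. s k \<in> lower_sol Y f (u k)" "s \<longlonglongrightarrow> v"
  using isc assms u_in u_lim unfolding inner_semicontinuous_at_def by blast

text \<open>Inner semicontinuity approximates every competitor by lower-level solutions at
  \<open>u k\<close>, where the comparison free of \<open>\<rho>\<close> is available; its quadratic
  terms vanish with \<open>\<sigma>\<close> and \<open>\<delta>\<close>.\<close>

lemma pessimistic_optimal: "yb \<in> pess_sol Y F f xb"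
proof -
  have "F (xb, v) \<le> F (xb, yb)" if v: "v \<in> lower_sol Y f xb" for v
  proof -
    obtain s where s: "\<And>k. s k \<in> lower_sol Y f (u k)" "s \<longlonglongrightarrow> v" by (rule lower_selection[OF v]) blast
    have "(\<lambda>k. (\<sigma> k + \<delta> k) / 2 * ((norm (ys k))\<^sup>2 - (norm (s k))\<^sup>2)) \<longlonglongrightarrow> (0 + 0) / 2 * ((norm yb)\<^sup>2 - (norm v)\<^sup>2)"
      by (intro tendsto_intros \<sigma>_lim \<delta>_lim ys_lim s(2)) simp
    moreover have "(\<lambda>k. F (u k, ys k) - F (u k, s k)) \<longlonglongrightarrow> F (xb, yb) - F (xb, v)"
      by (intro tendsto_diff continuous_composites u_lim ys_lim s(2))
    moreover have "(\<sigma> k + \<delta> k) / 2 * ((norm (ys k))\<^sup>2 - (norm (s k))\<^sup>2) \<le> F (u k, ys k) - F (u k, s k)" for k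
      using upper_value_y[OF u_in params s(1)] by (simp add: ys_def)
    ultimately have "(0 + 0) / 2 * ((norm yb)\<^sup>2 - (norm v)\<^sup>2) \<le> F (xb, yb) - F (xb, v)"
      by (intro LIMSEQ_le[of "\<lambda>k. (\<sigma> k + \<delta> k) / 2 * ((norm (ys k))\<^sup>2 - (norm (s k))\<^sup>2)" _
          "\<lambda>k. F (u k, ys k) - F (u k, s k)"]) auto
    then show ?thesis by simp
  qed
  then show ?thesis using lower_optimal by (auto simp: pess_sol_def is_arg_max_linorder)
qed

lemma zs_lim: "zs \<longlonglongrightarrow> yb"
proof -
  obtain s where s: "\<And>k. s k \<in> lower_sol Y f (u k)" "s \<longlonglongrightarrow> yb" by (rule lower_selection[OF lower_optimal]) blast
  have "norm (zs k - s k) \<le> norm (ys k - s k)" for k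
    using proximal_nonexpansive[OF u_in params s(1)] by (simp add: ys_def zs_def)
  moreover have "(\<lambda>k. norm (ys k - s k)) \<longlonglongrightarrow> norm (yb - yb)" by (intro tendsto_intros ys_lim s(2))
  ultimately have "(\<lambda>k. zs k - s k) \<longlonglongrightarrow> 0"
    by (intro Lim_null_comparison[of "\<lambda>k. zs k - s k" "\<lambda>k. norm (ys k - s k)"]) auto
  from tendsto_add[OF this s(2)] show ?thesis by simp
qed

lemma lower_sol_closed: "x \<in> X \<Longrightarrow> closed (lower_sol Y f x)"
proof -
  have "lower_sol Y f x = Y \<inter> (\<Inter>v\<in>Y. {y. f (x, y) \<le> f (x, v)})"
    by (auto simp: lower_sol_def is_arg_min_linorder)
  moreover have "continuous_on UNIV (\<lambda>y. f (x, y))"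
    by (rule continuous_on_compose2[OF continuous_f[of UNIV]]) (auto intro!: continuous_intros)
  then have "closed {y. f (x, y) \<le> f (x, v)}" for v by (intro closed_Collect_le continuous_intros)
  ultimately show ?thesis using Y(2) by (auto intro!: closed_Int closed_INT)
qed

text \<open>Divided by \<open>\<rho>\<close>, the optimality condition of y is that of the
  lower-level problem with a residual of order \<open>1 / \<rho>\<close>. The error bound turns this
  into a distance of the same order to the solution set, and nonexpansiveness of the proximal map
  bounds \<open>zs - ys\<close> by twice that distance.\<close>

lemma scaled_gap_bounded:
  assumes "uniform_error_bound X Y f xb yb"
  shows "\<exists>C. \<forall>\<^sub>F k in sequentially. norm (\<rho> k *\<^sub>R (zs k - ys k)) \<le> C"
proof -
  obtain U V \<kappa> where UV: "open U" "xb \<in> U" "open V" "yb \<in> V" and \<kappa>: "0 < \<kappa>"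
    and eb: "\<And>x y. x \<in> X \<inter> U \<Longrightarrow> y \<in> Y \<inter> V \<Longrightarrow>
      infdist y (lower_sol Y f x) \<le> \<kappa> * infdist 0 ((\<lambda>v. fy x y + v) ` normal_cone Y y)"
    using assms unfolding uniform_error_bound_def partials by blast
  obtain R where R: "uniform_radius R" using uniform_radius_exists by blast
  have "continuous_on (X \<times> Y) (\<lambda>p. snd (gradient F (at p)))"
    using lipschitz_on_continuous_on[OF F_lip] by (intro continuous_intros)
  from bounded_on_compact[OF this, of R]
  obtain M where M: "\<forall>x\<in>X. \<forall>y\<in>Y. norm y \<le> R \<longrightarrow> norm (Fy x y) \<le> M" by (auto simp: Fy_def)
  have "\<forall>\<^sub>F k in sequentially. u k \<in> U" "\<forall>\<^sub>F k in sequentially. ys k \<in> V"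
    using topological_tendstoD[OF u_lim UV(1,2)] topological_tendstoD[OF ys_lim UV(3,4)] .
  moreover have "\<forall>\<^sub>F k in sequentially. \<sigma> k < 1" "\<forall>\<^sub>F k in sequentially. \<delta> k < 1"
    using order_tendstoD(2)[OF \<sigma>_lim, of 1] order_tendstoD(2)[OF \<delta>_lim, of 1] by simp_all
  ultimately have "\<forall>\<^sub>F k in sequentially. norm (\<rho> k *\<^sub>R (zs k - ys k)) \<le> 2 * (\<kappa> * (M + R + R))"
  proof eventually_elim
    case (elim k)
    have n: "norm (ys k) \<le> R" "norm (zs k) \<le> R"
      using R u_in params by (auto simp: uniform_radius_def ys_def zs_def)
    let ?d = "Fy (u k) (ys k) - \<sigma> k *\<^sub>R zs k - \<delta> k *\<^sub>R ys k"
    have "norm (\<sigma> k *\<^sub>R zs k) \<le> 1 * R" "norm (\<delta> k *\<^sub>R ys k) \<le> 1 * R"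
      unfolding norm_scaleR using n elim params[of k] by (intro mult_mono; simp)+
    moreover have "norm (Fy (u k) (ys k)) \<le> M" using M u_in ys_in n(1) by blast
    ultimately have dB: "norm ?d \<le> M + R + R"
      by (intro norm_triangle_le_diff add_mono) simp_all
    let ?v = "(1 / \<rho> k) *\<^sub>R (?d - \<rho> k *\<^sub>R fy (u k) (ys k))"
    have "- fst (vi_op (\<rho> k) (\<sigma> k) (\<delta> k) (u k) (ys k, zs k)) \<in> normal_cone Y (ys k)"
      using saddle_point_normal(1)[OF u_in params, of k] by (simp add: ys_def zs_def)
    then have "?d - \<rho> k *\<^sub>R fy (u k) (ys k) \<in> normal_cone Y (ys k)"
      by (simp add: vi_op_def algebra_simps)
    then have v: "?v \<in> normal_cone Y (ys k)" using params(1)[of k] by (intro normal_cone_scale) auto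
    have "infdist 0 ((\<lambda>v. fy (u k) (ys k) + v) ` normal_cone Y (ys k)) \<le> dist 0 (fy (u k) (ys k) + ?v)"
      using v by (intro infdist_le imageI)
    also have "fy (u k) (ys k) + ?v = (1 / \<rho> k) *\<^sub>R ?d"
      using params(1)[of k] by (simp add: scaleR_diff_right)
    also have "dist 0 \<dots> \<le> (M + R + R) / \<rho> k"
      using dB params(1)[of k] by (simp add: dist_norm divide_right_mono)
    finally have i: "infdist (ys k) (lower_sol Y f (u k)) \<le> \<kappa> * ((M + R + R) / \<rho> k)"
      using eb[of "u k" "ys k"] elim u_in ys_in mult_left_mono[OF _ less_imp_le[OF \<kappa>]] by (meson IntI order_trans)
    have "lower_sol Y f (u k) \<noteq> {}" using R u_in by (auto simp: uniform_radius_def)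
    then obtain q where q: "q \<in> lower_sol Y f (u k)" "infdist (ys k) (lower_sol Y f (u k)) = dist (ys k) q"
      using infdist_attains_inf[OF lower_sol_closed[OF u_in]] by metis
    have "norm (zs k - q) \<le> norm (ys k - q)"
      using proximal_nonexpansive[OF u_in params q(1)] by (simp add: ys_def zs_def)
    then have "norm (zs k - ys k) \<le> 2 * norm (ys k - q)"
      using norm_triangle_ineq4[of "zs k - q" "ys k - q"] by simp
    also have "\<dots> \<le> 2 * (\<kappa> * ((M + R + R) / \<rho> k))" using i q(2) by (simp add: dist_norm)
    finally have "\<rho> k * norm (zs k - ys k) \<le> \<rho> k * (2 * (\<kappa> * ((M + R + R) / \<rho> k)))"
      using params(1)[of k] by (intro mult_left_mono) auto
    then show ?case using params(1)[of k] by simp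
  qed
  then show ?thesis by blast
qed

end

section \<open>Passage to the limit in the optimality conditions\<close>

text \<open>The derivative of the Lagrangian is available only after pairing with a fixed vector;
  the pairings with the basis assemble the derivative itself.\<close>

lemma jacobian_by_components:
  fixes \<Lambda> :: "real^'n \<Rightarrow> real^'m"
  assumes "\<And>c. ((\<lambda>x. inner (\<Lambda> x) c) has_derivative (\<lambda>h. \<phi> h c)) (at x0)"
  shows "inner (transpose (jacobian \<Lambda> (at x0)) *v \<gamma>) h = \<phi> h \<gamma>"
proof -
  define D where "D h = (\<Sum>b\<in>Basis. \<phi> h b *\<^sub>R b)" for h
  have D: "(\<Lambda> has_derivative D) (at x0)"
    unfolding has_derivative_componentwise_within[of \<Lambda>]
    using assms by (auto simp: D_def inner_sum_left inner_Basis if_distrib sum.delta cong: if_cong)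
  then have "((\<lambda>x. inner (\<Lambda> x) \<gamma>) has_derivative (\<lambda>h. inner (D h) \<gamma>)) (at x0)"
    by (auto intro!: derivative_eq_intros)
  from fun_cong[OF has_derivative_unique[OF this assms[of \<gamma>]], of h]
  show ?thesis unfolding transpose_jacobian_inner[OF D] by (simp add: inner_commute)
qed

locale constrained = bilevel_data X Y F f L
  for X :: "(real^'n) set" and Y :: "(real^'m) set" and F f L +
  fixes G :: "real^'n \<Rightarrow> real^'q" and g :: "real^'m \<Rightarrow> real^'p"
    and G' :: "real^'n \<Rightarrow> (real^'n) \<Rightarrow>\<^sub>L (real^'q)" and g' :: "real^'m \<Rightarrow> (real^'m) \<Rightarrow>\<^sub>L (real^'p)"
    and g'' :: "real^'m \<Rightarrow> (real^'m) \<Rightarrow>\<^sub>L ((real^'m) \<Rightarrow>\<^sub>L (real^'p))"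
    and W :: "((real^'n) \<times> (real^'m)) set"
    and f' :: "(real^'n) \<times> (real^'m) \<Rightarrow> ((real^'n) \<times> (real^'m)) \<Rightarrow>\<^sub>L real"
    and f'' :: "(real^'n) \<times> (real^'m) \<Rightarrow> ((real^'n) \<times> (real^'m)) \<Rightarrow>\<^sub>L (((real^'n) \<times> (real^'m)) \<Rightarrow>\<^sub>L real)"
    and xb :: "real^'n" and yb :: "real^'m"
  assumes X_eq: "X = {u. \<forall>i. G u $ i \<le> 0}" and Y_eq: "Y = {v. \<forall>i. g v $ i \<le> 0}"
    and G_convex: "\<And>i. convex_on UNIV (\<lambda>u. G u $ i)" and g_convex: "\<And>i. convex_on UNIV (\<lambda>v. g v $ i)"
    and G': "\<And>u. (G has_derivative blinfun_apply (G' u)) (at u)" and G'_cont: "continuous_on UNIV G'"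
    and g': "\<And>v. (g has_derivative blinfun_apply (g' v)) (at v)"
    and g'': "\<And>v. (g' has_derivative blinfun_apply (g'' v)) (at v)" and g''_cont: "continuous_on UNIV g''"
    and W: "open W" "(xb, yb) \<in> W"
    and f': "\<And>p. p \<in> W \<Longrightarrow> (f has_derivative blinfun_apply (f' p)) (at p)"
    and f'': "\<And>p. p \<in> W \<Longrightarrow> (f' has_derivative blinfun_apply (f'' p)) (at p)" and f''_cont: "continuous_on W f''"
begin

lemma g'_cont: "continuous_on UNIV g'"
  by (auto intro!: continuous_at_imp_continuous_on has_derivative_continuous[OF g''])

lemma f_gradient_inner:
  assumes "(u, v) \<in> W"
  shows "inner (fx u v) h = f' (u, v) (h, 0)" "inner (fy u v) k = f' (u, v) (0, k)"
  using inner_gradient[OF f'[OF assms], of "(h, 0)"] inner_gradient[OF f'[OF assms], of "(0, k)"]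
  by (simp_all add: inner_prod_def fx_def fy_def inner_commute)

lemma lower_lagr_inner:
  assumes "(u, v) \<in> W"
  shows "inner (lower_lagr f g u v \<mu>) c = f' (u, v) (0, c) + inner \<mu> (g' v c)"
  unfolding lower_lagr_def partials
  using f_gradient_inner(2)[OF assms] transpose_jacobian_inner[OF g']
  by (simp add: inner_add_left)

lemma f''_symmetric: "p \<in> W \<Longrightarrow> f'' p h k = f'' p k h"
  using symmetric_second_derivative[OF W(1) _ f' f''] by blast

lemma f''_minus: "f'' p (0, - b) k = - f'' p (0, b) k"
  using blinfun.minus_right[of "f'' p" "(0, b)"] by (simp add: blinfun.minus_left)

lemma g''_symmetric: "g'' v h k = g'' v k h"
  using symmetric_second_derivative[OF open_UNIV UNIV_I g' g''] .

text \<open>Differentiation produces the direction \<open>(h, 0)\<close> in the first slot of the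
  second derivative. Symmetry moves \<open>\<gamma>\<close> there, which is where the limits of the
  difference quotients of \<open>f'\<close> put it. The formula for the Lagrangian holds only on
  \<open>W\<close>, hence the transfer within an open set.\<close>

lemma lagr_jacobian_x:
  "inner (transpose (jacobian (\<lambda>x. lower_lagr f g x yb \<mu>) (at xb)) *v \<gamma>) h = f'' (xb, yb) (0, \<gamma>) (h, 0)"
proof -
  have "inner (transpose (jacobian (\<lambda>x. lower_lagr f g x yb \<mu>) (at xb)) *v \<gamma>) h = f'' (xb, yb) (h, 0) (0, \<gamma>)"
  proof (rule jacobian_by_components)
    fix c
    have "((\<lambda>x. (x, yb)) has_derivative (\<lambda>h. (h, 0))) (at xb)" by (auto intro!: derivative_eq_intros)
    from has_derivative_compose[OF this f''[OF W(2)]]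
    have "((\<lambda>x. f' (x, yb)) has_derivative (\<lambda>h. f'' (xb, yb) (h, 0))) (at xb)" .
    from bounded_linear.has_derivative[OF blinfun.bounded_linear_left this, of "(0, c)"]
    have "((\<lambda>x. f' (x, yb) (0, c) + inner \<mu> (g' yb c)) has_derivative (\<lambda>h. f'' (xb, yb) (h, 0) (0, c))) (at xb)"
      by (rule has_derivative_add_const)
    moreover have "open ((\<lambda>x. (x, yb)) -` W)" using W(1) by (intro open_vimage) (auto intro!: continuous_intros)
    ultimately show "((\<lambda>x. inner (lower_lagr f g x yb \<mu>) c) has_derivative (\<lambda>h. f'' (xb, yb) (h, 0) (0, c))) (at xb)"
      by (rule has_derivative_transform_within_open) (use W in \<open>auto simp: lower_lagr_inner\<close>)
  qed
  then show ?thesis using f''_symmetric[OF W(2)] by simp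
qed

lemma lagr_jacobian_y:
  "inner (transpose (jacobian (\<lambda>y. lower_lagr f g xb y \<mu>) (at yb)) *v \<gamma>) h
     = f'' (xb, yb) (0, \<gamma>) (0, h) + inner \<mu> (g'' yb \<gamma> h)"
proof -
  have "inner (transpose (jacobian (\<lambda>y. lower_lagr f g xb y \<mu>) (at yb)) *v \<gamma>) h
      = f'' (xb, yb) (0, h) (0, \<gamma>) + inner \<mu> (g'' yb h \<gamma>)"
  proof (rule jacobian_by_components[where \<phi> = "\<lambda>h c. f'' (xb, yb) (0, h) (0, c) + inner \<mu> (g'' yb h c)"])
    fix c
    have "((\<lambda>y. (xb, y)) has_derivative (\<lambda>h. (0, h))) (at yb)" by (auto intro!: derivative_eq_intros)
    from has_derivative_compose[OF this f''[OF W(2)]]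
    have "((\<lambda>y. f' (xb, y)) has_derivative (\<lambda>h. f'' (xb, yb) (0, h))) (at yb)" .
    from has_derivative_add[OF bounded_linear.has_derivative[OF blinfun.bounded_linear_left this, of "(0, c)"]
      bounded_linear.has_derivative[OF bounded_linear_inner_right
        bounded_linear.has_derivative[OF blinfun.bounded_linear_left g'', of c], of \<mu>]]
    have "((\<lambda>y. f' (xb, y) (0, c) + inner \<mu> (g' y c)) has_derivative
        (\<lambda>h. f'' (xb, yb) (0, h) (0, c) + inner \<mu> (g'' yb h c))) (at yb)" .
    moreover have "open ((\<lambda>y. (xb, y)) -` W)" using W(1) by (intro open_vimage) (auto intro!: continuous_intros)
    ultimately show "((\<lambda>y. inner (lower_lagr f g xb y \<mu>) c) has_derivative
        (\<lambda>h. f'' (xb, yb) (0, h) (0, c) + inner \<mu> (g'' yb h c))) (at yb)"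
      by (rule has_derivative_transform_within_open) (use W in \<open>auto simp: lower_lagr_inner\<close>)
  qed
  then show ?thesis using f''_symmetric[OF W(2)] g''_symmetric by simp
qed

end

text \<open>
  The multipliers are those of the optimality conditions for \<open>y\<close> and \<open>z\<close> after division by \<open>\<rho>\<close>.
  Multiplied by \<open>\<rho>\<close> again, the difference of the two conditions produces in the limit
  the adjoint equation with \<open>\<gamma> = lim \<rho> (z - y)\<close> and \<open>\<omega> = lim \<rho> (\<nu> - \<mu>)\<close>.
\<close>
locale kkt_seq = constrained X Y F f L G g G' g' g'' W f' f'' xb yb
  for X :: "(real^'n) set" and Y :: "(real^'m) set" and F f L
    and G :: "real^'n \<Rightarrow> real^'q" and g :: "real^'m \<Rightarrow> real^'p" and G' g' g'' W f' f'' xb yb +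
  fixes u p v :: "nat \<Rightarrow> real^'n" and y z :: "nat \<Rightarrow> real^'m" and \<rho> \<sigma> \<delta> :: "nat \<Rightarrow> real"
    and \<mu> \<nu> :: "nat \<Rightarrow> real^'p" and \<pi> :: "nat \<Rightarrow> real^'q" and m :: "real^'p" and P :: "real^'q" and \<gamma> :: "real^'m"
  assumes in_sets: "\<And>k. u k \<in> X" "\<And>k. y k \<in> Y" "\<And>k. z k \<in> Y" "xb \<in> X" "yb \<in> Y"
    and \<rho>_pos: "\<And>k. 0 < \<rho> k" and inv_\<rho>: "(\<lambda>k. 1 / \<rho> k) \<longlonglongrightarrow> 0"
    and \<sigma>0: "\<sigma> \<longlonglongrightarrow> 0" and \<delta>0: "\<delta> \<longlonglongrightarrow> 0"
    and u_lim: "u \<longlonglongrightarrow> xb" and y_lim: "y \<longlonglongrightarrow> yb" and z_lim: "z \<longlonglongrightarrow> yb" and p_lim: "p \<longlonglongrightarrow> xb" and v_lim: "v \<longlonglongrightarrow> 0"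
    and \<gamma>: "(\<lambda>k. \<rho> k *\<^sub>R (z k - y k)) \<longlonglongrightarrow> \<gamma>" and \<mu>: "\<mu> \<longlonglongrightarrow> m" and \<pi>: "\<pi> \<longlonglongrightarrow> P"
    and kkt_y: "\<And>k. is_multiplier g g' (y k)
        ((1 / \<rho> k) *\<^sub>R (- fst (vi_op (\<rho> k) (\<sigma> k) (\<delta> k) (u k) (y k, z k)))) (\<mu> k)"
    and kkt_z: "\<And>k. is_multiplier g g' (z k)
        ((1 / \<rho> k) *\<^sub>R (- snd (vi_op (\<rho> k) (\<sigma> k) (\<delta> k) (u k) (y k, z k)))) (\<nu> k)"
    and kkt_x: "\<And>k. is_multiplier G G' (p k) (v k - phi_grad (\<rho> k) (u k) (y k, z k)) (\<pi> k)"
begin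

definition "\<omega> k = \<rho> k *\<^sub>R (\<nu> k - \<mu> k)"

lemma scaled_difference: "(\<lambda>k. \<rho> k *\<^sub>R (y k - z k)) \<longlonglongrightarrow> - \<gamma>"
proof -
  have "\<rho> k *\<^sub>R (y k - z k) = - (\<rho> k *\<^sub>R (z k - y k))" for k by (simp add: algebra_simps)
  then show ?thesis using tendsto_minus[OF \<gamma>] by simp
qed

lemma f'_difference: "(\<lambda>k. \<rho> k *\<^sub>R (f' (u k, y k) - f' (u k, z k))) \<longlonglongrightarrow> f'' (xb, yb) (0, - \<gamma>)"
proof (rule C1_difference_quotient_tendsto[OF W f'' f''_cont])
  show "(\<lambda>k. (u k, y k)) \<longlonglongrightarrow> (xb, yb)" "(\<lambda>k. (u k, z k)) \<longlonglongrightarrow> (xb, yb)"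
    by (intro tendsto_Pair u_lim y_lim z_lim)+
  show "(\<lambda>k. \<rho> k *\<^sub>R ((u k, y k) - (u k, z k))) \<longlonglongrightarrow> (0, - \<gamma>)"
    using tendsto_Pair[OF tendsto_const scaled_difference, of 0] by simp
qed

lemma g'_difference: "(\<lambda>k. \<rho> k *\<^sub>R (g' (y k) - g' (z k))) \<longlonglongrightarrow> g'' yb (- \<gamma>)"
  by (rule C1_difference_quotient_tendsto[OF open_UNIV UNIV_I g'' g''_cont y_lim z_lim scaled_difference])

lemma g_difference: "(\<lambda>k. \<rho> k *\<^sub>R (g (y k) - g (z k))) \<longlonglongrightarrow> g' yb (- \<gamma>)"
  by (rule C1_difference_quotient_tendsto[OF open_UNIV UNIV_I g' g'_cont y_lim z_lim scaled_difference])

lemma eventually_W: "\<forall>\<^sub>F k in sequentially. (u k, y k) \<in> W \<and> (u k, z k) \<in> W"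
  using topological_tendstoD[OF tendsto_Pair[OF u_lim y_lim] W]
    topological_tendstoD[OF tendsto_Pair[OF u_lim z_lim] W] by (rule eventually_conj)

text \<open>The condition for y is subtracted from the one for z, both multiplied by
  \<open>\<rho>\<close>; the terms \<open>\<sigma> *\<^sub>R z\<close> cancel. Replacing
  \<open>g' (y k)\<close> by \<open>g' (z k)\<close> is charged to \<open>\<mu>\<close>, which
  converges, so that no bound on \<open>\<omega>\<close> is presupposed.\<close>

lemma \<omega>_limit:
  "(\<lambda>k. inner (\<omega> k) (g' (z k) h)) \<longlonglongrightarrow> - inner (Fy xb yb) h - f'' (xb, yb) (0, \<gamma>) (0, h) - inner m (g'' yb \<gamma> h)"
proof -
  have eq: "\<forall>\<^sub>F k in sequentially.
      - inner (Fy (u k) (y k)) h + (\<rho> k *\<^sub>R (f' (u k, y k) - f' (u k, z k))) (0, h) + (\<sigma> k + \<delta> k) * inner (y k) h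
        + inner (\<mu> k) ((\<rho> k *\<^sub>R (g' (y k) - g' (z k))) h)
      = inner (\<omega> k) (g' (z k) h)"
    using eventually_W
  proof eventually_elim
    case (elim k)
    have scale: "inner c h = \<rho> k * d" if "inner ((1 / \<rho> k) *\<^sub>R c) h = d" for c d
      using that \<rho>_pos[of k] by auto
    have 1: "inner (- fst (vi_op (\<rho> k) (\<sigma> k) (\<delta> k) (u k) (y k, z k))) h = \<rho> k * inner (\<mu> k) (g' (y k) h)"
      and 2: "inner (- snd (vi_op (\<rho> k) (\<sigma> k) (\<delta> k) (u k) (y k, z k))) h = \<rho> k * inner (\<nu> k) (g' (z k) h)"
      using kkt_y[of k] kkt_z[of k] by (auto simp only: is_multiplier_def intro!: scale)
    show ?case
      using 1 2 f_gradient_inner(2)[of "u k" "y k" h] f_gradient_inner(2)[of "u k" "z k" h] elim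
      by (simp add: \<omega>_def vi_op_def blinfun.diff_left blinfun.scaleR_left algebra_simps inner_simps)
  qed
  have "(\<lambda>k. - inner (Fy (u k) (y k)) h + (\<rho> k *\<^sub>R (f' (u k, y k) - f' (u k, z k))) (0, h) + (\<sigma> k + \<delta> k) * inner (y k) h
        + inner (\<mu> k) ((\<rho> k *\<^sub>R (g' (y k) - g' (z k))) h))
     \<longlonglongrightarrow> - inner (Fy xb yb) h + f'' (xb, yb) (0, - \<gamma>) (0, h) + (0 + 0) * inner yb h + inner m (g'' yb (- \<gamma>) h)"
    by (intro tendsto_intros gradient_limits f'_difference g'_difference \<sigma>0 \<delta>0 u_lim y_lim \<mu> in_sets)
  moreover note f''_minus[of "(xb, yb)" \<gamma> "(0, h)"]
  moreover have "g'' yb (- \<gamma>) h = - g'' yb \<gamma> h" by (simp add: blinfun.minus_left blinfun.minus_right)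
  ultimately show ?thesis using Lim_transform_eventually[OF _ eq] by simp
qed

lemma feasible: "g (y k) $ i \<le> 0" "g (z k) $ i \<le> 0" "g yb $ i \<le> 0"
  using in_sets(2)[of k] in_sets(3)[of k] in_sets(5) by (simp_all add: Y_eq)

lemma comp_y: "\<mu> k $ i * g (y k) $ i = 0" and comp_z: "\<nu> k $ i * g (z k) $ i = 0"
  using complementarity_componentwise[of "\<mu> k" "g (y k)" i] complementarity_componentwise[of "\<nu> k" "g (z k)" i]
    kkt_y[of k] kkt_z[of k] feasible by (simp_all add: is_multiplier_def)

lemma g_lim: "(\<lambda>k. g (y k) $ i) \<longlonglongrightarrow> g yb $ i" "(\<lambda>k. g (z k) $ i) \<longlonglongrightarrow> g yb $ i"
  using isCont_tendsto_compose[OF has_derivative_continuous[OF g'] y_lim]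
    isCont_tendsto_compose[OF has_derivative_continuous[OF g'] z_lim] by (auto intro: tendsto_vec_nth)

lemma \<omega>_inactive:
  assumes "g yb $ i < 0"
  shows "\<forall>\<^sub>F k in sequentially. \<omega> k $ i = 0"
  using order_tendstoD(2)[OF g_lim(1) assms] order_tendstoD(2)[OF g_lim(2) assms]
proof eventually_elim
  case (elim k)
  then have "\<mu> k $ i = 0" "\<nu> k $ i = 0" using comp_y[of k i] comp_z[of k i] by auto
  then show ?case by (simp add: \<omega>_def)
qed

text \<open>The preceding limit controls \<open>\<omega>\<close> only through the transposed
  derivative of \<open>g\<close>. Since \<open>\<omega>\<close> is eventually supported on the
  indices active at \<open>yb\<close>, LICQ inverts that map with a uniform bound.\<close>

lemma \<omega>_subseq:
  assumes licq: "lower_LICQ g yb"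
  shows "\<exists>r w. strict_mono r \<and> (\<lambda>j. \<omega> (r j)) \<longlonglongrightarrow> w"
proof -
  define A where "A = {i. g yb $ i = 0}"
  \<comment> \<open>The vector that represents
    \<open>h \<mapsto> inner (\<omega> k) (g' (z k) h)\<close>; it converges because its coordinates
    do.\<close>
  define q where "q k = (\<Sum>b\<in>Basis. inner (\<omega> k) (g' (z k) b) *\<^sub>R b)" for k
  have q: "inner (q k) h = inner (\<omega> k) (g' (z k) h)" for k h
  proof -
    have "linear (\<lambda>h. inner (\<omega> k) (g' (z k) h))"
      by (intro bounded_linear.linear bounded_linear_intros)
    then show ?thesis
      using linear_functional_eq_inner[of "\<lambda>h. inner (\<omega> k) (g' (z k) h)" h] unfolding q_def
      by (simp add: inner_commute)
  qed
  have "q \<longlonglongrightarrow> (\<Sum>b\<in>Basis. (- inner (Fy xb yb) b - f'' (xb, yb) (0, \<gamma>) (0, b) - inner m (g'' yb \<gamma> b)) *\<^sub>R b)"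
    unfolding q_def by (intro tendsto_sum tendsto_scaleR \<omega>_limit tendsto_const)
  from tendsto_eventually_norm_le[OF this] obtain C where C: "\<forall>\<^sub>F k in sequentially. norm (q k) \<le> C" by blast
  have supp: "\<forall>\<^sub>F k in sequentially. \<forall>i. i \<notin> A \<longrightarrow> \<omega> k $ i = 0"
    unfolding eventually_all_finite
  proof (intro eventually_all_finite allI)
    fix i
    show "\<forall>\<^sub>F k in sequentially. i \<notin> A \<longrightarrow> \<omega> k $ i = 0"
      using \<omega>_inactive[of i] feasible(3)[of i] by (cases "i \<in> A") (auto simp: A_def elim: eventually_mono)
  qed
  obtain B where B: "\<forall>\<^sub>F k in sequentially. \<forall>c v. (\<forall>i. i \<notin> A \<longrightarrow> c $ i = 0) \<longrightarrow> (\<forall>h. inner v h = inner c (g' (z k) h)) \<longrightarrow>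
      norm c \<le> B * norm v"
  proof -
    have "c = 0" if "\<And>i. i \<notin> A \<Longrightarrow> c $ i = 0" "\<And>h. inner c (g' yb h) = 0" for c
      using lower_LICQ_D[OF licq g' _ that(2)] that(1) by (auto simp: A_def)
    from independent_multipliers_bounded[OF g'_cont z_lim this] show ?thesis using that by blast
  qed
  have "\<forall>\<^sub>F k in sequentially. norm (\<omega> k) \<le> \<bar>B\<bar> * C"
    using B supp C
  proof eventually_elim
    case (elim k)
    then have "norm (\<omega> k) \<le> B * norm (q k)" using q by blast
    also have "\<dots> \<le> \<bar>B\<bar> * C" using elim(3) by (intro mult_mono) auto
    finally show ?case .
  qed
  then obtain N where N: "\<And>k. N \<le> k \<Longrightarrow> norm (\<omega> k) \<le> \<bar>B\<bar> * C" by (auto simp: eventually_sequentially)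
  then have "bounded (range (\<lambda>k. \<omega> (k + N)))" by (intro boundedI[of _ "\<bar>B\<bar> * C"]) auto
  then obtain w r where r: "strict_mono r" "(\<lambda>j. \<omega> (r j + N)) \<longlonglongrightarrow> w" by (rule bounded_subseq)
  then show ?thesis by (intro exI[of _ "\<lambda>j. r j + N"] exI[of _ w]) (auto simp: strict_mono_def)
qed

theorem C_stationary_limit:
  assumes licq: "lower_LICQ g yb" and opt: "yb \<in> pess_sol Y F f xb"
  shows "C_stationary X Y F f G g xb"
proof -
  obtain r w where r: "strict_mono r" and w: "(\<lambda>j. \<omega> (r j)) \<longlonglongrightarrow> w" using \<omega>_subseq[OF licq] by blast
  have sub: "(\<lambda>j. a (r j)) \<longlonglongrightarrow> l" if "a \<longlonglongrightarrow> l" for a :: "nat \<Rightarrow> 'z::topological_space" and l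
    using LIMSEQ_subseq_LIMSEQ[OF that r] by (simp add: o_def)
  have evsub: "\<forall>\<^sub>F j in sequentially. Q (r j)" if "\<forall>\<^sub>F k in sequentially. Q k" for Q
    using eventually_subseq[OF r that] .
  have wi: "(\<lambda>j. \<omega> (r j) $ i) \<longlonglongrightarrow> w $ i" for i using w by (rule tendsto_vec_nth)
  \<comment> \<open>The multipliers of y and of z have the same limit, because they differ by
    \<open>\<omega> / \<rho>\<close> and \<open>\<omega>\<close> stays bounded.\<close>
  have nz: "(\<lambda>j. \<nu> (r j)) \<longlonglongrightarrow> m"
  proof -
    have "\<mu> k + (1 / \<rho> k) *\<^sub>R \<omega> k = \<nu> k" for k using \<rho>_pos[of k] by (simp add: \<omega>_def)
    moreover have "(\<lambda>j. \<mu> (r j) + (1 / \<rho> (r j)) *\<^sub>R \<omega> (r j)) \<longlonglongrightarrow> m + 0 *\<^sub>R w"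
      by (intro tendsto_intros sub[OF \<mu>] sub[OF inv_\<rho>] w)
    ultimately show ?thesis by simp
  qed
  have g'_lim: "(\<lambda>k. g' (a k)) \<longlonglongrightarrow> g' yb" if "a \<longlonglongrightarrow> yb" for a
    using g'_cont that by (auto simp: continuous_on_eq_continuous_at intro: isCont_tendsto_compose)
  have G_lims: "(\<lambda>k. G' (p k)) \<longlonglongrightarrow> G' xb" "(\<lambda>k. G (p k)) \<longlonglongrightarrow> G xb"
    using G'_cont p_lim has_derivative_continuous[OF G']
    by (auto simp: continuous_on_eq_continuous_at intro: isCont_tendsto_compose)
  have mult: "m \<in> multipliers f g xb yb"
  proof -
    have nonneg: "0 \<le> m $ i" for i
      using kkt_y by (intro tendsto_lowerbound[OF tendsto_vec_nth[OF \<mu>]]) (auto simp: is_multiplier_def)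
    have "(\<lambda>k. inner (\<mu> k) (g (y k))) \<longlonglongrightarrow> inner m (g yb)"
      by (intro tendsto_intros \<mu> isCont_tendsto_compose[OF has_derivative_continuous[OF g'] y_lim])
    then have "inner m (g yb) = 0" using kkt_y by (simp add: is_multiplier_def LIMSEQ_const_iff)
    moreover have "lower_lagr f g xb yb m = 0"
    proof -
      have "inner (lower_lagr f g xb yb m) h = 0" for h
      proof -
        have "(\<lambda>k. inner ((1 / \<rho> k) *\<^sub>R (Fy (u k) (y k) - \<sigma> k *\<^sub>R z k - \<delta> k *\<^sub>R y k) - fy (u k) (y k)) h)
            \<longlonglongrightarrow> inner (0 *\<^sub>R (Fy xb yb - 0 *\<^sub>R yb - 0 *\<^sub>R yb) - fy xb yb) h"
          by (intro tendsto_intros gradient_limits inv_\<rho> \<sigma>0 \<delta>0 u_lim y_lim z_lim in_sets)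
        moreover have "inner ((1 / \<rho> k) *\<^sub>R (Fy (u k) (y k) - \<sigma> k *\<^sub>R z k - \<delta> k *\<^sub>R y k) - fy (u k) (y k)) h
            = inner (\<mu> k) (g' (y k) h)" for k
        proof -
          have "(1 / \<rho> k) *\<^sub>R (- fst (vi_op (\<rho> k) (\<sigma> k) (\<delta> k) (u k) (y k, z k)))
              = (1 / \<rho> k) *\<^sub>R (Fy (u k) (y k) - \<sigma> k *\<^sub>R z k - \<delta> k *\<^sub>R y k) - fy (u k) (y k)"
            using \<rho>_pos[of k] by (simp add: vi_op_def scaleR_diff_right scaleR_add_right)
          then show ?thesis using kkt_y[of k] by (metis is_multiplier_def)
        qed
        moreover have "(\<lambda>k. inner (\<mu> k) (g' (y k) h)) \<longlonglongrightarrow> inner m (g' yb h)"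
          by (intro tendsto_intros \<mu> g'_lim y_lim)
        ultimately have "inner m (g' yb h) = - inner (fy xb yb) h"
          by (simp add: LIMSEQ_unique)
        then show ?thesis using lower_lagr_inner[OF W(2)] f_gradient_inner(2)[OF W(2)] by simp
      qed
      then show ?thesis by (metis inner_eq_zero_iff)
    qed
    ultimately show ?thesis using nonneg feasible(3) by (simp add: multipliers_def)
  qed
  have eq_x: "grad_x F xb yb + transpose (jacobian (\<lambda>x. lower_lagr f g x yb m) (at xb)) *v \<gamma>
      + transpose (jacobian G (at xb)) *v P = 0" (is "?e = 0")
  proof -
    have "inner ?e h = 0" for h
    proof -
      have eq: "\<forall>\<^sub>F k in sequentially.
          inner (v k) h - inner (Fx (u k) (y k)) h + (\<rho> k *\<^sub>R (f' (u k, y k) - f' (u k, z k))) (h, 0) = inner (\<pi> k) (G' (p k) h)"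
        using eventually_W
      proof eventually_elim
        case (elim k)
        have "inner (v k - phi_grad (\<rho> k) (u k) (y k, z k)) h = inner (\<pi> k) (G' (p k) h)"
          using kkt_x[of k] by (simp add: is_multiplier_def)
        then show ?case
          using f_gradient_inner(1)[of "u k" "y k" h] f_gradient_inner(1)[of "u k" "z k" h] elim
          by (simp add: phi_grad_def blinfun.diff_left blinfun.scaleR_left inner_simps)
      qed
      have "(\<lambda>k. inner (v k) h - inner (Fx (u k) (y k)) h + (\<rho> k *\<^sub>R (f' (u k, y k) - f' (u k, z k))) (h, 0))
          \<longlonglongrightarrow> inner 0 h - inner (Fx xb yb) h + f'' (xb, yb) (0, - \<gamma>) (h, 0)"
        by (intro tendsto_intros gradient_limits f'_difference v_lim u_lim y_lim in_sets)
      then have "(\<lambda>k. inner (\<pi> k) (G' (p k) h)) \<longlonglongrightarrow> inner 0 h - inner (Fx xb yb) h + f'' (xb, yb) (0, - \<gamma>) (h, 0)"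
        using eq by (rule Lim_transform_eventually)
      moreover have "(\<lambda>k. inner (\<pi> k) (G' (p k) h)) \<longlonglongrightarrow> inner P (G' xb h)"
        by (intro tendsto_intros \<pi> G_lims)
      ultimately have "inner P (G' xb h) = inner 0 h - inner (Fx xb yb) h + f'' (xb, yb) (0, - \<gamma>) (h, 0)"
        by (rule LIMSEQ_unique[rotated])
      then show ?thesis using f''_minus[of "(xb, yb)" \<gamma> "(h, 0)"]
        by (simp add: inner_add_left partials lagr_jacobian_x transpose_jacobian_inner[OF G'] del: transpose_matrix_vector)
    qed
    then show ?thesis by (metis inner_eq_zero_iff)
  qed
  have eq_y: "grad_y F xb yb + transpose (jacobian (\<lambda>y. lower_lagr f g xb y m) (at yb)) *v \<gamma>
      + transpose (jacobian g (at yb)) *v w = 0" (is "?e = 0")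
  proof -
    have "inner ?e h = 0" for h
    proof -
      have "(\<lambda>j. inner (\<omega> (r j)) (g' (z (r j)) h)) \<longlonglongrightarrow> inner w (g' yb h)"
        by (intro tendsto_intros w g'_lim sub[OF z_lim])
      then have "inner w (g' yb h) = - inner (Fy xb yb) h - f'' (xb, yb) (0, \<gamma>) (0, h) - inner m (g'' yb \<gamma> h)"
        using sub[OF \<omega>_limit[of h]] by (rule LIMSEQ_unique)
      then show ?thesis
        by (simp add: inner_add_left partials lagr_jacobian_y transpose_jacobian_inner[OF g'] del: transpose_matrix_vector)
    qed
    then show ?thesis by (metis inner_eq_zero_iff)
  qed
  have P: "0 \<le> P $ i" for i
    using kkt_x by (intro tendsto_lowerbound[OF tendsto_vec_nth[OF \<pi>]]) (auto simp: is_multiplier_def)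
  have "(\<lambda>k. inner (\<pi> k) (G (p k))) \<longlonglongrightarrow> inner P (G xb)" by (intro tendsto_intros \<pi> G_lims)
  then have PG: "inner P (G xb) = 0" using kkt_x by (simp add: is_multiplier_def LIMSEQ_const_iff)
  have grad_g: "inner (gradient (\<lambda>y. g y $ i) (at yb)) \<gamma> = g' yb \<gamma> $ i" for i
    using inner_gradient[OF has_derivative_vec_component[OF g']] by (metis inner_commute)
  have g_diff: "(\<lambda>j. \<rho> (r j) * (g (z (r j)) $ i - g (y (r j)) $ i)) \<longlonglongrightarrow> g' yb \<gamma> $ i" for i
  proof -
    have "- ((\<rho> k *\<^sub>R (g (y k) - g (z k))) $ i) = \<rho> k * (g (z k) $ i - g (y k) $ i)" for k
      by (simp add: algebra_simps)
    then show ?thesis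
      using sub[OF tendsto_minus[OF tendsto_vec_nth[OF g_difference, of i]]] by (simp add: blinfun.minus_right)
  qed
  have I1: "w $ i = 0" if "g yb $ i < 0" for i
  proof -
    have "(\<lambda>j. \<omega> (r j) $ i) \<longlonglongrightarrow> 0" using evsub[OF \<omega>_inactive[OF that]] by (rule tendsto_eventually)
    with wi show ?thesis by (rule LIMSEQ_unique)
  qed
  \<comment> \<open>Both multipliers are eventually positive, so by complementarity the constraint
    is active at both points and the difference quotient is exactly zero.\<close>
  have I3: "g' yb \<gamma> $ i = 0" if "0 < m $ i" for i
  proof -
    have "\<forall>\<^sub>F j in sequentially. 0 < \<mu> (r j) $ i" "\<forall>\<^sub>F j in sequentially. 0 < \<nu> (r j) $ i"
      using order_tendstoD(1)[OF tendsto_vec_nth[OF sub[OF \<mu>]] that] order_tendstoD(1)[OF tendsto_vec_nth[OF nz] that] .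
    then have "\<forall>\<^sub>F j in sequentially. \<rho> (r j) * (g (z (r j)) $ i - g (y (r j)) $ i) = 0"
    proof eventually_elim
      case (elim j)
      then show ?case using comp_y[of "r j" i] comp_z[of "r j" i] by auto
    qed
    then have "(\<lambda>j. \<rho> (r j) * (g (z (r j)) $ i - g (y (r j)) $ i)) \<longlonglongrightarrow> 0" by (rule tendsto_eventually)
    with g_diff show ?thesis by (rule LIMSEQ_unique)
  qed
  \<comment> \<open>Complementarity kills the two diagonal products and the cross products are
    nonpositive. One factor \<open>\<rho>\<close> goes to the multipliers and one to the constraint
    values before the limit is taken.\<close>
  have I2: "0 \<le> w $ i * g' yb \<gamma> $ i" for i
  proof (rule tendsto_lowerbound[OF tendsto_mult[OF wi g_diff]])
    have "0 \<le> \<omega> k $ i * (\<rho> k * (g (z k) $ i - g (y k) $ i))" for k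
    proof -
      have "(\<nu> k $ i - \<mu> k $ i) * (g (z k) $ i - g (y k) $ i) = - (\<nu> k $ i * g (y k) $ i) - \<mu> k $ i * g (z k) $ i"
        using comp_y[of k i] comp_z[of k i] by (auto simp: algebra_simps)
      moreover have "\<nu> k $ i * g (y k) $ i \<le> 0" "\<mu> k $ i * g (z k) $ i \<le> 0"
        using kkt_y[of k] kkt_z[of k] feasible by (auto simp: is_multiplier_def intro!: mult_nonneg_nonpos)
      ultimately have "0 \<le> (\<nu> k $ i - \<mu> k $ i) * (g (z k) $ i - g (y k) $ i)" by linarith
      then have "0 \<le> (\<rho> k * \<rho> k) * ((\<nu> k $ i - \<mu> k $ i) * (g (z k) $ i - g (y k) $ i))" by simp
      then show ?thesis by (simp add: \<omega>_def mult_ac)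
    qed
    then show "\<forall>\<^sub>F j in sequentially. 0 \<le> \<omega> (r j) $ i * (\<rho> (r j) * (g (z (r j)) $ i - g (y (r j)) $ i))" by simp
  qed simp
  show ?thesis
    unfolding C_stationary_def
  proof (intro conjI bexI exI allI impI)
    show "grad_x F xb yb + transpose (jacobian (\<lambda>x. lower_lagr f g x yb m) (at xb)) *v \<gamma> + transpose (jacobian G (at xb)) *v P = 0"
      by (rule eq_x)
    show "grad_y F xb yb + transpose (jacobian (\<lambda>y. lower_lagr f g xb y m) (at yb)) *v \<gamma> + transpose (jacobian g (at yb)) *v w = 0"
      by (rule eq_y)
  qed (use in_sets(4) opt mult P PG I1 I2 I3 grad_g in auto)
qed

end

section \<open>Construction of convergent multipliers along the saddle points\<close>

context constrained
begin

theorem C_stationary_of_approx_seq: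
  assumes seq: "approx_seq X Y F f L u \<rho> \<sigma> \<delta> xb yb"
    and \<alpha>_pos: "\<And>k. 0 < \<alpha> k" and \<alpha>0: "\<alpha> \<longlonglongrightarrow> 0"
    and stat: "(\<lambda>k. proj_grad_map X Y F f (\<alpha> k) (\<rho> k) (\<sigma> k) (\<delta> k) (u k)) \<longlonglongrightarrow> 0"
    and mfcq: "upper_MFCQ G xb" and licq: "lower_LICQ g yb" and ueb: "uniform_error_bound X Y f xb yb"
  shows "C_stationary X Y F f G g xb"
proof -
  interpret a: approx_seq X Y F f L u \<rho> \<sigma> \<delta> xb yb by (rule seq)
  let ?y = a.ys and ?z = a.zs
  define d where "d k = phi_grad (\<rho> k) (u k) (?y k, ?z k)" for k
  define v where "v k = proj_grad_map X Y F f (\<alpha> k) (\<rho> k) (\<sigma> k) (\<delta> k) (u k)" for k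
  \<comment> \<open>The condition in x holds exactly at the projected point \<open>p k\<close>, with
    residual \<open>v k\<close>, and not at \<open>u k\<close>; both points have the same
    limit.\<close>
  define p where "p k = closest_point X (u k - \<alpha> k *\<^sub>R d k)" for k
  have sol: "saddle_point Y F f (\<rho> k) (\<sigma> k) (\<delta> k) (u k) = (?y k, ?z k)" for k
    by (simp add: a.ys_def a.zs_def)
  have v_lim: "v \<longlonglongrightarrow> 0" using stat by (simp add: v_def[abs_def])
  have \<alpha>v: "\<alpha> k *\<^sub>R v k = u k - p k" for k
    using proj_grad_map_eq[OF a.u_in a.params \<alpha>_pos, of k] \<alpha>_pos[of k] by (simp add: v_def p_def d_def sol)
  have p_lim: "p \<longlonglongrightarrow> xb"
  proof -
    have "(\<lambda>k. u k - \<alpha> k *\<^sub>R v k) \<longlonglongrightarrow> xb - 0 *\<^sub>R 0" by (intro tendsto_intros a.u_lim \<alpha>0 v_lim)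
    then show ?thesis by (simp add: \<alpha>v)
  qed
  have p_in: "p k \<in> X" for k unfolding p_def using closed_X X(1) by (rule closest_point_in_set)
  have normal_x: "v k - d k \<in> normal_cone {u. \<forall>i. G u $ i \<le> 0} (p k)" for k
  proof -
    have "u k - \<alpha> k *\<^sub>R d k - p k = \<alpha> k *\<^sub>R (v k - d k)" using \<alpha>v[of k] by (simp add: scaleR_diff_right)
    then have "\<alpha> k *\<^sub>R (v k - d k) \<in> normal_cone X (p k)"
      using closest_point_dot[OF X(3) closed_X, of _ "u k - \<alpha> k *\<^sub>R d k"] p_in
      by (simp add: normal_cone_def p_def)
    from normal_cone_scale[OF this, of "1 / \<alpha> k"] show ?thesis
      using \<alpha>_pos[of k] by (simp add: X_eq[symmetric])
  qed
  define ny where "ny k = (1 / \<rho> k) *\<^sub>R (- fst (vi_op (\<rho> k) (\<sigma> k) (\<delta> k) (u k) (?y k, ?z k)))" for k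
  define nz where "nz k = (1 / \<rho> k) *\<^sub>R (- snd (vi_op (\<rho> k) (\<sigma> k) (\<delta> k) (u k) (?y k, ?z k)))" for k
  have normal_y: "ny k \<in> normal_cone {v. \<forall>i. g v $ i \<le> 0} (?y k)"
    and normal_z: "nz k \<in> normal_cone {v. \<forall>i. g v $ i \<le> 0} (?z k)" for k
    unfolding ny_def nz_def Y_eq[symmetric]
    using saddle_point_normal[OF a.u_in[of k] a.params(1)[of k] a.params(2)[of k] a.params(3)[of k]] a.params(1)[of k]
    by (auto simp only: sol fst_conv snd_conv intro!: normal_cone_scale divide_nonneg_pos zero_le_one)
  note lims = gradient_limits[OF a.u_in _ a.xb_in a.yb_in a.u_lim]
  have ny_eq: "ny k = (1 / \<rho> k) *\<^sub>R (Fy (u k) (?y k) - \<sigma> k *\<^sub>R ?z k - \<delta> k *\<^sub>R ?y k) - fy (u k) (?y k)" for k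
    using a.params(1)[of k] by (simp add: ny_def vi_op_def scaleR_diff_right scaleR_add_right)
  have "(\<lambda>k. (1 / \<rho> k) *\<^sub>R (Fy (u k) (?y k) - \<sigma> k *\<^sub>R ?z k - \<delta> k *\<^sub>R ?y k) - fy (u k) (?y k))
      \<longlonglongrightarrow> 0 *\<^sub>R (Fy xb yb - 0 *\<^sub>R yb - 0 *\<^sub>R yb) - fy xb yb"
    by (intro tendsto_intros lims a.ys_in a.ys_lim a.zs_lim a.inverse_\<rho>_lim a.\<sigma>_lim a.\<delta>_lim)
  then have "ny \<longlonglongrightarrow> - fy xb yb" unfolding ny_eq[symmetric] by simp
  from tendsto_eventually_norm_le[OF this] obtain Cy where Cy: "\<forall>\<^sub>F k in sequentially. norm (ny k) \<le> Cy" by blast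
  have nz_eq: "nz k = - fy (u k) (?z k) - ((1 / \<rho> k) * \<sigma> k) *\<^sub>R (?z k - ?y k)" for k
    using a.params(1)[of k] by (simp add: nz_def vi_op_def scaleR_diff_right scaleR_add_right)
  have "(\<lambda>k. - fy (u k) (?z k) - ((1 / \<rho> k) * \<sigma> k) *\<^sub>R (?z k - ?y k)) \<longlonglongrightarrow> - fy xb yb - (0 * 0) *\<^sub>R (yb - yb)"
    by (intro tendsto_intros lims a.zs_in a.ys_lim a.zs_lim a.inverse_\<rho>_lim a.\<sigma>_lim)
  then have "nz \<longlonglongrightarrow> - fy xb yb" unfolding nz_eq[symmetric] by simp
  from tendsto_eventually_norm_le[OF this] obtain Cz where Cz: "\<forall>\<^sub>F k in sequentially. norm (nz k) \<le> Cz" by blast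
  obtain C\<gamma> where C\<gamma>: "\<forall>\<^sub>F k in sequentially. norm (\<rho> k *\<^sub>R (?z k - ?y k)) \<le> C\<gamma>"
    using a.scaled_gap_bounded[OF ueb] by blast
  \<comment> \<open>The only critical term of \<open>d\<close> is \<rho> times a difference of
    gradients of \<open>f\<close>, bounded by \<open>L\<close> times the scaled gap
    \<open>\<rho> *\<^sub>R (z - y)\<close>.\<close>
  have "\<forall>\<^sub>F k in sequentially. norm (v k - d k) \<le> (norm (0 :: real^'n) + 1) + ((norm (Fx xb yb) + 1) + L * C\<gamma>)"
    using tendsto_eventually_norm_le[OF v_lim] tendsto_eventually_norm_le[OF lims(1)[OF a.ys_in a.ys_lim]] C\<gamma>
  proof eventually_elim
    case (elim k)
    have "norm (fx (u k) (?y k) - fx (u k) (?z k)) \<le> L * norm (?z k - ?y k)"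
      using lipschitz_gradients(3)[OF a.u_in a.u_in a.ys_in a.zs_in, of k k k k] by (simp add: norm_minus_commute)
    then have "\<rho> k * norm (fx (u k) (?y k) - fx (u k) (?z k)) \<le> \<rho> k * (L * norm (?z k - ?y k))"
      using a.params(1)[of k] by (intro mult_left_mono) auto
    also have "\<dots> = L * norm (\<rho> k *\<^sub>R (?z k - ?y k))" using a.params(1)[of k] by simp
    also have "\<dots> \<le> L * C\<gamma>" using elim(3) L_nonneg by (rule mult_left_mono)
    finally have "norm (\<rho> k *\<^sub>R (fx (u k) (?y k) - fx (u k) (?z k))) \<le> L * C\<gamma>" using a.params(1)[of k] by simp
    then have "norm (d k) \<le> (norm (Fx xb yb) + 1) + L * C\<gamma>"
      unfolding d_def phi_grad_def fst_conv snd_conv by (intro norm_triangle_le_diff add_mono elim(2))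
    then show ?case by (intro norm_triangle_le_diff add_mono elim(1))
  qed
  then obtain Cx where Cx: "\<forall>\<^sub>F k in sequentially. norm (v k - d k) \<le> Cx" by blast
  have mfcq': "\<pi> = 0" if "\<forall>i. 0 \<le> \<pi> $ i" "inner \<pi> (G xb) = 0" "\<forall>h. inner \<pi> (G' xb h) = 0" for \<pi>
  proof -
    have "inner (transpose (jacobian G (at xb)) *v \<pi>) h = 0" for h
      using transpose_jacobian_inner[OF G'] that(3) by simp
    then have "transpose (jacobian G (at xb)) *v \<pi> = 0" by (metis inner_eq_zero_iff)
    then show ?thesis using mfcq that unfolding upper_MFCQ_def by blast
  qed
  \<comment> \<open>Complementarity confines \<open>\<pi>\<close> to the active indices, where LICQ
    applies.\<close>
  have licq': "\<pi> = 0" if "\<forall>i. 0 \<le> \<pi> $ i" "inner \<pi> (g yb) = 0" "\<forall>h. inner \<pi> (g' yb h) = 0" for \<pi>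
  proof (rule lower_LICQ_D[OF licq g'])
    fix i assume "g yb $ i \<noteq> 0"
    then show "\<pi> $ i = 0"
      using complementarity_componentwise[of \<pi> "g yb" i] that(1,2) a.yb_in by (simp add: Y_eq)
  qed (use that(3) in blast)
  obtain Bx where Bx: "\<forall>\<^sub>F k in sequentially. \<exists>\<pi>. is_multiplier G G' (p k) (v k - d k) \<pi> \<and> norm \<pi> \<le> Bx"
    using multipliers_bounded[OF G_convex G' G'_cont mfcq' p_lim normal_x Cx] by blast
  obtain By where By: "\<forall>\<^sub>F k in sequentially. \<exists>\<mu>. is_multiplier g g' (?y k) (ny k) \<mu> \<and> norm \<mu> \<le> By"
    using multipliers_bounded[OF g_convex g' g'_cont licq' a.ys_lim normal_y Cy] by blast
  obtain Bz where Bz: "\<forall>\<^sub>F k in sequentially. \<exists>\<nu>. is_multiplier g g' (?z k) (nz k) \<nu> \<and> norm \<nu> \<le> Bz"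
    using multipliers_bounded[OF g_convex g' g'_cont licq' a.zs_lim normal_z Cz] by blast
  define Q where "Q k \<pi> \<mu> \<nu> \<longleftrightarrow> is_multiplier G G' (p k) (v k - d k) \<pi> \<and> norm \<pi> \<le> Bx \<and>
      is_multiplier g g' (?y k) (ny k) \<mu> \<and> norm \<mu> \<le> By \<and> is_multiplier g g' (?z k) (nz k) \<nu> \<and>
      norm (\<rho> k *\<^sub>R (?z k - ?y k)) \<le> C\<gamma>" for k \<pi> \<mu> \<nu>
  from Bx By Bz C\<gamma> have "\<forall>\<^sub>F k in sequentially. \<exists>\<pi> \<mu> \<nu>. Q k \<pi> \<mu> \<nu>"
    by eventually_elim (auto simp: Q_def)
  then obtain N where "\<And>k. N \<le> k \<Longrightarrow> \<exists>\<pi> \<mu> \<nu>. Q k \<pi> \<mu> \<nu>" by (auto simp: eventually_sequentially)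
  then have "\<forall>k. \<exists>\<pi> \<mu> \<nu>. Q (k + N) \<pi> \<mu> \<nu>" by simp
  then obtain \<pi> \<mu> \<nu> where "\<And>k. Q (k + N) (\<pi> k) (\<mu> k) (\<nu> k)" by metis
  then have \<pi>: "\<And>k. is_multiplier G G' (p (k + N)) (v (k + N) - d (k + N)) (\<pi> k)" "\<And>k. norm (\<pi> k) \<le> Bx"
    and \<mu>: "\<And>k. is_multiplier g g' (?y (k + N)) (ny (k + N)) (\<mu> k)" "\<And>k. norm (\<mu> k) \<le> By"
    and \<nu>: "\<And>k. is_multiplier g g' (?z (k + N)) (nz (k + N)) (\<nu> k)"
    and \<gamma>: "\<And>k. norm (\<rho> (k + N) *\<^sub>R (?z (k + N) - ?y (k + N))) \<le> C\<gamma>"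
    unfolding Q_def by blast+
  \<comment> \<open>One sequence in the product space yields a common subsequence.
    \<open>\<nu>\<close> is left out, since its limit is obtained from those of \<open>\<mu>\<close>
    and \<open>\<omega>\<close>. The shift by \<open>N\<close> skips the indices without bounded
    multipliers.\<close>
  define q where "q k = (\<pi> k, \<mu> k, \<rho> (k + N) *\<^sub>R (?z (k + N) - ?y (k + N)))" for k
  have "bounded (range q)"
    unfolding q_def using \<pi>(2) \<mu>(2) \<gamma>
    by (intro boundedI[of _ "Bx + (By + C\<gamma>)"]) (auto intro!: norm_Pair_le_add simp del: norm_scaleR)
  then obtain l r where r: "strict_mono r" and q: "(\<lambda>j. q (r j)) \<longlonglongrightarrow> l" by (rule bounded_subseq)
  define s where "s j = r j + N" for j
  have s: "strict_mono s" using r by (simp add: s_def[abs_def] strict_mono_def)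
  have sub: "(\<lambda>j. b (s j)) \<longlonglongrightarrow> c" if "b \<longlonglongrightarrow> c" for b :: "nat \<Rightarrow> 'z::topological_space" and c
    using LIMSEQ_subseq_LIMSEQ[OF that s] by (simp add: o_def)
  interpret k: kkt_seq X Y F f L G g G' g' g'' W f' f'' xb yb "\<lambda>j. u (s j)" "\<lambda>j. p (s j)" "\<lambda>j. v (s j)"
    "\<lambda>j. ?y (s j)" "\<lambda>j. ?z (s j)" "\<lambda>j. \<rho> (s j)" "\<lambda>j. \<sigma> (s j)" "\<lambda>j. \<delta> (s j)"
    "\<lambda>j. \<mu> (r j)" "\<lambda>j. \<nu> (r j)" "\<lambda>j. \<pi> (r j)" "fst (snd l)" "fst l" "snd (snd l)"
  proof unfold_locales
    show "(\<lambda>j. \<rho> (s j) *\<^sub>R (?z (s j) - ?y (s j))) \<longlonglongrightarrow> snd (snd l)"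
      "(\<lambda>j. \<mu> (r j)) \<longlonglongrightarrow> fst (snd l)" "(\<lambda>j. \<pi> (r j)) \<longlonglongrightarrow> fst l"
      using tendsto_snd[OF tendsto_snd[OF q]] tendsto_fst[OF tendsto_snd[OF q]] tendsto_fst[OF q]
      by (simp_all add: q_def s_def)
    show "is_multiplier g g' (?y (s j)) ((1 / \<rho> (s j)) *\<^sub>R (- fst (vi_op (\<rho> (s j)) (\<sigma> (s j)) (\<delta> (s j)) (u (s j)) (?y (s j), ?z (s j))))) (\<mu> (r j))" for j
      using \<mu>(1)[of "r j"] by (simp only: s_def ny_def)
    show "is_multiplier g g' (?z (s j)) ((1 / \<rho> (s j)) *\<^sub>R (- snd (vi_op (\<rho> (s j)) (\<sigma> (s j)) (\<delta> (s j)) (u (s j)) (?y (s j), ?z (s j))))) (\<nu> (r j))" for j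
      using \<nu>[of "r j"] by (simp only: s_def nz_def)
    show "is_multiplier G G' (p (s j)) (v (s j) - phi_grad (\<rho> (s j)) (u (s j)) (?y (s j), ?z (s j))) (\<pi> (r j))" for j
      using \<pi>(1)[of "r j"] by (simp only: s_def d_def)
  qed (rule a.u_in a.ys_in a.zs_in a.xb_in a.yb_in a.params sub a.inverse_\<rho>_lim a.\<sigma>_lim a.\<delta>_lim a.u_lim a.ys_lim a.zs_lim p_lim v_lim)+
  show ?thesis by (rule k.C_stationary_limit[OF licq a.pessimistic_optimal])
qed

end

section \<open>Application to the run of the algorithm\<close>

lemma pw_at_top: "0 < a \<Longrightarrow> filterlim (\<lambda>k. pw k a) at_top sequentially"
proof -
  assume a: "0 < a"
  have "filterlim (\<lambda>k. inverse (pw k (- a))) at_top sequentially"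
    using pw_tendsto_0[of "- a"] a by (intro filterlim_inverse_at_top) auto
  then show ?thesis by (simp add: pw_inverse)
qed

text \<open>The threshold \<open>c\<close> is chosen before \<open>\<beta>0\<close> and the
  iterates, so it depends only on the problem data and the other constants. Accumulation pairs are
  expressed by a further subsequence \<open>l\<close>, and the second half of the conclusion covers
  every subsequence with the stationarity property.\<close>

theorem theorem6:
  fixes X :: "(real^'n) set" and Y :: "(real^'m) set"
    and F f :: "(real^'n) \<times> (real^'m) \<Rightarrow> real"
    and \<alpha>0 \<sigma>0 \<delta>0 \<rho>0 s t :: real
    and \<alpha> \<sigma> \<delta> \<rho> :: "nat \<Rightarrow> real"
  assumes X: "X \<noteq> {}" "closed X" "convex X"
    and Y: "Y \<noteq> {}" "closed Y" "convex Y"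
    and A1_smooth: "C1_on F UNIV" "\<exists>L. L-lipschitz_on (X \<times> Y) (\<lambda>p. gradient F (at p))"
    and A1_concave: "\<And>x. x \<in> X \<Longrightarrow> concave_on Y (\<lambda>y. F (x, y))"
    and A1_coercive: "\<And>x. x \<in> X \<Longrightarrow>
          filterlim (\<lambda>y. F (x, y)) at_bot (inf at_infinity (principal Y))"
    and A2_smooth: "C1_on f UNIV" "\<exists>L. L-lipschitz_on (X \<times> Y) (\<lambda>p. gradient f (at p))"
    and A2_convex: "\<And>x. x \<in> X \<Longrightarrow> convex_on Y (\<lambda>y. f (x, y))"
    and A2_nonempty: "\<And>x. x \<in> X \<Longrightarrow> lower_sol Y f x \<noteq> {}"
    and A2_bounded: "\<And>Dx. Dx \<subseteq> X \<Longrightarrow> bounded Dx \<Longrightarrow>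
          \<exists>Dy. Dy \<subseteq> Y \<and> bounded Dy \<and> (\<forall>x\<in>Dx. lower_sol Y f x \<inter> Dy \<noteq> {})"
    and A4: "compact X"
    and phi_bounded_below: "bdd_below (pess_value Y F f ` X)"
    and pos: "\<alpha>0 > 0" "\<sigma>0 > 0" "\<delta>0 > 0" "\<rho>0 > 0" "s > 0" "t > 0"
    and exponents: "s > 7 * t" "s + 2 * t < 1"
    and \<alpha>: "\<And>k. \<alpha> k = \<alpha>0 * real (k + 1) powr (- s)"
    and \<sigma>: "\<And>k. \<sigma> k = \<sigma>0 * real (k + 1) powr (- t)"
    and \<delta>: "\<And>k. \<delta> k = \<delta>0 * real (k + 1) powr (- t)"
    and \<rho>: "\<And>k. \<rho> k = \<rho>0 * real (k + 1) powr t"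
  shows "\<exists>c>0. \<forall>\<beta>0 x y z.
    \<beta>0 > 0 \<and> \<beta>0 / \<sigma>0 < c \<and>
    SiPBA X Y F f \<alpha> (\<lambda>k. \<beta>0 * real (k + 1) powr (- 3 * t)) \<rho> \<sigma> \<delta> x y z \<longrightarrow>
      (\<exists>r. stationary_subseq X Y F f \<alpha> \<rho> \<sigma> \<delta> x y z r) \<and>
      (\<forall>r. stationary_subseq X Y F f \<alpha> \<rho> \<sigma> \<delta> x y z r \<longrightarrow>
        (\<forall>xb yb l. \<forall>(G :: real^'n \<Rightarrow> real^'q) (g :: real^'m \<Rightarrow> real^'p).
           strict_mono l \<and>
           (\<lambda>j. let k = r (l j)
                in (x k, fst (saddle_point Y F f (\<rho> k) (\<sigma> k) (\<delta> k) (x k)))) \<longlonglongrightarrow> (xb, yb) \<and>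
           X = {u. \<forall>i. G u $ i \<le> 0} \<and> C1_on G UNIV \<and> (\<forall>i. convex_on UNIV (\<lambda>u. G u $ i)) \<and>
           Y = {v. \<forall>i. g v $ i \<le> 0} \<and> C2_on g UNIV \<and> (\<forall>i. convex_on UNIV (\<lambda>v. g v $ i)) \<and>
           inner_semicontinuous_at X (lower_sol Y f) xb \<and>
           (\<exists>W. open W \<and> (xb, yb) \<in> W \<and> C2_on f W) \<and>
           upper_MFCQ G xb \<and> lower_LICQ g yb \<and> uniform_error_bound X Y f xb yb \<longrightarrow>
             (\<lambda>j. x (r (l j))) \<longlonglongrightarrow> xb \<and>
             (\<lambda>j. (y (r (l j)), z (r (l j)))) \<longlonglongrightarrow> (yb, yb) \<and>
             yb \<in> pess_sol Y F f xb \<and>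
             C_stationary X Y F f G g xb))"
proof -
  obtain L1 L2 where lip: "L1-lipschitz_on (X \<times> Y) (\<lambda>p. gradient F (at p))" "L2-lipschitz_on (X \<times> Y) (\<lambda>p. gradient f (at p))"
    using A1_smooth(2) A2_smooth(2) by blast
  define L where "L = max L1 L2"
  interpret bilevel_data X Y F f L
  proof
    show "(F has_derivative (\<lambda>h. inner h (gradient F (at p)))) (at p)" for p
      using A1_smooth(1) has_derivative_gradient unfolding C1_on_def by blast
    show "(f has_derivative (\<lambda>h. inner h (gradient f (at p)))) (at p)" for p
      using A2_smooth(1) has_derivative_gradient unfolding C1_on_def by blast
    show "L-lipschitz_on (X \<times> Y) (\<lambda>p. gradient F (at p))" "L-lipschitz_on (X \<times> Y) (\<lambda>p. gradient f (at p))"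
      using lip by (auto simp: L_def intro: lipschitz_on_le)
    obtain Dy where Dy: "bounded Dy" "\<forall>x\<in>X. lower_sol Y f x \<inter> Dy \<noteq> {}"
      using A2_bounded[OF subset_refl compact_imp_bounded[OF A4]] by blast
    obtain R where "\<forall>v\<in>Dy. norm v \<le> R" using Dy(1) by (auto simp: bounded_iff)
    with Dy(2) show "\<exists>R. \<forall>x\<in>X. \<exists>v\<in>lower_sol Y f x. norm v \<le> R" by (intro exI[of _ R]) blast
  qed (use X Y A4 A1_concave A2_convex A1_coercive in auto)
  define C where "C = L + 2 * \<rho>0 * L + 3 * \<sigma>0 + \<delta>0"
  have C: "0 < C" using L_nonneg pos by (simp add: C_def add_nonneg_pos)
  have pw: "\<alpha> k = \<alpha>0 * pw k (- s)" "\<sigma> k = \<sigma>0 * pw k (- t)" "\<delta> k = \<delta>0 * pw k (- t)" "\<rho> k = \<rho>0 * pw k t" for k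
    by (simp_all add: \<alpha> \<sigma> \<delta> \<rho> pw_def)
  have params: "0 < \<alpha> k" "0 < \<rho> k" "0 < \<sigma> k" "0 < \<delta> k" for k using pos by (simp_all add: pw)
  show ?thesis
  proof (rule exI, intro conjI allI impI; (elim conjE)?)
    \<comment> \<open>Dividing by \<open>\<sigma>0\<close> turns the bound on
      \<open>\<beta>0 / \<sigma>0\<close> into the step-size condition
      \<open>\<beta>0 * C\<^sup>2 \<le> min \<sigma>0 \<delta>0\<close>.\<close>
    show "0 < min \<sigma>0 \<delta>0 / (C\<^sup>2 * \<sigma>0)" using C pos by simp
  next
    fix \<beta>0 x y z
    assume b: "0 < \<beta>0" "\<beta>0 / \<sigma>0 < min \<sigma>0 \<delta>0 / (C\<^sup>2 * \<sigma>0)"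
      and run: "SiPBA X Y F f \<alpha> (\<lambda>k. \<beta>0 * real (k + 1) powr (- 3 * t)) \<rho> \<sigma> \<delta> x y z"
    have bC: "\<beta>0 * C\<^sup>2 \<le> min \<sigma>0 \<delta>0"
      using b C pos by (simp add: field_simps)
    interpret sipba X Y F f L \<alpha>0 \<sigma>0 \<delta>0 \<rho>0 \<beta>0 s t \<alpha> \<sigma> \<delta> \<rho> "\<lambda>k. \<beta>0 * real (k + 1) powr (- 3 * t)" x y z
    proof unfold_locales
    qed (use bC pos b exponents pw run in \<open>simp_all add: C_def pw_def\<close>)
    show "\<exists>r. stationary_subseq X Y F f \<alpha> \<rho> \<sigma> \<delta> x y z r" by (rule stationary_subseq_exists)
  next
    fix \<beta>0 x y z r xb yb l
    fix G :: "real^'n \<Rightarrow> real^'q" and g :: "real^'m \<Rightarrow> real^'p"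
    assume run: "SiPBA X Y F f \<alpha> (\<lambda>k. \<beta>0 * real (k + 1) powr (- 3 * t)) \<rho> \<sigma> \<delta> x y z"
      and r: "stationary_subseq X Y F f \<alpha> \<rho> \<sigma> \<delta> x y z r"
      and l: "strict_mono l" and acc: "(\<lambda>j. let k = r (l j)
                in (x k, fst (saddle_point Y F f (\<rho> k) (\<sigma> k) (\<delta> k) (x k)))) \<longlonglongrightarrow> (xb, yb)"
      and sets: "X = {u. \<forall>i. G u $ i \<le> 0}" "Y = {v. \<forall>i. g v $ i \<le> 0}"
      and smooth: "C1_on G UNIV" "C2_on g UNIV" "\<exists>W. open W \<and> (xb, yb) \<in> W \<and> C2_on f W"
      and conv: "\<forall>i. convex_on UNIV (\<lambda>u. G u $ i)" "\<forall>i. convex_on UNIV (\<lambda>v. g v $ i)"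
      and isc: "inner_semicontinuous_at X (lower_sol Y f) xb"
      and cq: "upper_MFCQ G xb" "lower_LICQ g yb" "uniform_error_bound X Y f xb yb"
    define q where "q j = r (l j)" for j
    have "strict_mono r" using r by (simp add: stationary_subseq_def)
    from strict_mono_o[OF this l] have q: "strict_mono q" by (simp add: q_def[abs_def] o_def)
    have sub: "(\<lambda>j. b (q j)) \<longlonglongrightarrow> c" if "b \<longlonglongrightarrow> c" for b :: "nat \<Rightarrow> 'z::topological_space" and c
      using LIMSEQ_subseq_LIMSEQ[OF that q] by (simp add: o_def)
    have sub': "(\<lambda>j. b (q j)) \<longlonglongrightarrow> c" if "(\<lambda>j. b (r j)) \<longlonglongrightarrow> c" for b :: "nat \<Rightarrow> 'z::topological_space" and c
      using LIMSEQ_subseq_LIMSEQ[OF that l] by (simp add: o_def q_def)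
    have x_in: "x k \<in> X" for k
      using run closest_point_in_set[OF closed_X X(1)] by (cases k) (auto simp: SiPBA_def Let_def)
    have pair: "(\<lambda>j. (x (q j), fst (saddle_point Y F f (\<rho> (q j)) (\<sigma> (q j)) (\<delta> (q j)) (x (q j))))) \<longlonglongrightarrow> (xb, yb)"
      using acc by (simp add: Let_def q_def)
    have z0: "(\<lambda>k. c * pw k (- e)) \<longlonglongrightarrow> 0" if "0 < e" for c e
      using tendsto_mult_right_zero[OF pw_tendsto_0[of "- e"], of c] that by simp
    interpret a: approx_seq X Y F f L "\<lambda>j. x (q j)" "\<lambda>j. \<rho> (q j)" "\<lambda>j. \<sigma> (q j)" "\<lambda>j. \<delta> (q j)" xb yb
    proof unfold_locales
      have "filterlim \<rho> at_top sequentially"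
        using filterlim_tendsto_pos_mult_at_top[OF tendsto_const pos(4) pw_at_top[OF pos(6)]] by (simp add: pw(4)[abs_def])
      from filterlim_compose[OF this filterlim_subseq[OF q]]
      show "filterlim (\<lambda>j. \<rho> (q j)) at_top sequentially" .
      show "(\<lambda>j. \<sigma> (q j)) \<longlonglongrightarrow> 0" "(\<lambda>j. \<delta> (q j)) \<longlonglongrightarrow> 0"
        using sub[OF z0[OF pos(6)]] by (simp_all add: pw)
      show "(\<lambda>j. x (q j)) \<longlonglongrightarrow> xb"
        "(\<lambda>j. fst (saddle_point Y F f (\<rho> (q j)) (\<sigma> (q j)) (\<delta> (q j)) (x (q j)))) \<longlonglongrightarrow> yb"
        using tendsto_fst[OF pair] tendsto_snd[OF pair] by simp_all
    qed (use x_in params isc in auto)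
    show "(\<lambda>j. x (r (l j))) \<longlonglongrightarrow> xb" using a.u_lim by (simp add: q_def)
    have "(\<lambda>j. (y (q j), z (q j)) - (a.ys j, a.zs j)) \<longlonglongrightarrow> 0"
      using sub'[of "\<lambda>k. (y k, z k) - saddle_point Y F f (\<rho> k) (\<sigma> k) (\<delta> k) (x k)" 0] r
      by (simp add: stationary_subseq_def a.ys_def a.zs_def del: diff_Pair)
    from tendsto_add[OF this tendsto_Pair[OF a.ys_lim a.zs_lim]]
    show "(\<lambda>j. (y (r (l j)), z (r (l j)))) \<longlonglongrightarrow> (yb, yb)" by (simp add: q_def)
    show "yb \<in> pess_sol Y F f xb" by (rule a.pessimistic_optimal)
    obtain G' where G': "\<And>u. (G has_derivative blinfun_apply (G' u)) (at u)" "continuous_on UNIV G'"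
      using smooth(1) unfolding C1_on_def by blast
    obtain g' g'' where g': "\<And>v. (g has_derivative blinfun_apply (g' v)) (at v)"
      and g'': "\<And>v. (g' has_derivative blinfun_apply (g'' v)) (at v)" "continuous_on UNIV g''"
      using smooth(2) unfolding C2_on_def C1_on_def by blast
    obtain W where W: "open W" "(xb, yb) \<in> W" and "C2_on f W" using smooth(3) by blast
    then obtain f' f'' where f': "\<And>p. p \<in> W \<Longrightarrow> (f has_derivative blinfun_apply (f' p)) (at p)"
      and f'': "\<And>p. p \<in> W \<Longrightarrow> (f' has_derivative blinfun_apply (f'' p)) (at p)" "continuous_on W f''"
      unfolding C2_on_def C1_on_def by blast
    interpret c: constrained X Y F f L G g G' g' g'' W f' f'' xb yb
      by unfold_locales (fact sets | use conv G' g' g'' W f' f'' in blast)+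
    show "C_stationary X Y F f G g xb"
    proof (rule c.C_stationary_of_approx_seq[OF a.approx_seq_axioms _ _ _ cq])
      show "(\<lambda>j. \<alpha> (q j)) \<longlonglongrightarrow> 0" using sub[OF z0[OF pos(5)]] by (simp add: pw)
      show "(\<lambda>j. proj_grad_map X Y F f (\<alpha> (q j)) (\<rho> (q j)) (\<sigma> (q j)) (\<delta> (q j)) (x (q j))) \<longlonglongrightarrow> 0"
        using sub'[of "\<lambda>k. proj_grad_map X Y F f (\<alpha> k) (\<rho> k) (\<sigma> k) (\<delta> k) (x k)" 0] r
        by (simp add: stationary_subseq_def)
    qed (use params in blast)
  qed
qed

end
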